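(* Let $X\subset\mathbb{P}^r$ be an irreducible non-degenerate projective variety, let $k\ge 0$ and $s\ge 1$ be integers with $s-1\le r$, and put $w=\min\{k,s-1\}$. Then $$\dim\sigma_s(Seg(\mathbb{P}^k\times X))=\dim GS_X(w,s)+(w+1)(k+1)-1.$$
   Context: Everything is over an algebraically closed field $K$ of characteristic $0$. Let $N=rk+r+k=(k+1)(r+1)-1$. The Segre variety $Seg(\mathbb{P}^k\times X)\subset\mathbb{P}^N$ is the image of the Segre embedding $\varphi:\mathbb{P}^k\times X\to\mathbb{P}^N$, $\varphi(\Lambda,P)=(\lambda_ix_j)_{0\le i\le k,\,0\le j\le r}$ for $\Lambda=(\lambda_0,\dots,\lambda_k)$ and $P=(x_0,\dots,x_r)$. For an irreducible non-degenerate projective variety $Y\subset\mathbb{P}^m$, the $s$-th secant variety $\sigma_s(Y)\subset\mathbb{P}^m$ is the Zariski closure of the union of all linear spans $\langle P_1,\dots,P_s\rangle$ of $s$ distinct points of $Y$. For integers $0\le w\le s-1\le m$, the $(w,s)$-Grassmann secant variety $GS_Y(w,s)$ is the Zariski closure in the Grassmannian $\mathbb{G}(w,m)$ (of $w$-dimensional linear subspaces of $\mathbb{P}^m$) of the set of those $\Lambda\in\mathbb{G}(w,m)$ that lie in the linear span of $s$ (linearly) independent points of $Y$. *)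

theory Defs
  imports "HOL-Analysis.Analysis" "HOL-Library.Poly_Mapping"
begin

text \<open>
  The space \<open>K\<^sup>m\<^sup>+\<^sup>1\<close> is \<open>'a ^ 'n\<close> with \<open>CARD('n) = m + 1\<close>. A linear subspace of projective \<open>m\<close>-space
  is identified with its affine cone, a vector subspace of \<open>'a ^ 'n\<close>; in particular a point of
  projective space is a one-dimensional vector subspace.
\<close>

definition grassmannian :: "nat \<Rightarrow> ('a::field ^ 'n) set set" where
  "grassmannian w = {L. vec.subspace L \<and> vec.dim L = w + 1}"

abbreviation proj_space :: "('a::field ^ 'n) set set" where
  "proj_space \<equiv> grassmannian 0"

definition lin_span :: "('a::field ^ 'n) set set \<Rightarrow> ('a ^ 'n) set" where
  "lin_span S = vec.span (\<Union>S)"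


section \<open>Homogeneous polynomials\<close>

text \<open>Polynomials with coefficients in \<open>'a\<close> and variables indexed by \<open>'v\<close>.\<close>

type_synonym ('v, 'a) mpoly = "('v \<Rightarrow>\<^sub>0 nat) \<Rightarrow>\<^sub>0 'a"

definition mpoly_eval :: "('v, 'a::comm_ring_1) mpoly \<Rightarrow> ('v \<Rightarrow> 'a) \<Rightarrow> 'a" where
  "mpoly_eval F x =
     (\<Sum>m\<in>Poly_Mapping.keys F. Poly_Mapping.lookup F m *
        (\<Prod>v\<in>Poly_Mapping.keys m. x v ^ Poly_Mapping.lookup m v))"

definition homogeneous :: "('v, 'a::zero) mpoly \<Rightarrow> bool" where
  "homogeneous F \<longleftrightarrow>
     (\<exists>d. \<forall>m\<in>Poly_Mapping.keys F. (\<Sum>v\<in>Poly_Mapping.keys m. Poly_Mapping.lookup m v) = d)"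


section \<open>Zariski topologies\<close>

text \<open>
  The complements of the hypersurfaces \<open>F = 0\<close> generate the topology, so the closed sets are exactly
  the common zero loci of sets of homogeneous polynomials. By homogeneity the choice of the
  representative \<open>x\<close> is immaterial.
\<close>

definition proj_nonzero_locus :: "('n, 'a::field) mpoly \<Rightarrow> ('a ^ 'n) set set" where
  "proj_nonzero_locus F =
     {P \<in> proj_space. \<exists>x. P = vec.span {x} \<and> mpoly_eval F (\<lambda>i. x $ i) \<noteq> 0}"

definition proj_zariski :: "('a::field ^ 'n) set topology" where
  "proj_zariski = topology_generated_by {proj_nonzero_locus F | F. homogeneous F}"

text \<open>
  The Pluecker coordinates of the subspace spanned by \<open>b 0, \<dots>, b w\<close> are the maximal minors of the
  matrix with these rows. They are indexed by all lists \<open>J\<close> of \<open>w + 1\<close> columns rather than by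
  increasing ones only; the additional coordinates are \<open>0\<close> or agree up to sign with one of the
  usual coordinates, so they do not affect the induced topology. Lists of any other length are
  irrelevant indices and get the value \<open>0\<close>. The minor is written out since \<^const>\<open>det\<close> only covers
  matrices whose size is a type.
\<close>

definition plucker :: "nat \<Rightarrow> (nat \<Rightarrow> 'a::field ^ 'n) \<Rightarrow> 'n list \<Rightarrow> 'a" where
  "plucker w b J =
     (if length J = w + 1
      then (\<Sum>p | p permutes {..w}. of_int (sign p) * (\<Prod>i\<le>w. b i $ (J ! p i)))
      else 0)"

definition grass_nonzero_locus :: "nat \<Rightarrow> ('n list, 'a::field) mpoly \<Rightarrow> ('a ^ 'n) set set" where
  "grass_nonzero_locus w F =
     {L \<in> grassmannian w. \<exists>b. L = vec.span (b ` {..w}) \<and> mpoly_eval F (plucker w b) \<noteq> 0}"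

definition grass_zariski :: "nat \<Rightarrow> ('a::field ^ 'n) set topology" where
  "grass_zariski w = topology_generated_by {grass_nonzero_locus w F | F. homogeneous F}"


section \<open>Irreducibility and dimension\<close>

definition irreducible_in :: "'p topology \<Rightarrow> 'p set \<Rightarrow> bool" where
  "irreducible_in T S \<longleftrightarrow> S \<subseteq> topspace T \<and> S \<noteq> {} \<and>
     (\<forall>A B. closedin T A \<and> closedin T B \<and> S \<subseteq> A \<union> B \<longrightarrow> S \<subseteq> A \<or> S \<subseteq> B)"

text \<open>
  Krull dimension: the supremum of the lengths \<open>n\<close> of chains \<open>C 0 \<subset> \<dots> \<subset> C n\<close> of irreducible closed
  subsets. (The empty space gets dimension \<open>0\<close>.)
\<close>

definition krull_dim :: "'p topology \<Rightarrow> enat" where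
  "krull_dim T = Sup {enat n | n. \<exists>C. (\<forall>i\<le>n. closedin T (C i) \<and> irreducible_in T (C i)) \<and>
                                       (\<forall>i<n. C i \<subset> C (i + 1))}"

abbreviation proj_dim :: "('a::field ^ 'n) set set \<Rightarrow> enat" where
  "proj_dim Y \<equiv> krull_dim (subtopology proj_zariski Y)"

abbreviation grass_dim :: "nat \<Rightarrow> ('a::field ^ 'n) set set \<Rightarrow> enat" where
  "grass_dim w Y \<equiv> krull_dim (subtopology (grass_zariski w) Y)"


section \<open>Projective varieties, Segre varieties and secant varieties\<close>

definition irreducible_projective_variety :: "('a::field ^ 'n) set set \<Rightarrow> bool" where
  "irreducible_projective_variety X \<longleftrightarrow> closedin proj_zariski X \<and> irreducible_in proj_zariski X"

text \<open>Non-degenerate: not contained in a hyperplane.\<close>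

definition nondegenerate :: "('a::field ^ 'n) set set \<Rightarrow> bool" where
  "nondegenerate X \<longleftrightarrow>
     \<not> (\<exists>H. vec.subspace H \<and> vec.dim H + 1 = CARD('n) \<and> (\<forall>P\<in>X. P \<subseteq> H))"

definition segre_point :: "('a::field ^ 'k) set \<Rightarrow> ('a ^ 'r) set \<Rightarrow> ('a ^ ('k::finite \<times> 'r::finite)) set" where
  "segre_point L P = vec.span {\<chi> ij. l $ fst ij * x $ snd ij | l x. l \<in> L \<and> x \<in> P}"

definition segre :: "('a::field ^ 'r) set set \<Rightarrow> ('a ^ ('k::finite \<times> 'r::finite)) set set" where
  "segre X = (\<lambda>(L, P). segre_point L P) ` (proj_space \<times> X)"

definition secant_variety :: "nat \<Rightarrow> ('a::field ^ 'n) set set \<Rightarrow> ('a ^ 'n) set set" where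
  "secant_variety s Y =
     proj_zariski closure_of
       {Q \<in> proj_space. \<exists>S. S \<subseteq> Y \<and> finite S \<and> card S = s \<and> Q \<subseteq> lin_span S}"

text \<open>Points are linearly independent if vectors representing them are.\<close>

definition independent_points :: "('a::field ^ 'n) set set \<Rightarrow> bool" where
  "independent_points S \<longleftrightarrow>
     (\<exists>v. (\<forall>P\<in>S. P = vec.span {v P}) \<and> inj_on v S \<and> vec.independent (v ` S))"

definition grassmann_secant_variety ::
    "nat \<Rightarrow> nat \<Rightarrow> ('a::field ^ 'n) set set \<Rightarrow> ('a ^ 'n) set set" where
  "grassmann_secant_variety w s Y =
     grass_zariski w closure_of
       {L \<in> grassmannian w. \<exists>S. S \<subseteq> Y \<and> finite S \<and> card S = s \<and> independent_points S \<and>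
                                L \<subseteq> lin_span S}"

end

theory Submission
  imports Defs "HOL-Library.Function_Algebras" "Jordan_Normal_Form.Determinant"
begin

text \<open>
  Write \<open>\<sigma>\<close> for the secant variety and \<open>GS\<close> for the Grassmann secant variety. A point of \<open>\<sigma>\<close> is a matrix
  \<open>M = \<Sum>\<^sub>i \<lambda>\<^sub>i \<otimes> x\<^sub>i\<close> with \<open>x\<^sub>i\<close> on the cone over \<open>X\<close>; for a generic \<open>M\<close> the row space is a point of \<open>GS\<close>, and
  the matrices with rows in a given \<open>L\<close> form a linear space of affine dimension \<open>c = (w + 1)(k + 1)\<close>.

  Chains in \<open>GS\<close> therefore lift to \<open>\<sigma>\<close> as the matrices with rows in a member of \<open>C\<^sub>i\<close>, and below the
  lift of \<open>C\<^sub>0\<close> there is room for a flag of \<open>c - 1\<close> linear subspaces of one fibre. This gives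
  \<open>dim \<sigma> \<ge> dim GS + c - 1\<close>.

  Conversely, passing to a proper irreducible closed subset lowers the order of growth of the Hilbert
  function, so a growth of order \<open>n\<^sup>e\<close> bounds the Krull dimension by \<open>e\<close>. Over an affine chart \<open>V\<close> of
  \<open>GS\<close> a generic \<open>M\<close> is a product \<open>A y\<close> with \<open>y \<in> V\<close>, whence the growth of \<open>\<sigma>\<close> has order at most
  \<open>d + c - 1\<close>, where the coordinate ring of \<open>V\<close> has a transcendence basis of \<open>d\<close> coordinates.
  Finally such a basis yields a chain of \<open>d + 1\<close> prime ideals: specializing one basis coordinate to a
  generic constant keeps the others independent, because zeros of an ideal over the basis coordinates
  extend generically to all coordinates.
\<close>

text \<open>Chains in \<open>GS\<close> are bounded only through \<open>sec\<close>. With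
  \<open>d\<close> the size of a transcendence basis on a chart, three facts close a circle:
  \<open>GS\<close> has a chain of length \<open>d\<close>; a chain of length \<open>n\<close> in
  \<open>GS\<close> lifts to one of length \<open>n + c - 1\<close> in \<open>sec\<close>; no chain
  in \<open>sec\<close> is longer than \<open>d + c - 1\<close>. Lifting an arbitrary chain of
  \<open>GS\<close> then forces \<open>n \<le> d\<close>.

  The value of \<open>w\<close> makes matrices and row spaces correspond: a sum of \<open>s\<close>
  rank-one matrices with \<open>k + 1\<close> rows has generic rank \<open>min (k + 1) s\<close>,
  namely \<open>w + 1\<close>. The term \<open>c - 1\<close> is the projective dimension of the
  space of matrices whose \<open>k + 1\<close> rows lie in a fixed \<open>L\<close>.

  A mismatch between the two definitions shapes the middle part: points of \<open>sec0\<close> may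
  come from dependent points of \<open>X\<close>, while \<open>GS0\<close> asks for independent
  ones. Both are therefore compared with a common irreducible parameter space, on which independence
  is a nonvanishing condition. Membership in a closure is always tested by finitely many forms that
  are nonzero at the given point.\<close>

no_notation vec_index (infixl "$" 100)
hide_const (open) Matrix.vec Matrix.row Matrix.col
hide_type (open) Matrix.vec

section \<open>Polynomial functions\<close>

text \<open>
  As the field is infinite, polynomials are represented by the functions they induce. The predicates
  \<open>pold B n\<close> and \<open>homf B n\<close> stand for degree at most \<open>n\<close> and homogeneous of degree \<open>n\<close>, in the
  variables \<open>B\<close>.
\<close>

inductive pold :: "'v set \<Rightarrow> nat \<Rightarrow> (('v \<Rightarrow> 'a::comm_ring_1) \<Rightarrow> 'a) \<Rightarrow> bool" for B where
  const: "pold B n (\<lambda>x. c)"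
| var: "pold B n f \<Longrightarrow> v \<in> B \<Longrightarrow> pold B (Suc n) (\<lambda>x. x v * f x)"
| add: "pold B n f \<Longrightarrow> pold B n g \<Longrightarrow> pold B n (\<lambda>x. f x + g x)"

inductive homf :: "'v set \<Rightarrow> nat \<Rightarrow> (('v \<Rightarrow> 'a::comm_ring_1) \<Rightarrow> 'a) \<Rightarrow> bool" for B where
  zero: "homf B n (\<lambda>x. 0)"
| const: "homf B 0 (\<lambda>x. c)"
| var: "homf B n f \<Longrightarrow> v \<in> B \<Longrightarrow> homf B (Suc n) (\<lambda>x. x v * f x)"
| add: "homf B n f \<Longrightarrow> homf B n g \<Longrightarrow> homf B n (\<lambda>x. f x + g x)"

definition polf :: "'v set \<Rightarrow> (('v \<Rightarrow> 'a::comm_ring_1) \<Rightarrow> 'a) \<Rightarrow> bool" where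
  "polf B f \<longleftrightarrow> (\<exists>n. pold B n f)"

lemma pold_mono: "pold B n f \<Longrightarrow> n \<le> m \<Longrightarrow> B \<subseteq> C \<Longrightarrow> pold C m f"
proof (induction arbitrary: m rule: pold.induct)
  case (const n c) then show ?case by (auto intro: pold.const)
next
  case (var n f v)
  then obtain m' where m: "m = Suc m'" "n \<le> m'" by (cases m) auto
  then show ?case using var by (auto intro!: pold.var)
next
  case (add n f g) then show ?case by (auto intro!: pold.add)
qed

lemma pold_scale: "pold B n f \<Longrightarrow> pold B n (\<lambda>x. c * f x)"
proof (induction rule: pold.induct)
  case (const n d) show ?case by (rule pold.const)
next
  case (var n f v)
  from pold.var[OF var.IH var.hyps(2)] show ?case by (simp add: mult.left_commute)
next
  case (add n f g)
  from pold.add[OF add.IH] show ?case by (simp add: distrib_left)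
qed

lemma pold_mult: "pold B n f \<Longrightarrow> pold B m g \<Longrightarrow> pold B (n + m) (\<lambda>x. f x * g x)"
proof (induction rule: pold.induct)
  case (const n c)
  then show ?case using pold_mono[OF pold_scale[OF const], of "n + m" B c] by simp
next
  case (var n f v)
  then show ?case using pold.var[OF var.IH var.hyps(2)] by (simp add: mult.assoc)
next
  case (add n f g)
  then show ?case using pold.add by (fastforce simp: distrib_right)
qed

lemma pold_sum: "(\<And>i. i \<in> I \<Longrightarrow> pold B n (f i)) \<Longrightarrow> pold B n (\<lambda>x. \<Sum>i\<in>I. f i x)"
  by (induction I rule: infinite_finite_induct) (auto intro: pold.const pold.add)

lemma pold_power: "pold B n f \<Longrightarrow> pold B (j * n) (\<lambda>x. f x ^ j)"
  by (induction j) (auto intro: pold.const dest: pold_mult)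

lemma pold_coord: "v \<in> B \<Longrightarrow> pold B 1 (\<lambda>x. x v)"
  using pold.var[OF pold.const[of B 0 1], of v] by simp

lemma polf_const [intro, simp]: "polf B (\<lambda>x. c)"
  unfolding polf_def using pold.const by blast

lemma polf_coord: "v \<in> B \<Longrightarrow> polf B (\<lambda>x. x v)"
  unfolding polf_def by (rule exI) (rule pold_coord)

lemma polf_add: "polf B f \<Longrightarrow> polf B g \<Longrightarrow> polf B (\<lambda>x. f x + g x)"
proof -
  assume "polf B f" "polf B g"
  then obtain n m where "pold B n f" "pold B m g" unfolding polf_def by blast
  then have "pold B (max n m) f" "pold B (max n m) g" by (auto intro: pold_mono)
  from pold.add[OF this] show ?thesis unfolding polf_def by (rule exI)
qed

lemma polf_mult: "polf B f \<Longrightarrow> polf B g \<Longrightarrow> polf B (\<lambda>x. f x * g x)"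
  unfolding polf_def using pold_mult by blast

lemma polf_scale: "polf B f \<Longrightarrow> polf B (\<lambda>x. c * f x)"
  unfolding polf_def using pold_scale by blast

lemma polf_diff: "polf B f \<Longrightarrow> polf B g \<Longrightarrow> polf B (\<lambda>x. f x - g x)"
  using polf_add[of B f "\<lambda>x. - 1 * g x"] polf_scale[of B g "-1"] by simp

lemma polf_mono: "polf B f \<Longrightarrow> B \<subseteq> C \<Longrightarrow> polf C f"
  unfolding polf_def using pold_mono by blast

lemma polf_sum: "(\<And>i. i \<in> I \<Longrightarrow> polf B (f i)) \<Longrightarrow> polf B (\<lambda>x. \<Sum>i\<in>I. f i x)"
  by (induction I rule: infinite_finite_induct) (auto intro: polf_add)

lemma polf_prod: "(\<And>i. i \<in> I \<Longrightarrow> polf B (f i)) \<Longrightarrow> polf B (\<lambda>x. \<Prod>i\<in>I. f i x)"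
  by (induction I rule: infinite_finite_induct) (auto intro: polf_mult)

lemma polf_power: "polf B f \<Longrightarrow> polf B (\<lambda>x. f x ^ j)"
  by (induction j) (auto intro: polf_mult)

lemma polf_induct [consumes 1, case_names const var add]:
  assumes "polf B f" "\<And>c. P (\<lambda>x. c)" "\<And>f v. polf B f \<Longrightarrow> P f \<Longrightarrow> v \<in> B \<Longrightarrow> P (\<lambda>x. x v * f x)"
    "\<And>f g. polf B f \<Longrightarrow> polf B g \<Longrightarrow> P f \<Longrightarrow> P g \<Longrightarrow> P (\<lambda>x. f x + g x)"
  shows "P f"
proof -
  obtain n where "pold B n f" using assms(1) polf_def by blast
  then show ?thesis
  proof (induction rule: pold.induct)
    case (const n c) show ?case by (rule assms(2))
  next
    case (var n f v) then show ?case using assms(3) polf_def by blast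
  next
    case (add n f g) then show ?case using assms(4) polf_def by blast
  qed
qed

lemma polf_subst: "polf B f \<Longrightarrow> (\<And>v. v \<in> B \<Longrightarrow> polf C (g v)) \<Longrightarrow> polf C (\<lambda>x. f (\<lambda>v. g v x))"
  by (induction rule: polf_induct) (auto intro: polf_add polf_mult)

lemma polf_cong: "polf B f \<Longrightarrow> (\<And>v. v \<in> B \<Longrightarrow> x v = y v) \<Longrightarrow> f x = f y"
  by (induction rule: polf_induct) auto

lemma hom_cong: "homf B n f \<Longrightarrow> (\<And>v. v \<in> B \<Longrightarrow> x v = y v) \<Longrightarrow> f x = f y"
  by (induction rule: homf.induct) auto

lemma hom_pold: "homf B n f \<Longrightarrow> pold B n f"
  by (induction rule: homf.induct) (auto intro: pold.intros)

lemma hom_polf: "homf B n f \<Longrightarrow> polf B f"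
  unfolding polf_def using hom_pold by blast

lemma hom_scale: "homf B n f \<Longrightarrow> homf B n (\<lambda>x. c * f x)"
proof (induction rule: homf.induct)
  case (var n f v)
  from homf.var[OF var.IH var.hyps(2)] show ?case by (simp add: mult.left_commute)
next
  case (add n f g)
  from homf.add[OF add.IH] show ?case by (simp add: distrib_left)
qed (auto intro: homf.intros)

lemma hom_mult: "homf B n f \<Longrightarrow> homf B m g \<Longrightarrow> homf B (n + m) (\<lambda>x. f x * g x)"
proof (induction rule: homf.induct)
  case (var n f v)
  then show ?case using homf.var[OF var.IH var.hyps(2)] by (simp add: mult.assoc)
next
  case (add n f g)
  then show ?case using homf.add by (fastforce simp: distrib_right)
qed (auto intro: homf.intros hom_scale)

lemma hom_sum: "(\<And>i. i \<in> I \<Longrightarrow> homf B n (f i)) \<Longrightarrow> homf B n (\<lambda>x. \<Sum>i\<in>I. f i x)"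
  by (induction I rule: infinite_finite_induct) (auto intro: homf.intros)

lemma hom_prod: "finite I \<Longrightarrow> (\<And>i. i \<in> I \<Longrightarrow> homf B (d i) (f i)) \<Longrightarrow> homf B (sum d I) (\<lambda>x. \<Prod>i\<in>I. f i x)"
  by (induction I rule: finite_induct) (auto intro: homf.const hom_mult)

lemma hom_power: "homf B n f \<Longrightarrow> homf B (j * n) (\<lambda>x. f x ^ j)"
  by (induction j) (auto intro: homf.const dest: hom_mult)

lemma hom_coord: "v \<in> B \<Longrightarrow> homf B 1 (\<lambda>x. x v)"
  using homf.var[OF homf.const[of B 1], of v] by simp

lemma hom_subst: "homf B n f \<Longrightarrow> (\<And>v. v \<in> B \<Longrightarrow> homf C e (g v)) \<Longrightarrow> homf C (n * e) (\<lambda>x. f (\<lambda>v. g v x))"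
proof (induction rule: homf.induct)
  case (var n f v)
  then show ?case using hom_mult[of C e "g v" "n * e"] by (simp add: add.commute)
qed (auto intro: homf.intros)

lemma hom_homog: "homf B n f \<Longrightarrow> f (\<lambda>v. c * x v) = c ^ n * f x"
  by (induction rule: homf.induct) (auto simp: algebra_simps)

section \<open>Expansions into homogeneous components and into powers of one variable\<close>

lemma pold_hom_decomp:
  "pold B n f \<Longrightarrow> \<exists>h. (\<forall>i. homf B i (h i)) \<and> (\<forall>x. f x = (\<Sum>i\<le>n. h i x))"
proof (induction rule: pold.induct)
  case (const n c)
  show ?case
    by (rule exI[of _ "\<lambda>i x. if i = 0 then c else 0"]) (auto intro: homf.intros)
next
  case (var n f v)
  then obtain h where h: "\<forall>i. homf B i (h i)" "\<forall>x. f x = (\<Sum>i\<le>n. h i x)" by blast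
  show ?case
  proof (rule exI[of _ "\<lambda>i x. case i of 0 \<Rightarrow> 0 | Suc j \<Rightarrow> x v * h j x"], intro conjI allI)
    fix i show "homf B i (\<lambda>x. case i of 0 \<Rightarrow> 0 | Suc j \<Rightarrow> x v * h j x)"
      using h(1) var.hyps(2) by (cases i) (auto intro: homf.intros)
    fix x show "x v * f x = (\<Sum>i\<le>Suc n. case i of 0 \<Rightarrow> 0 | Suc j \<Rightarrow> x v * h j x)"
      by (subst sum.atMost_Suc_shift) (simp add: h(2) sum_distrib_left)
  qed
next
  case (add n f g)
  then obtain h k where "\<forall>i. homf B i (h i)" "\<forall>x. f x = (\<Sum>i\<le>n. h i x)"
    "\<forall>i. homf B i (k i)" "\<forall>x. g x = (\<Sum>i\<le>n. k i x)" by blast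
  then show ?case
    by (intro exI[of _ "\<lambda>i x. h i x + k i x"]) (auto intro: homf.intros simp: sum.distrib)
qed

text \<open>The bound \<open>n\<close> on the coefficients, instead of \<open>n - i\<close>, is
  crude but linear in the degree, which suffices for growth estimates.\<close>

lemma pold_decomp:
  "pold (insert b B) n f \<Longrightarrow> \<exists>c. (\<forall>i. pold B n (c i)) \<and> (\<forall>x. f x = (\<Sum>i\<le>n. c i x * x b ^ i))"
proof (induction rule: pold.induct)
  case (const n c)
  show ?case
    by (rule exI[of _ "\<lambda>i x. if i = 0 then c else 0"])
      (auto intro: pold.intros simp: if_distrib[of "\<lambda>a. a * _"] cong: if_cong)
next
  case (var n f v)
  then obtain c where c: "\<forall>i. pold B n (c i)" "\<forall>x. f x = (\<Sum>i\<le>n. c i x * x b ^ i)" by blast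
  show ?case
  proof (cases "v = b")
    case True
    show ?thesis
    proof (rule exI[of _ "\<lambda>i x. case i of 0 \<Rightarrow> 0 | Suc j \<Rightarrow> c j x"], intro conjI allI)
      fix i show "pold B (Suc n) (\<lambda>x. case i of 0 \<Rightarrow> 0 | Suc j \<Rightarrow> c j x)"
        using c(1) by (cases i) (auto intro: pold.intros pold_mono[where B = B])
      fix x show "x v * f x = (\<Sum>i\<le>Suc n. (case i of 0 \<Rightarrow> 0 | Suc j \<Rightarrow> c j x) * x b ^ i)"
        by (subst sum.atMost_Suc_shift) (simp add: True c(2) sum_distrib_left mult_ac)
    qed
  next
    case False
    then have v: "v \<in> B" using var by auto
    show ?thesis
    proof (rule exI[of _ "\<lambda>i x. if i \<le> n then x v * c i x else 0"], intro conjI allI)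
      fix i show "pold B (Suc n) (\<lambda>x. if i \<le> n then x v * c i x else 0)"
        using c(1) v by (cases "i \<le> n") (auto intro: pold.intros)
      fix x show "x v * f x = (\<Sum>i\<le>Suc n. (if i \<le> n then x v * c i x else 0) * x b ^ i)"
        by (simp add: c(2) sum_distrib_left mult_ac)
    qed
  qed
next
  case (add n f g)
  then obtain c d where "\<forall>i. pold B n (c i)" "\<forall>x. f x = (\<Sum>i\<le>n. c i x * x b ^ i)"
    "\<forall>i. pold B n (d i)" "\<forall>x. g x = (\<Sum>i\<le>n. d i x * x b ^ i)" by blast
  then show ?case
    by (intro exI[of _ "\<lambda>i x. c i x + d i x"]) (auto intro: pold.intros simp: sum.distrib distrib_right)
qed

lemma polf_decomp:
  assumes "polf (insert b B) f"
  shows "\<exists>n c. (\<forall>i. polf B (c i)) \<and> (\<forall>x. f x = (\<Sum>i\<le>n. c i x * x b ^ i))"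
proof -
  obtain n where "pold (insert b B) n f" using assms unfolding polf_def by blast
  from pold_decomp[OF this] obtain c where "\<forall>i. pold B n (c i)" "\<forall>x. f x = (\<Sum>i\<le>n. c i x * x b ^ i)" by blast
  then show ?thesis unfolding polf_def by (intro exI[of _ n] exI[of _ c]) blast
qed

text \<open>The exact degree \<open>n - i\<close> keeps the coefficients homogeneous down to the
  last variable, where only multiples of one power are left.\<close>

lemma hom_decomp:
  "homf (insert b B) n f \<Longrightarrow> \<exists>c. (\<forall>i\<le>n. homf B (n - i) (c i)) \<and> (\<forall>x. f x = (\<Sum>i\<le>n. c i x * x b ^ i))"
proof (induction rule: homf.induct)
  case (zero n)
  show ?case
    by (rule exI[of _ "\<lambda>i x. 0"]) (auto intro: homf.intros)
next
  case (const c)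
  show ?case
    by (rule exI[of _ "\<lambda>i x. c"]) (auto intro: homf.intros)
next
  case (var n f v)
  then obtain c where c: "\<forall>i\<le>n. homf B (n - i) (c i)" "\<forall>x. f x = (\<Sum>i\<le>n. c i x * x b ^ i)" by blast
  show ?case
  proof (cases "v = b")
    case True
    show ?thesis
    proof (rule exI[of _ "\<lambda>i x. case i of 0 \<Rightarrow> 0 | Suc j \<Rightarrow> c j x"], intro conjI allI impI)
      fix i assume "i \<le> Suc n" then show "homf B (Suc n - i) (\<lambda>x. case i of 0 \<Rightarrow> 0 | Suc j \<Rightarrow> c j x)"
        using c(1) by (cases i) (auto intro: homf.intros)
    next
      fix x show "x v * f x = (\<Sum>i\<le>Suc n. (case i of 0 \<Rightarrow> 0 | Suc j \<Rightarrow> c j x) * x b ^ i)"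
        by (subst sum.atMost_Suc_shift) (simp add: True c(2) sum_distrib_left mult_ac)
    qed
  next
    case False
    then have v: "v \<in> B" using var by auto
    show ?thesis
    proof (rule exI[of _ "\<lambda>i x. if i \<le> n then x v * c i x else 0"], intro conjI allI impI)
      fix i assume "i \<le> Suc n"
      then show "homf B (Suc n - i) (\<lambda>x. if i \<le> n then x v * c i x else 0)"
        using c(1) v by (cases "i \<le> n") (auto intro: homf.intros simp: Suc_diff_le)
    next
      fix x show "x v * f x = (\<Sum>i\<le>Suc n. (if i \<le> n then x v * c i x else 0) * x b ^ i)"
        by (simp add: c(2) sum_distrib_left mult_ac)
    qed
  qed
next
  case (add n f g)
  then obtain c d where "\<forall>i\<le>n. homf B (n - i) (c i)" "\<forall>x. f x = (\<Sum>i\<le>n. c i x * x b ^ i)"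
    "\<forall>i\<le>n. homf B (n - i) (d i)" "\<forall>x. g x = (\<Sum>i\<le>n. d i x * x b ^ i)" by blast
  then show ?case
    by (intro exI[of _ "\<lambda>i x. c i x + d i x"]) (auto intro: homf.intros simp: sum.distrib distrib_right)
qed

text \<open>Restriction to a curve with polynomial coordinates turns nonvanishing on a set of points
  into a question about nonzero polynomials in one variable, which have only finitely many
  roots.\<close>

lemma polf_univariate:
  "polf B f \<Longrightarrow> (\<And>v. v \<in> B \<Longrightarrow> \<exists>p. \<forall>t. g v t = poly p t) \<Longrightarrow> \<exists>p. \<forall>t. f (\<lambda>v. g v t) = poly p t"
proof (induction rule: polf_induct)
  case (const c) show ?case by (rule exI[of _ "[:c:]"]) simp
next
  case (var f v)
  then obtain p q where "\<forall>t. g v t = poly p t" "\<forall>t. f (\<lambda>v. g v t) = poly q t" by meson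
  then show ?case by (intro exI[of _ "p * q"]) simp
next
  case (add f1 f2)
  then obtain p q where "\<forall>t. f1 (\<lambda>v. g v t) = poly p t" "\<forall>t. f2 (\<lambda>v. g v t) = poly q t" by meson
  then show ?case by (intro exI[of _ "p + q"]) simp
qed

lemma poly_common_nonroot:
  fixes p q :: "'a::{idom, ring_char_0} poly"
  assumes "p \<noteq> 0" "q \<noteq> 0" shows "\<exists>t. poly p t \<noteq> 0 \<and> poly q t \<noteq> 0"
proof (rule ccontr)
  assume "\<not> ?thesis"
  then have "\<forall>t. poly (p * q) t = 0" by auto
  then have "p * q = 0" using poly_all_0_iff_0 by blast
  then show False using assms by simp
qed

subsection \<open>Irreducible sets of points\<close>

text \<open>Says that the polynomial functions in the variables \<open>B\<close> that vanish on
  \<open>V\<close> form a prime ideal. The set \<open>V\<close> need not be closed; only its Zariski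
  closure is described.\<close>

definition pirr :: "'v set \<Rightarrow> ('v \<Rightarrow> 'a::comm_ring_1) set \<Rightarrow> bool" where
  "pirr B V \<longleftrightarrow> V \<noteq> {} \<and> (\<forall>f g. polf B f \<and> polf B g \<and> (\<exists>x\<in>V. f x \<noteq> 0) \<and> (\<exists>x\<in>V. g x \<noteq> 0) \<longrightarrow>
     (\<exists>x\<in>V. f x * g x \<noteq> 0))"

lemma pirr_nonempty: "pirr B V \<Longrightarrow> V \<noteq> {}"
  unfolding pirr_def by (elim conjE)

lemma pirrD:
  "pirr B V \<Longrightarrow> polf B f \<Longrightarrow> polf B g \<Longrightarrow> \<exists>x\<in>V. f x \<noteq> 0 \<Longrightarrow> \<exists>x\<in>V. g x \<noteq> 0 \<Longrightarrow> \<exists>x\<in>V. f x * g x \<noteq> 0"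
  unfolding pirr_def by (elim conjE allE[of _ f] allE[of _ g]) simp

lemma pirr_finite:
  assumes "pirr B V" "finite I" "\<And>i. i \<in> I \<Longrightarrow> polf B (f i)" "\<And>i. i \<in> I \<Longrightarrow> \<exists>x\<in>V. f i x \<noteq> 0"
  shows "\<exists>x\<in>V. (\<Prod>i\<in>I. f i x) \<noteq> 0"
  using assms(2-)
proof (induction I rule: finite_induct)
  case empty then show ?case using assms(1) unfolding pirr_def by auto
next
  case (insert i I)
  have "polf B (f i)" "polf B (\<lambda>x. \<Prod>i\<in>I. f i x)" using insert by (auto intro: polf_prod)
  moreover have "\<exists>x\<in>V. f i x \<noteq> 0" "\<exists>x\<in>V. (\<Prod>i\<in>I. f i x) \<noteq> 0" using insert by auto
  ultimately have "\<exists>x\<in>V. f i x * (\<Prod>i\<in>I. f i x) \<noteq> 0"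
    using assms(1) unfolding pirr_def by blast
  then show ?case using insert by simp
qed

text \<open>On the line through a point where \<open>f\<close> is nonzero and a point where
  \<open>g\<close> is nonzero, both become nonzero polynomials in the parameter and have a common
  nonroot.\<close>

lemma pirr_affine_closed:
  fixes V :: "('v \<Rightarrow> 'a::{idom, ring_char_0}) set"
  assumes "V \<noteq> {}" and line: "\<And>x y t. x \<in> V \<Longrightarrow> y \<in> V \<Longrightarrow> (\<lambda>v. x v + t * (y v - x v)) \<in> V"
  shows "pirr B V"
  unfolding pirr_def
proof (intro conjI allI impI)
  fix f g :: "('v \<Rightarrow> 'a) \<Rightarrow> 'a"
  assume A: "polf B f \<and> polf B g \<and> (\<exists>x\<in>V. f x \<noteq> 0) \<and> (\<exists>x\<in>V. g x \<noteq> 0)"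
  then obtain x y where xy: "x \<in> V" "y \<in> V" "f x \<noteq> 0" "g y \<noteq> 0" by blast
  define l where "l t = (\<lambda>v. x v + t * (y v - x v))" for t
  have lin: "\<exists>p. \<forall>t. x v + t * (y v - x v) = poly p t" for v
    by (rule exI[of _ "[:x v, y v - x v:]"]) simp
  obtain p q where p: "\<forall>t. f (l t) = poly p t" and q: "\<forall>t. g (l t) = poly q t"
    using polf_univariate[of B f "\<lambda>v t. x v + t * (y v - x v)"]
      polf_univariate[of B g "\<lambda>v t. x v + t * (y v - x v)"] lin A unfolding l_def by metis
  have "l 0 = x" "l 1 = y" unfolding l_def by auto
  then have "p \<noteq> 0" "q \<noteq> 0" using p q xy by (metis poly_0)+
  then obtain t where "poly p t \<noteq> 0" "poly q t \<noteq> 0" using poly_common_nonroot by blast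
  then have "f (l t) * g (l t) \<noteq> 0" using p q by simp
  moreover have "l t \<in> V" using line[OF xy(1,2)] unfolding l_def .
  ultimately show "\<exists>x\<in>V. f x * g x \<noteq> 0" by blast
qed (fact assms(1))

lemma pirr_UNIV: "pirr B (UNIV :: ('v \<Rightarrow> 'a::{idom, ring_char_0}) set)"
  by (rule pirr_affine_closed) auto

text \<open>The homogeneous analogue, which is what irreducibility in a topology generated by forms
  provides.\<close>

definition hirr :: "'v set \<Rightarrow> ('v \<Rightarrow> 'a::comm_ring_1) set \<Rightarrow> bool" where
  "hirr B V \<longleftrightarrow> V \<noteq> {} \<and> (\<forall>n m f g. homf B n f \<and> homf B m g \<and> (\<exists>x\<in>V. f x \<noteq> 0) \<and> (\<exists>x\<in>V. g x \<noteq> 0) \<longrightarrow>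
     (\<exists>x\<in>V. f x * g x \<noteq> 0))"

lemma hirr_nonempty: "hirr B V \<Longrightarrow> V \<noteq> {}"
  unfolding hirr_def by (elim conjE)

lemma hirrD:
  "hirr B V \<Longrightarrow> homf B n f \<Longrightarrow> homf B m g \<Longrightarrow> \<exists>x\<in>V. f x \<noteq> 0 \<Longrightarrow> \<exists>x\<in>V. g x \<noteq> 0 \<Longrightarrow> \<exists>x\<in>V. f x * g x \<noteq> 0"
  unfolding hirr_def by (elim conjE allE[of _ n] allE[of _ m] allE[of _ f] allE[of _ g]) simp

text \<open>
  Choose a point where suitable homogeneous components of both functions are nonzero; along the line
  through it both functions are nonzero univariate polynomials.
\<close>

lemma hirr_imp_pirr_cone:
  fixes V :: "('v \<Rightarrow> 'a::{idom, ring_char_0}) set"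
  assumes "hirr B V" and cone: "\<And>x t. x \<in> V \<Longrightarrow> (\<lambda>v. t * x v) \<in> V"
  shows "pirr B V"
  unfolding pirr_def
proof (intro conjI allI impI)
  fix f g :: "('v \<Rightarrow> 'a) \<Rightarrow> 'a"
  assume A: "polf B f \<and> polf B g \<and> (\<exists>x\<in>V. f x \<noteq> 0) \<and> (\<exists>x\<in>V. g x \<noteq> 0)"
  then obtain x y where xy: "x \<in> V" "y \<in> V" "f x \<noteq> 0" "g y \<noteq> 0" by blast
  obtain n m where "pold B n f" "pold B m g" using A polf_def by blast
  then obtain h k where h: "\<forall>i. homf B i (h i)" "\<forall>x. f x = (\<Sum>i\<le>n. h i x)"
    and k: "\<forall>i. homf B i (k i)" "\<forall>x. g x = (\<Sum>i\<le>m. k i x)" using pold_hom_decomp by metis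
  obtain i where i: "i \<le> n" "h i x \<noteq> 0" using xy h(2) by (metis atMost_iff sum.neutral)
  obtain j where j: "j \<le> m" "k j y \<noteq> 0" using xy k(2) by (metis atMost_iff sum.neutral)
  obtain z where z: "z \<in> V" "h i z * k j z \<noteq> 0"
    using assms(1) h(1) k(1) xy i j unfolding hirr_def by blast
  define p where "p = (\<Sum>i\<le>n. monom (h i z) i)"
  define q where "q = (\<Sum>i\<le>m. monom (k i z) i)"
  have p: "poly p t = f (\<lambda>v. t * z v)" for t
    by (simp add: p_def poly_sum poly_monom h(2) hom_homog[OF h(1)[rule_format]] mult.commute)
  have q: "poly q t = g (\<lambda>v. t * z v)" for t
    by (simp add: q_def poly_sum poly_monom k(2) hom_homog[OF k(1)[rule_format]] mult.commute)
  have "coeff p i = h i z" "coeff q j = k j z"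
    using i j by (auto simp: p_def q_def coeff_sum)
  then have "p \<noteq> 0" "q \<noteq> 0" using z by auto
  then obtain t where "poly p t \<noteq> 0" "poly q t \<noteq> 0" using poly_common_nonroot by blast
  then show "\<exists>x\<in>V. f x * g x \<noteq> 0" using p q cone[OF z(1), of t] by (metis mult_eq_0_iff)
qed (use assms in \<open>auto simp: hirr_def\<close>)

section \<open>Forms\<close>

lemma mpoly_eval_superset:
  assumes "finite I" "Poly_Mapping.keys F \<subseteq> I"
  shows "mpoly_eval F x = (\<Sum>m\<in>I. Poly_Mapping.lookup F m * (\<Prod>v\<in>Poly_Mapping.keys m. x v ^ Poly_Mapping.lookup m v))"
  unfolding mpoly_eval_def
  by (rule sum.mono_neutral_left[OF assms]) (auto simp: in_keys_iff)

lemma mpoly_eval_add: "mpoly_eval (F + G) x = mpoly_eval F x + mpoly_eval G x"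
proof -
  let ?I = "Poly_Mapping.keys F \<union> Poly_Mapping.keys G"
  show ?thesis
    by (simp add: mpoly_eval_superset[of ?I F] mpoly_eval_superset[of ?I G]
        mpoly_eval_superset[of ?I "F + G", OF _ Poly_Mapping.keys_add] lookup_add sum.distrib distrib_right)
qed

lemma mpoly_eval_zero [simp]: "mpoly_eval 0 x = 0"
  by (simp add: mpoly_eval_def)

lemma mpoly_eval_sum: "mpoly_eval (\<Sum>i\<in>I. F i) x = (\<Sum>i\<in>I. mpoly_eval (F i) x)"
  by (induction I rule: infinite_finite_induct) (auto simp: mpoly_eval_add)

lemma mpoly_eval_single:
  "mpoly_eval (Poly_Mapping.single m c) x = c * (\<Prod>v\<in>Poly_Mapping.keys m. x v ^ Poly_Mapping.lookup m v)"
  by (subst mpoly_eval_superset[of "{m}"]) auto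

lemma monomial_shift:
  fixes m :: "'v \<Rightarrow>\<^sub>0 nat" and v :: 'v and x :: "'v \<Rightarrow> 'a::comm_ring_1"
  defines "m' \<equiv> m + Poly_Mapping.single v 1"
  shows "(\<Prod>u\<in>Poly_Mapping.keys m'. x u ^ Poly_Mapping.lookup m' u) =
      x v * (\<Prod>u\<in>Poly_Mapping.keys m. x u ^ Poly_Mapping.lookup m u)"
    and "(\<Sum>u\<in>Poly_Mapping.keys m'. Poly_Mapping.lookup m' u) =
      Suc (\<Sum>u\<in>Poly_Mapping.keys m. Poly_Mapping.lookup m u)"
proof -
  let ?I = "insert v (Poly_Mapping.keys m)"
  have l: "Poly_Mapping.lookup m' u = Poly_Mapping.lookup m u + (if u = v then 1 else 0)" for u
    by (auto simp: m'_def lookup_add lookup_single)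
  have k: "Poly_Mapping.keys m' \<subseteq> ?I" by (auto simp: in_keys_iff l split: if_splits)
  have "(\<Prod>u\<in>Poly_Mapping.keys m'. x u ^ Poly_Mapping.lookup m' u) = (\<Prod>u\<in>?I. x u ^ Poly_Mapping.lookup m' u)"
    by (rule prod.mono_neutral_left) (use k in \<open>auto simp: in_keys_iff\<close>)
  also have "\<dots> = (\<Prod>u\<in>?I. x u ^ Poly_Mapping.lookup m u) * (\<Prod>u\<in>?I. if u = v then x v else 1)"
    unfolding prod.distrib[symmetric] by (rule prod.cong) (auto simp: l)
  also have "(\<Prod>u\<in>?I. x u ^ Poly_Mapping.lookup m u) = (\<Prod>u\<in>Poly_Mapping.keys m. x u ^ Poly_Mapping.lookup m u)"
    by (rule prod.mono_neutral_right) (auto simp: in_keys_iff)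
  finally show "(\<Prod>u\<in>Poly_Mapping.keys m'. x u ^ Poly_Mapping.lookup m' u) =
      x v * (\<Prod>u\<in>Poly_Mapping.keys m. x u ^ Poly_Mapping.lookup m u)" by (simp add: mult.commute)
  have "(\<Sum>u\<in>Poly_Mapping.keys m'. Poly_Mapping.lookup m' u) = (\<Sum>u\<in>?I. Poly_Mapping.lookup m' u)"
    by (rule sum.mono_neutral_left) (use k in \<open>auto simp: in_keys_iff\<close>)
  also have "\<dots> = (\<Sum>u\<in>?I. Poly_Mapping.lookup m u) + (\<Sum>u\<in>?I. if u = v then 1 else 0)"
    unfolding sum.distrib[symmetric] by (rule sum.cong) (auto simp: l)
  also have "(\<Sum>u\<in>?I. Poly_Mapping.lookup m u) = (\<Sum>u\<in>Poly_Mapping.keys m. Poly_Mapping.lookup m u)"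
    by (rule sum.mono_neutral_right) (auto simp: in_keys_iff)
  finally show "(\<Sum>u\<in>Poly_Mapping.keys m'. Poly_Mapping.lookup m' u) =
      Suc (\<Sum>u\<in>Poly_Mapping.keys m. Poly_Mapping.lookup m u)" by simp
qed

text \<open>The degree is carried through the induction because a sum stays homogeneous when the
  degrees agree. Together with the converse below, this allows the topologies, defined by formal
  polynomials, to be described by functions.\<close>

lemma hom_imp_form:
  assumes "homf B n f"
  shows "\<exists>F. homogeneous F \<and> mpoly_eval F = f"
proof -
  have "\<exists>F. (\<forall>m\<in>Poly_Mapping.keys F. (\<Sum>v\<in>Poly_Mapping.keys m. Poly_Mapping.lookup m v) = n) \<and> (\<forall>x. mpoly_eval F x = f x)"
    using assms
  proof (induction rule: homf.induct)
    case (zero n) show ?case by (rule exI[of _ 0]) simp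
  next
    case (const c) show ?case
      by (rule exI[of _ "Poly_Mapping.single 0 c"]) (auto simp: mpoly_eval_single)
  next
    case (var n f v)
    then obtain F where F: "\<forall>m\<in>Poly_Mapping.keys F. (\<Sum>v\<in>Poly_Mapping.keys m. Poly_Mapping.lookup m v) = n"
      "\<forall>x. mpoly_eval F x = f x" by blast
    let ?G = "\<Sum>m\<in>Poly_Mapping.keys F. Poly_Mapping.single (m + Poly_Mapping.single v 1) (Poly_Mapping.lookup F m)"
    show ?case
    proof (rule exI[of _ ?G], intro conjI ballI allI)
      fix m assume "m \<in> Poly_Mapping.keys ?G"
      then have "m \<in> (\<Union>m\<in>Poly_Mapping.keys F. Poly_Mapping.keys (Poly_Mapping.single (m + Poly_Mapping.single v 1) (Poly_Mapping.lookup F m)))"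
        using Poly_Mapping.keys_sum by fast
      then obtain m0 where "m0 \<in> Poly_Mapping.keys F" "m = m0 + Poly_Mapping.single v 1"
        by (auto split: if_splits)
      then show "(\<Sum>v\<in>Poly_Mapping.keys m. Poly_Mapping.lookup m v) = Suc n"
        using F(1) monomial_shift(2)[of m0 v] by simp
    next
      fix x show "mpoly_eval ?G x = x v * f x"
        unfolding F(2)[rule_format, of x, symmetric] mpoly_eval_sum mpoly_eval_single monomial_shift
        by (simp add: sum_distrib_left mpoly_eval_def mult_ac)
    qed
  next
    case (add n f g)
    then obtain F G where "\<forall>m\<in>Poly_Mapping.keys F. (\<Sum>v\<in>Poly_Mapping.keys m. Poly_Mapping.lookup m v) = n"
      "\<forall>x. mpoly_eval F x = f x" "\<forall>m\<in>Poly_Mapping.keys G. (\<Sum>v\<in>Poly_Mapping.keys m. Poly_Mapping.lookup m v) = n"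
      "\<forall>x. mpoly_eval G x = g x" by blast
    then show ?case using Poly_Mapping.keys_add[of F G]
      by (intro exI[of _ "F + G"]) (auto simp: mpoly_eval_add)
  qed
  then show ?thesis unfolding homogeneous_def by blast
qed

lemma form_imp_hom:
  assumes "homogeneous F"
  shows "\<exists>n. homf UNIV n (mpoly_eval F)"
proof -
  obtain d where d: "\<forall>m\<in>Poly_Mapping.keys F. (\<Sum>v\<in>Poly_Mapping.keys m. Poly_Mapping.lookup m v) = d"
    using assms homogeneous_def by blast
  have "homf UNIV d (\<lambda>x. \<Sum>m\<in>Poly_Mapping.keys F. Poly_Mapping.lookup F m * (\<Prod>v\<in>Poly_Mapping.keys m. x v ^ Poly_Mapping.lookup m v))"
  proof (intro hom_sum hom_scale)
    fix m assume m: "m \<in> Poly_Mapping.keys F"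
    have "homf UNIV (\<Sum>v\<in>Poly_Mapping.keys m. Poly_Mapping.lookup m v) (\<lambda>x. \<Prod>v\<in>Poly_Mapping.keys m. x v ^ Poly_Mapping.lookup m v)"
      using hom_power[OF hom_coord[of _ UNIV]] by (intro hom_prod) (auto simp del: One_nat_def)
    then show "homf UNIV d (\<lambda>x. \<Prod>v\<in>Poly_Mapping.keys m. x v ^ Poly_Mapping.lookup m v)" using d m by simp
  qed
  then show ?thesis unfolding mpoly_eval_def[abs_def] by blast
qed

section \<open>Growth of spaces of functions\<close>

definition indep_on :: "'p set \<Rightarrow> ('i \<Rightarrow> 'p \<Rightarrow> 'a::field) \<Rightarrow> 'i set \<Rightarrow> bool" where
  "indep_on S h I \<longleftrightarrow> (\<forall>c. (\<forall>x\<in>S. (\<Sum>i\<in>I. c i * h i x) = 0) \<longrightarrow> (\<forall>i\<in>I. c i = 0))"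

text \<open>An upper bound for the dimension of the space of restrictions to \<open>S\<close>. The
  spanning functions need not satisfy \<open>P\<close> themselves, so \<open>P\<close> need not
  describe a linear space.\<close>

definition dimle :: "'p set \<Rightarrow> (('p \<Rightarrow> 'a::field) \<Rightarrow> bool) \<Rightarrow> nat \<Rightarrow> bool" where
  "dimle S P N \<longleftrightarrow> (\<exists>G. finite G \<and> card G \<le> N \<and> (\<forall>f. P f \<longrightarrow> (\<exists>c. \<forall>x\<in>S. f x = (\<Sum>g\<in>G. c g * g x))))"

lemma dimleI:
  assumes "finite J" "card J \<le> N" "\<And>f. P f \<Longrightarrow> \<exists>c. \<forall>x\<in>S. f x = (\<Sum>j\<in>J. c j * g j x)"
  shows "dimle S P N"
  unfolding dimle_def
proof (intro exI[of _ "g ` J"] conjI allI impI)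
  show "finite (g ` J)" using assms by simp
  show "card (g ` J) \<le> N" using assms card_image_le[of J g] by linarith
  fix f assume "P f"
  then obtain c where c: "\<forall>x\<in>S. f x = (\<Sum>j\<in>J. c j * g j x)" using assms(3) by blast
  have "(\<Sum>j\<in>J. c j * g j x) = (\<Sum>y\<in>g ` J. (\<Sum>j | j \<in> J \<and> g j = y. c j) * y x)" for x
    by (subst sum.image_gen[OF assms(1), of _ g]) (auto intro!: sum.cong simp: sum_distrib_right)
  then show "\<exists>c. \<forall>x\<in>S. f x = (\<Sum>y\<in>g ` J. c y * y x)"
    using c by (intro exI[of _ "\<lambda>y. \<Sum>j | j \<in> J \<and> g j = y. c j"]) simp
qed

lemma sum_fun_apply': "(\<Sum>i\<in>I. F i) x = (\<Sum>i\<in>I. F i x)"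
  by (induction I rule: infinite_finite_induct) auto

text \<open>Steinitz exchange in the vector space of all functions, applied to the restrictions
  extended by zero outside \<open>S\<close>.\<close>

lemma dimle_indep:
  fixes h :: "'i \<Rightarrow> 'p \<Rightarrow> 'a::field"
  assumes "dimle S P N" "finite I" "\<And>i. i \<in> I \<Longrightarrow> P (h i)" and ind: "indep_on S h I"
  shows "card I \<le> N"
proof -
  interpret fn: vector_space "\<lambda>c (f :: 'p \<Rightarrow> 'a) x. c * f x"
    by unfold_locales (auto simp: fun_eq_iff algebra_simps)
  define r where "r f = (\<lambda>x. if x \<in> S then f x else 0)" for f :: "'p \<Rightarrow> 'a"
  obtain G where G: "finite G" "card G \<le> N"
    "\<forall>f. P f \<longrightarrow> (\<exists>c. \<forall>x\<in>S. f x = (\<Sum>g\<in>G. c g * g x))" using assms(1) unfolding dimle_def by blast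
  have sp: "r (h i) \<in> fn.span (r ` G)" if i: "i \<in> I" for i
  proof -
    obtain c where c: "\<forall>x\<in>S. h i x = (\<Sum>g\<in>G. c g * g x)" using G(3) assms(3)[OF i] by meson
    have "r (h i) = (\<Sum>g\<in>G. (\<lambda>x. c g * r g x))"
      by (auto simp: fun_eq_iff r_def sum_fun_apply' c)
    also have "\<dots> \<in> fn.span (r ` G)"
      by (intro fn.span_sum fn.span_scale fn.span_base) auto
    finally show ?thesis .
  qed
  \<comment> \<open>A repeated restriction would give the relation with coefficients 1 and
    -1.\<close>
  have inj: "inj_on (\<lambda>i. r (h i)) I"
  proof (rule inj_onI, rule ccontr)
    fix i j assume ij: "i \<in> I" "j \<in> I" "r (h i) = r (h j)" "i \<noteq> j"
    let ?c = "\<lambda>l. if l = i then 1 else if l = j then -1 else 0 :: 'a"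
    have "\<forall>x\<in>S. (\<Sum>l\<in>I. ?c l * h l x) = 0"
    proof
      fix x assume x: "x \<in> S"
      have "(\<Sum>l\<in>I. ?c l * h l x) = (\<Sum>l\<in>I. (if l = i then h l x else 0) - (if l = j then h l x else 0))"
        using ij(4) by (intro sum.cong) auto
      also have "\<dots> = h i x - h j x" using ij assms(2) by (simp add: sum_subtractf)
      also have "\<dots> = 0" using fun_cong[OF ij(3), of x] x by (simp add: r_def)
      finally show "(\<Sum>l\<in>I. ?c l * h l x) = 0" .
    qed
    with ind ij(1) have "?c i = 0" unfolding indep_on_def by (elim allE[of _ ?c]) (auto dest: bspec[of _ _ i])
    then show False by simp
  qed
  have "fn.independent ((\<lambda>i. r (h i)) ` I)"
  proof
    assume "fn.dependent ((\<lambda>i. r (h i)) ` I)"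
    then obtain u v where u: "v \<in> (\<lambda>i. r (h i)) ` I" "u v \<noteq> 0"
      "(\<Sum>v\<in>(\<lambda>i. r (h i)) ` I. (\<lambda>x. u v * v x)) = 0"
      using fn.dependent_finite[of "(\<lambda>i. r (h i)) ` I"] assms(2) by auto
    have "(\<Sum>i\<in>I. u (r (h i)) * h i x) = 0" if "x \<in> S" for x
    proof -
      have "(\<Sum>v\<in>(\<lambda>i. r (h i)) ` I. (\<lambda>x. u v * v x)) x = 0" using u(3) by simp
      then have "(\<Sum>i\<in>I. u (r (h i)) * r (h i) x) = 0"
        by (simp add: sum_fun_apply' sum.reindex[OF inj])
      moreover have "r (h i) x = h i x" for i using that by (simp add: r_def)
      ultimately show ?thesis by simp
    qed
    with ind have "\<forall>i\<in>I. u (r (h i)) = 0"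
      unfolding indep_on_def by (elim allE[of _ "\<lambda>i. u (r (h i))"]) simp
    then show False using u by auto
  qed
  then have "card ((\<lambda>i. r (h i)) ` I) \<le> card (r ` G)"
    using fn.independent_span_bound[of "r ` G" "(\<lambda>i. r (h i)) ` I"] sp G(1) by blast
  also have "\<dots> \<le> N" using card_image_le[OF G(1), of r] G(2) by linarith
  finally show ?thesis using card_image[OF inj] by simp
qed

lemma indep_on_Suc:
  assumes "indep_on S h {..<m}" "\<not> indep_on S (h(m := f)) {..<Suc m}"
  shows "\<exists>c. \<forall>x\<in>S. f x = (\<Sum>i<m. c i * h i x)"
proof -
  obtain c i where c: "\<forall>x\<in>S. (\<Sum>i<Suc m. c i * (h(m := f)) i x) = 0" and i: "i < Suc m" "c i \<noteq> 0"
    using assms(2) unfolding indep_on_def by auto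
  have eq: "(\<Sum>i<m. c i * h i x) + c m * f x = 0" if "x \<in> S" for x
    using c[rule_format, OF that] by simp
  have "c m \<noteq> 0"
  proof
    assume m: "c m = 0"
    then have "\<forall>i\<in>{..<m}. c i = 0" using assms(1) eq unfolding indep_on_def by auto
    then show False using i m by (auto simp: less_Suc_eq)
  qed
  then have "f x = (\<Sum>i<m. (- c i / c m) * h i x)" if "x \<in> S" for x
  proof -
    have "c m * f x = - (\<Sum>i<m. c i * h i x)" using eq[OF that] by (simp add: add_eq_0_iff)
    also have "\<dots> = c m * (\<Sum>i<m. (- c i / c m) * h i x)"
      using \<open>c m \<noteq> 0\<close> by (simp add: sum_distrib_left sum_negf)
    finally show ?thesis using \<open>c m \<noteq> 0\<close> by simp
  qed
  then show ?thesis by (intro exI[of _ "\<lambda>i. - c i / c m"]) simp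
qed

text \<open>A largest independent family spans, because enlarging it by any further function gives a
  relation in which that function has a nonzero coefficient. To bound a dimension it is then enough
  to map independent families to independent families elsewhere.\<close>

lemma dimle_of_indep_bound:
  assumes "\<And>h m. (\<And>i. i < m \<Longrightarrow> P (h i)) \<Longrightarrow> indep_on S h {..<m} \<Longrightarrow> m \<le> N"
  shows "dimle S P N"
proof -
  define Q where "Q m = (\<exists>h. (\<forall>i<m. P (h i)) \<and> indep_on S h {..<m})" for m :: nat
  have "Q 0" unfolding Q_def indep_on_def by auto
  moreover have "\<forall>m. Q m \<longrightarrow> m \<le> N" unfolding Q_def using assms by blast
  ultimately obtain m where m: "Q m" "\<And>m'. Q m' \<Longrightarrow> m' \<le> m"
    using Greatest_le_nat[of Q _ N] GreatestI_nat[of Q 0 N] by blast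
  obtain h where h: "\<forall>i<m. P (h i)" "indep_on S h {..<m}" using m(1) unfolding Q_def by blast
  have mN: "m \<le> N" using assms h by blast
  show ?thesis
  proof (rule dimleI[of "{..<m}" _ _ _ h])
    fix f assume f: "P f"
    have "\<not> indep_on S (h(m := f)) {..<Suc m}"
    proof
      assume i: "indep_on S (h(m := f)) {..<Suc m}"
      have "\<forall>i<Suc m. P ((h(m := f)) i)" using h(1) f by (auto simp: less_Suc_eq)
      then have "Q (Suc m)" using i unfolding Q_def by blast
      then show False using m(2) by fastforce
    qed
    then show "\<exists>c. \<forall>x\<in>S. f x = (\<Sum>i\<in>{..<m}. c i * h i x)" using indep_on_Suc[OF h(2)] by simp
  qed (use mN in auto)
qed

lemma dimle_mono: "dimle S P N \<Longrightarrow> S' \<subseteq> S \<Longrightarrow> (\<And>f. Q f \<Longrightarrow> P f) \<Longrightarrow> N \<le> N' \<Longrightarrow> dimle S' Q N'"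
  unfolding dimle_def by (meson order_trans subsetD)

text \<open>The Hilbert function of \<open>Y\<close> grows at most like the power \<open>d\<close>
  of the degree. The base \<open>n + 1\<close> instead of \<open>n\<close> keeps the bound usable in
  degree 0.\<close>

definition grow :: "'v set \<Rightarrow> ('v \<Rightarrow> 'a::field) set \<Rightarrow> nat \<Rightarrow> bool" where
  "grow B Y d \<longleftrightarrow> (\<exists>C. \<forall>n. dimle Y (homf B n) (C * (n + 1) ^ d))"

lemma grow_subset:
  assumes "grow B Y d" "Z \<subseteq> Y" shows "grow B Z d"
proof -
  obtain C where "\<And>n. dimle Y (homf B n) (C * (n + 1) ^ d)" using assms(1) unfolding grow_def by blast
  then have "\<forall>n. dimle Z (homf B n) (C * (n + 1) ^ d)" using dimle_mono[OF _ assms(2)] by blast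
  then show ?thesis unfolding grow_def by (rule exI)
qed

lemma hirr_cancel:
  fixes f g :: "('v \<Rightarrow> 'a::field) \<Rightarrow> 'a"
  assumes "hirr B Y" "homf B n f" "homf B m g" "\<exists>x\<in>Y. f x \<noteq> 0" "\<forall>x\<in>Y. f x * g x = 0"
  shows "\<forall>x\<in>Y. g x = 0"
  using assms unfolding hirr_def by blast

text \<open>
  If \<open>g\<close> vanishes on \<open>Z\<close> but not on \<open>Y\<close>, then forms \<open>h\<^sub>i\<close> that are independent on \<open>Z\<close> have multiples
  \<open>g\<^sup>a h\<^sub>i\<close> that are independent on \<open>Y\<close>; powers of a linear form \<open>u\<close> equalize their degrees.
\<close>

lemma indep_filtration:
  fixes g u :: "('v \<Rightarrow> 'a::field) \<Rightarrow> 'a"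
  assumes Z: "hirr B Z" and Y: "hirr B Y" and ZY: "Z \<subseteq> Y"
    and g: "homf B e g" "\<forall>x\<in>Z. g x = 0" "\<exists>x\<in>Y. g x \<noteq> 0"
    and u: "homf B 1 u" "\<exists>x\<in>Z. u x \<noteq> 0"
    and h: "indep_on Z h {..<q}" "\<And>i. i < q \<Longrightarrow> homf B n (h i)"
  shows "(\<forall>x\<in>Y. (\<Sum>a<m. g x ^ a * u x ^ (e * (m - Suc a)) * (\<Sum>i<q. c a i * h i x)) = 0) \<Longrightarrow>
     \<forall>a<m. \<forall>i<q. c a i = 0"
proof (induction m arbitrary: c)
  case 0 then show ?case by simp
next
  case (Suc m)
  define W where "W x = (\<Sum>a<m. g x ^ a * u x ^ (e * (m - Suc a)) * (\<Sum>i<q. c (Suc a) i * h i x))" for x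
  have hF: "homf B n (\<lambda>x. \<Sum>i<q. c a i * h i x)" for a
    using h(2) by (intro hom_sum hom_scale) auto
  have split: "(\<Sum>a<Suc m. g x ^ a * u x ^ (e * (Suc m - Suc a)) * (\<Sum>i<q. c a i * h i x)) =
     u x ^ (e * m) * (\<Sum>i<q. c 0 i * h i x) + g x * W x" for x
    unfolding W_def by (subst sum.lessThan_Suc_shift) (simp add: sum_distrib_left mult.assoc)
  have eq: "u x ^ (e * m) * (\<Sum>i<q. c 0 i * h i x) + g x * W x = 0" if "x \<in> Y" for x
    using Suc.prems that unfolding split by blast
  \<comment> \<open>On \<open>Z\<close> the form \<open>g\<close> vanishes, so only the term with
    \<open>a = 0\<close> survives, and the power of \<open>u\<close> can be cancelled.\<close>
  have "\<forall>x\<in>Z. (\<Sum>i<q. c 0 i * h i x) = 0"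
  proof (rule hirr_cancel[OF Z hom_power[OF u(1)] hF[of 0]])
    show "\<exists>x\<in>Z. u x ^ (e * m) \<noteq> 0" using u(2) by auto
    show "\<forall>x\<in>Z. u x ^ (e * m) * (\<Sum>i<q. c 0 i * h i x) = 0" using eq ZY g(2) by force
  qed
  then have c0: "\<forall>i<q. c 0 i = 0" using h(1) unfolding indep_on_def by auto
  have "homf B (e * (m - 1) + n) W" unfolding W_def
  proof (intro hom_sum)
    fix a assume "a \<in> {..<m}"
    then have a: "a * e + e * (m - Suc a) + n = e * (m - 1) + n"
      by (cases m) (auto simp: algebra_simps simp flip: distrib_left)
    show "homf B (e * (m - 1) + n) (\<lambda>x. g x ^ a * u x ^ (e * (m - Suc a)) * (\<Sum>i<q. c (Suc a) i * h i x))"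
      using hom_mult[OF hom_mult[OF hom_power[OF g(1)] hom_power[OF u(1)]] hF, of a "e * (m - Suc a)" "Suc a"]
      by (simp add: a)
  qed
  \<comment> \<open>Without its first term the relation on \<open>Y\<close> has the factor
    \<open>g\<close>; cancelling it leaves a relation of the same shape with one term less.\<close>
  then have "\<forall>x\<in>Y. W x = 0" using hirr_cancel[OF Y g(1) _ g(3)] eq c0 by auto
  then have "\<forall>a<m. \<forall>i<q. c (Suc a) i = 0" unfolding W_def by (rule Suc.IH)
  then show ?case using c0 by (auto simp: less_Suc_eq_0_disj)
qed

text \<open>All \<open>m * q\<close> products have the common degree \<open>e * (m - 1) + n\<close>,
  so together they fit into one space of forms on \<open>Y\<close>.\<close>

lemma dimle_filtration:
  fixes g u :: "('v \<Rightarrow> 'a::field) \<Rightarrow> 'a"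
  assumes Z: "hirr B Z" and Y: "hirr B Y" and ZY: "Z \<subseteq> Y"
    and g: "homf B e g" "\<forall>x\<in>Z. g x = 0" "\<exists>x\<in>Y. g x \<noteq> 0"
    and u: "homf B 1 u" "\<exists>x\<in>Z. u x \<noteq> 0"
    and h: "indep_on Z h {..<q}" "\<And>i. i < q \<Longrightarrow> homf B n (h i)"
    and D: "dimle Y (homf B (e * (m - 1) + n)) N"
  shows "m * q \<le> N"
proof -
  define H where "H = (\<lambda>(a, i) x. g x ^ a * u x ^ (e * (m - Suc a)) * h i x)"
  have "card ({..<m} \<times> {..<q}) \<le> N"
  proof (rule dimle_indep[OF D, where h = H])
    fix p assume "p \<in> {..<m} \<times> {..<q}"
    then obtain a i where p: "p = (a, i)" "a < m" "i < q" by auto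
    then have a: "a * e + e * (m - Suc a) + n = e * (m - 1) + n"
      by (cases m) (auto simp: algebra_simps simp flip: distrib_left)
    show "homf B (e * (m - 1) + n) (H p)"
      using hom_mult[OF hom_mult[OF hom_power[OF g(1)] hom_power[OF u(1)]] h(2)[OF p(3)], of a "e * (m - Suc a)"]
      by (simp add: a p(1) H_def)
  next
    show "indep_on Y H ({..<m} \<times> {..<q})" unfolding indep_on_def
    proof (intro allI impI)
      fix c assume c: "\<forall>x\<in>Y. (\<Sum>p\<in>{..<m} \<times> {..<q}. c p * H p x) = 0"
      have "(\<Sum>p\<in>{..<m} \<times> {..<q}. c p * H p x) =
        (\<Sum>a<m. g x ^ a * u x ^ (e * (m - Suc a)) * (\<Sum>i<q. curry c a i * h i x))" for x
        by (simp add: sum.cartesian_product H_def sum_distrib_left mult_ac split_beta)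
      then have "\<forall>a<m. \<forall>i<q. curry c a i = 0"
        using c indep_filtration[OF Z Y ZY g u h, of m "curry c"] by simp
      then show "\<forall>p\<in>{..<m} \<times> {..<q}. c p = 0" by auto
    qed
  qed simp
  then show ?thesis by simp
qed

text \<open>With \<open>m = n + 1\<close> powers of \<open>g\<close>, the degree grows at most by
  the factor \<open>e + 1\<close> while the number of independent forms is multiplied by
  \<open>n + 1\<close>; division lowers the exponent by one.\<close>

lemma grow_proper_subset:
  fixes g u :: "('v \<Rightarrow> 'a::field) \<Rightarrow> 'a"
  assumes Z: "hirr B Z" and Y: "hirr B Y" and ZY: "Z \<subseteq> Y"
    and g: "homf B e g" "\<forall>x\<in>Z. g x = 0" "\<exists>x\<in>Y. g x \<noteq> 0"
    and u: "homf B 1 u" "\<exists>x\<in>Z. u x \<noteq> 0"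
    and D: "grow B Y d"
  shows "\<exists>d'. d = Suc d' \<and> grow B Z d'"
proof -
  obtain C where C: "\<And>n. dimle Y (homf B n) (C * (n + 1) ^ d)" using D unfolding grow_def by blast
  show ?thesis
  proof (cases d)
    case 0
    \<comment> \<open>A bounded Hilbert function is impossible: the constant 1 would give
      \<open>C + 1\<close> independent forms on \<open>Y\<close> where at most \<open>C\<close>
      fit.\<close>
    have "indep_on Z (\<lambda>i x. 1 :: 'a) {..<1::nat}"
      using Z unfolding indep_on_def hirr_def by auto
    then have "Suc C * 1 \<le> C * (e * (Suc C - 1) + 0 + 1) ^ d"
      by (rule dimle_filtration[OF Z Y ZY g u _ _ C]) (auto intro: homf.intros)
    then show ?thesis using 0 by simp
  next
    case (Suc d')
    have "dimle Z (homf B n) (C * (e + 1) ^ d * (n + 1) ^ d')" for n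
    proof (rule dimle_of_indep_bound)
      fix h and q :: nat assume h: "\<And>i. i < q \<Longrightarrow> homf B n (h i)" "indep_on Z h {..<q}"
      have "(n + 1) * q \<le> C * (e * (n + 1 - 1) + n + 1) ^ d"
        by (rule dimle_filtration[OF Z Y ZY g u h(2,1) C])
      also have "\<dots> \<le> C * ((e + 1) * (n + 1)) ^ d"
        by (intro mult_le_mono2 power_mono) auto
      also have "\<dots> = (n + 1) * (C * (e + 1) ^ d * (n + 1) ^ d')"
        unfolding power_mult_distrib by (simp only: Suc power_Suc[of "n + 1"] mult_ac)
      finally show "q \<le> C * (e + 1) ^ d * (n + 1) ^ d'" by (subst (asm) mult_le_cancel1) auto
    qed
    then show ?thesis using Suc unfolding grow_def by blast
  qed
qed

text \<open>Each strict inclusion costs one exponent. Since \<open>u\<close> is nonzero somewhere on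
  the smallest set, it serves all inclusions.\<close>

lemma grow_chain:
  fixes Y :: "nat \<Rightarrow> ('v \<Rightarrow> 'a::field) set"
  assumes "\<And>i. i \<le> n \<Longrightarrow> hirr B (Y i)" "\<And>i. i < n \<Longrightarrow> Y i \<subseteq> Y (Suc i)"
    and "\<And>i. i < n \<Longrightarrow> \<exists>e g. homf B e g \<and> (\<forall>x\<in>Y i. g x = 0) \<and> (\<exists>x\<in>Y (Suc i). g x \<noteq> 0)"
    and u: "homf B 1 u" "\<exists>x\<in>Y 0. u x \<noteq> 0"
    and "grow B (Y n) d"
  shows "n \<le> d"
  using assms(1-3,6)
proof (induction n arbitrary: d)
  case (Suc n)
  have "\<exists>x\<in>Y i. u x \<noteq> 0" if "i \<le> Suc n" for i using that
  proof (induction i)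
    case (Suc i) then show ?case using Suc.prems \<open>\<And>i. i < Suc n \<Longrightarrow> Y i \<subseteq> Y (Suc i)\<close>[of i] by auto
  qed (use u(2) in simp)
  then have un: "\<exists>x\<in>Y n. u x \<noteq> 0" by simp
  obtain e g where g: "homf B e g" "\<forall>x\<in>Y n. g x = 0" "\<exists>x\<in>Y (Suc n). g x \<noteq> 0"
    using Suc.prems(3)[OF lessI] by (elim exE conjE)
  have "hirr B (Y n)" "hirr B (Y (Suc n))" "Y n \<subseteq> Y (Suc n)" using Suc.prems(1,2) by auto
  from grow_proper_subset[OF this g u(1) un Suc.prems(4)]
  obtain d' where d': "d = Suc d'" "grow B (Y n) d'" by blast
  then have "n \<le> d'" using Suc.IH[of d'] Suc.prems by auto
  then show ?case using d' by simp
qed simp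

section \<open>Prime ideals of polynomial functions\<close>

text \<open>Pseudo-division by a polynomial of degree \<open>e\<close> in \<open>x b\<close> with
  leading coefficient \<open>p e\<close>: each new factor \<open>x b\<close> costs one factor
  \<open>p e\<close>. The degrees of the remainder coefficients are tracked because the growth
  estimate relies on their being linear in \<open>j\<close>.\<close>

lemma pseudo_reduce_power:
  fixes p :: "nat \<Rightarrow> ('v \<Rightarrow> 'a::comm_ring_1) \<Rightarrow> 'a"
  assumes p: "\<And>i. i \<le> e \<Longrightarrow> pold B D (p i)" and e: "e > 0"
  shows "\<exists>Q r. polf (insert b B) Q \<and> (\<forall>i<e. pold B (j * D) (r i)) \<and>
     (\<forall>x. p e x ^ j * x b ^ j = Q x * (\<Sum>i\<le>e. p i x * x b ^ i) + (\<Sum>i<e. r i x * x b ^ i))"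
proof (induction j)
  case 0
  have "(\<Sum>i<e. (if i = 0 then 1 else 0) * x b ^ i) = 1" for x :: "'v \<Rightarrow> 'a"
    using e by (simp add: if_distrib[of "\<lambda>a. a * _"] cong: if_cong)
  then show ?case
    by (intro exI[of _ "\<lambda>x. 0"] exI[of _ "\<lambda>i x. if i = 0 then 1 else 0"]) (auto intro: pold.const)
next
  case (Suc j)
  then obtain Q r where Q: "polf (insert b B) Q" and r: "\<And>i. i < e \<Longrightarrow> pold B (j * D) (r i)"
    and eq: "\<And>x. p e x ^ j * x b ^ j = Q x * (\<Sum>i\<le>e. p i x * x b ^ i) + (\<Sum>i<e. r i x * x b ^ i)" by blast
  obtain e' where e': "e = Suc e'" using e by (cases e) auto
  \<comment> \<open>The old remainder is multiplied by \<open>p e * x b\<close>, and its new top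
    term of degree \<open>e\<close> is removed by subtracting \<open>r e'\<close> times the
    divisor.\<close>
  define s where "s i x = (case i of 0 \<Rightarrow> 0 | Suc i' \<Rightarrow> p e x * r i' x) - r e' x * p i x" for i x
  define P where "P x = (\<Sum>i\<le>e. p i x * x b ^ i)" for x
  have s: "pold B (Suc j * D) (s i)" if "i < e" for i
  proof -
    have "pold B (Suc j * D) (\<lambda>x. case i of 0 \<Rightarrow> 0 | Suc i' \<Rightarrow> p e x * r i' x)"
    proof (cases i)
      case 0 then show ?thesis using pold.const[of B "Suc j * D" 0] by simp
    next
      case (Suc i') then show ?thesis using pold_mult[OF p r, of e i'] that by simp
    qed
    moreover have "pold B (Suc j * D) (\<lambda>x. (-1) * (r e' x * p i x))"
      using pold_scale[OF pold_mult[OF r p, of e' i], of "-1"] that e' by (simp add: add.commute)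
    ultimately have "pold B (Suc j * D) (\<lambda>x. (case i of 0 \<Rightarrow> 0 | Suc i' \<Rightarrow> p e x * r i' x) + (-1) * (r e' x * p i x))"
      by (rule pold.add)
    then show ?thesis unfolding s_def by simp
  qed
  have "p e x ^ Suc j * x b ^ Suc j = (p e x * x b * Q x + r e' x) * P x + (\<Sum>i<e. s i x * x b ^ i)" for x
  proof -
    have "p e x ^ Suc j * x b ^ Suc j = p e x * x b * (p e x ^ j * x b ^ j)" by (simp add: mult_ac)
    also have "\<dots> = p e x * x b * Q x * P x + (\<Sum>i<e. p e x * r i x * x b ^ Suc i)"
      unfolding eq P_def[symmetric] by (simp add: distrib_left sum_distrib_left mult_ac)
    also have "(\<Sum>i<e. p e x * r i x * x b ^ Suc i) =
       (\<Sum>i<e. (case i of 0 \<Rightarrow> 0 | Suc i' \<Rightarrow> p e x * r i' x) * x b ^ i) + p e x * r e' x * x b ^ e"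
    proof -
      have "(\<Sum>i<e. p e x * r i x * x b ^ Suc i) =
        (\<Sum>i<Suc e. (case i of 0 \<Rightarrow> 0 | Suc i' \<Rightarrow> p e x * r i' x) * x b ^ i)"
        by (subst sum.lessThan_Suc_shift) simp
      then show ?thesis by (simp add: e')
    qed
    also have "p e x * r e' x * x b ^ e = r e' x * P x - (\<Sum>i<e. r e' x * p i x * x b ^ i)"
      by (simp add: P_def lessThan_Suc_atMost[symmetric] distrib_left sum_distrib_left mult_ac)
    finally show ?thesis by (simp add: s_def algebra_simps sum_subtractf)
  qed
  moreover have "polf (insert b B) (\<lambda>x. p e x * x b * Q x + r e' x)"
  proof -
    have "polf B (p e)" "polf B (r e')" using p[of e] r[of e'] e' unfolding polf_def by auto
    then have "polf (insert b B) (p e)" "polf (insert b B) (r e')" by (auto intro: polf_mono)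
    then show ?thesis by (intro polf_add polf_mult Q polf_coord) auto
  qed
  ultimately show ?case using s unfolding P_def by (intro exI conjI) auto
qed

text \<open>Different powers of \<open>x b\<close> call for different powers of \<open>p e\<close>;
  the factor \<open>p e ^ (n - j)\<close> brings all of them to \<open>p e ^ n\<close>, and the
  degrees then add up to \<open>n + n * D\<close> for every \<open>j\<close>.\<close>

lemma pseudo_reduce:
  fixes p :: "nat \<Rightarrow> ('v \<Rightarrow> 'a::comm_ring_1) \<Rightarrow> 'a"
  assumes p: "\<And>i. i \<le> e \<Longrightarrow> pold B D (p i)" and e: "e > 0" and f: "pold (insert b B) n f"
  obtains Q r where "polf (insert b B) Q" "\<And>i. i < e \<Longrightarrow> pold B (n + n * D) (r i)"
     "\<And>x. p e x ^ n * f x = Q x * (\<Sum>i\<le>e. p i x * x b ^ i) + (\<Sum>i<e. r i x * x b ^ i)"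
proof -
  obtain c where c: "\<And>i. pold B n (c i)" "\<And>x. f x = (\<Sum>i\<le>n. c i x * x b ^ i)"
    using pold_decomp[OF f] by auto
  have "\<forall>j. \<exists>Q r. polf (insert b B) Q \<and> (\<forall>i<e. pold B (j * D) (r i)) \<and>
     (\<forall>x. p e x ^ j * x b ^ j = Q x * (\<Sum>i\<le>e. p i x * x b ^ i) + (\<Sum>i<e. r i x * x b ^ i))"
    by (intro allI pseudo_reduce_power p e)
  from choice[OF this] obtain Q where "\<forall>j. \<exists>r. polf (insert b B) (Q j) \<and> (\<forall>i<e. pold B (j * D) (r i)) \<and>
     (\<forall>x. p e x ^ j * x b ^ j = Q j x * (\<Sum>i\<le>e. p i x * x b ^ i) + (\<Sum>i<e. r i x * x b ^ i))" by blast
  from choice[OF this] obtain r where Q: "\<And>j. polf (insert b B) (Q j)" and r: "\<And>j i. i < e \<Longrightarrow> pold B (j * D) (r j i)"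
    and eq: "\<And>j x. p e x ^ j * x b ^ j = Q j x * (\<Sum>i\<le>e. p i x * x b ^ i) + (\<Sum>i<e. r j i x * x b ^ i)"
    by blast
  define Q' where "Q' x = (\<Sum>j\<le>n. c j x * p e x ^ (n - j) * Q j x)" for x
  define r' where "r' i x = (\<Sum>j\<le>n. c j x * p e x ^ (n - j) * r j i x)" for i x
  show thesis
  proof (rule that[of Q' r'])
    have "polf B (p e)" using p[of e] unfolding polf_def by auto
    moreover have "polf B (c j)" for j using c(1) unfolding polf_def by auto
    ultimately have "polf (insert b B) (p e)" "polf (insert b B) (c j)" for j by (auto intro: polf_mono)
    then show "polf (insert b B) Q'" unfolding Q'_def
      by (intro polf_sum polf_mult Q polf_power)
    show "pold B (n + n * D) (r' i)" if "i < e" for i unfolding r'_def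
    proof (rule pold_sum)
      fix j assume "j \<in> {..n}"
      then have e: "n + (n - j) * D + j * D = n + n * D" by (simp flip: distrib_right)
      show "pold B (n + n * D) (\<lambda>x. c j x * p e x ^ (n - j) * r j i x)"
        using pold_mult[OF pold_mult[OF c(1)[of j] pold_power[OF p[OF order_refl], of "n - j"]] r[OF that, of j]]
        unfolding e .
    qed
    fix x
    define P where "P = (\<Sum>i\<le>e. p i x * x b ^ i)"
    have "p e x ^ n * f x = (\<Sum>j\<le>n. c j x * p e x ^ (n - j) * (p e x ^ j * x b ^ j))"
      unfolding c(2) sum_distrib_left
    proof (rule sum.cong)
      fix j assume "j \<in> {..n}"
      then have "p e x ^ n = p e x ^ (n - j) * p e x ^ j" by (simp flip: power_add)
      then show "p e x ^ n * (c j x * x b ^ j) = c j x * p e x ^ (n - j) * (p e x ^ j * x b ^ j)"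
        by (simp add: mult_ac)
    qed simp
    also have "\<dots> = Q' x * P + (\<Sum>j\<le>n. \<Sum>i<e. c j x * p e x ^ (n - j) * r j i x * x b ^ i)"
      unfolding eq P_def[symmetric] Q'_def
      by (simp add: distrib_left sum.distrib sum_distrib_left sum_distrib_right mult_ac)
    also have "(\<Sum>j\<le>n. \<Sum>i<e. c j x * p e x ^ (n - j) * r j i x * x b ^ i) = (\<Sum>i<e. r' i x * x b ^ i)"
      unfolding r'_def by (subst sum.swap) (simp add: sum_distrib_right)
    finally show "p e x ^ n * f x = Q' x * (\<Sum>i\<le>e. p i x * x b ^ i) + (\<Sum>i<e. r' i x * x b ^ i)"
      unfolding P_def .
  qed
qed

section \<open>Extension of zeros and the Nullstellensatz\<close>

lemma poly_eqI_all:
  fixes p q :: "'a::{idom, ring_char_0} poly"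
  shows "(\<And>t. poly p t = poly q t) \<Longrightarrow> p = q"
  using poly_eq_poly_eq_iff by blast

text \<open>Over an algebraically closed field \<open>p\<close> is, up to a constant, a product of
  \<open>degree p\<close> linear factors, and each of them divides \<open>q\<close>.\<close>

lemma roots_subset_imp_dvd_power:
  fixes p q :: "'a::alg_closed_field poly"
  assumes "p \<noteq> 0" "\<And>t. poly p t = 0 \<Longrightarrow> poly q t = 0"
  shows "p dvd q ^ degree p"
  using assms
proof (induction "degree p" arbitrary: p)
  case 0
  then have "is_unit p" by (simp add: is_unit_iff_degree)
  then show ?case by (rule unit_imp_dvd)
next
  case (Suc n)
  then obtain t where t: "poly p t = 0" using alg_closed_imp_poly_has_root[of p] by auto
  then obtain p' where p': "p = [:- t, 1:] * p'" using poly_eq_0_iff_dvd[of p t] by (auto simp: dvd_def)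
  with Suc.prems have "p' \<noteq> 0" by auto
  then have "degree p = Suc (degree p')" using p' degree_mult_eq[of "[:- t, 1:]" p'] by simp
  then have "n = degree p'" using Suc.hyps(2) by simp
  moreover have "poly q s = 0" if "poly p' s = 0" for s using Suc.prems(2)[of s] that p' by simp
  ultimately have "p' dvd q ^ degree p'" using Suc.hyps(1) \<open>p' \<noteq> 0\<close> by blast
  moreover have "[:- t, 1:] dvd q" using Suc.prems(2)[OF t] by (simp add: poly_eq_0_iff_dvd)
  ultimately have "p dvd q * q ^ degree p'" unfolding p' by (intro mult_dvd_mono)
  then show ?case using \<open>degree p = Suc (degree p')\<close> by simp
qed

text \<open>Only the members of \<open>J\<close> in the variables \<open>B\<close> are imposed and
  all other coordinates are free: the cylinder over the zero set of an elimination ideal.\<close>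

definition zeros :: "(('v \<Rightarrow> 'a::comm_ring_1) \<Rightarrow> 'a) set \<Rightarrow> 'v set \<Rightarrow> ('v \<Rightarrow> 'a) set" where
  "zeros J B = {y. \<forall>f\<in>J. polf B f \<longrightarrow> f y = 0}"

locale poly_ideal =
  fixes M :: "'v set" and J :: "(('v \<Rightarrow> 'a::comm_ring_1) \<Rightarrow> 'a) set"
  assumes polf: "f \<in> J \<Longrightarrow> polf M f"
    and zero: "(\<lambda>x. 0) \<in> J"
    and add: "f \<in> J \<Longrightarrow> g \<in> J \<Longrightarrow> (\<lambda>x. f x + g x) \<in> J"
    and mult: "f \<in> J \<Longrightarrow> polf M g \<Longrightarrow> (\<lambda>x. g x * f x) \<in> J"
begin

lemma uminus: "f \<in> J \<Longrightarrow> (\<lambda>x. - f x) \<in> J"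
  using mult[of f "\<lambda>x. - 1"] by simp

lemma diff: "f \<in> J \<Longrightarrow> g \<in> J \<Longrightarrow> (\<lambda>x. f x - g x) \<in> J"
  using add[OF _ uminus] by simp

lemma sum: "(\<And>i. i \<in> I \<Longrightarrow> f i \<in> J) \<Longrightarrow> (\<lambda>x. \<Sum>i\<in>I. f i x) \<in> J"
  by (induction I rule: infinite_finite_induct) (auto intro: zero add)

end

locale prime_ideal = poly_ideal M J for M :: "'v set" and J :: "(('v \<Rightarrow> 'a::{alg_closed_field, field_char_0}) \<Rightarrow> 'a) set" +
  assumes proper: "(\<lambda>x. 1) \<notin> J"
    and prime: "polf M f \<Longrightarrow> polf M g \<Longrightarrow> (\<lambda>x. f x * g x) \<in> J \<Longrightarrow> f \<in> J \<or> g \<in> J"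
begin

lemma prime_power: "polf M f \<Longrightarrow> (\<lambda>x. f x ^ n) \<in> J \<Longrightarrow> f \<in> J"
  by (induction n) (use proper prime polf_power in fastforce)+

text \<open>For a prime ideal this is algebraicity of \<open>x b\<close> over the fraction field of
  the coordinates \<open>B\<close> modulo \<open>J\<close>, with denominators cleared.\<close>

definition algebraic_over :: "'v set \<Rightarrow> 'v \<Rightarrow> nat \<Rightarrow> bool" where
  "algebraic_over B b e \<longleftrightarrow> (\<exists>p. (\<forall>i\<le>e. polf B (p i)) \<and> p e \<notin> J \<and> (\<lambda>x. \<Sum>i\<le>e. p i x * x b ^ i) \<in> J)"

lemma algebraic_over_mono: "algebraic_over B b e \<Longrightarrow> B \<subseteq> C \<Longrightarrow> algebraic_over C b e"
  unfolding algebraic_over_def using polf_mono by blast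

lemma algebraic_over_pos: "algebraic_over B b e \<Longrightarrow> e > 0"
  unfolding algebraic_over_def by (cases e) auto

lemma algebraic_overE:
  assumes "algebraic_over B b e"
  obtains p D where "\<And>i. i \<le> e \<Longrightarrow> pold B D (p i)" "p e \<notin> J" "(\<lambda>x. \<Sum>i\<le>e. p i x * x b ^ i) \<in> J"
proof -
  obtain p where p: "\<forall>i\<le>e. polf B (p i)" "p e \<notin> J" "(\<lambda>x. \<Sum>i\<le>e. p i x * x b ^ i) \<in> J"
    using assms unfolding algebraic_over_def by blast
  then have "\<forall>i. \<exists>n. i \<le> e \<longrightarrow> pold B n (p i)" unfolding polf_def by blast
  from choice[OF this] obtain d where d: "\<forall>i\<le>e. pold B (d i) (p i)" by blast
  have "pold B (Max (d ` {..e})) (p i)" if "i \<le> e" for i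
    by (rule pold_mono[OF d[rule_format, OF that]]) (use that in auto)
  then show thesis using that p by blast
qed

text \<open>A leading coefficient outside \<open>J\<close> would make the sum a relation of
  forbidden degree; once it lies in \<open>J\<close>, its term can be subtracted and the next
  coefficient treated alike.\<close>

lemma coefficient_in_ideal:
  assumes b: "b \<in> M" and B: "B \<subseteq> M" and c: "\<And>i. i < n \<Longrightarrow> polf B (c i)"
    and J: "(\<lambda>x. \<Sum>i<n. c i x * x b ^ i) \<in> J" and na: "\<And>e. e < n \<Longrightarrow> \<not> algebraic_over B b e"
  shows "i < n \<Longrightarrow> c i \<in> J"
  using c J na
proof (induction n)
  case (Suc n)
  have cn: "c n \<in> J"
  proof (rule ccontr)
    assume "c n \<notin> J"
    then have "algebraic_over B b n"
      using Suc.prems(2,3) unfolding algebraic_over_def lessThan_Suc_atMost by (intro exI[of _ c]) auto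
    then show False using Suc.prems(4) by blast
  qed
  have "(\<lambda>x. x b ^ n * c n x) \<in> J" using cn b by (intro mult polf_power polf_coord)
  from diff[OF Suc.prems(3) this] have "(\<lambda>x. \<Sum>i<n. c i x * x b ^ i) \<in> J"
    by (simp add: mult.commute)
  then show ?case using Suc cn by (cases "i = n") auto
qed simp

lemma zeros_fun_upd:
  assumes "b \<notin> B" "polf B f" shows "f (y(b := t)) = f y"
  by (rule polf_cong[OF assms(2)]) (use assms(1) in auto)

text \<open>
  If \<open>b\<close> is algebraic over \<open>B\<close>, pseudo-division by an element of \<open>J\<close> of minimal degree in \<open>b\<close> shows
  that over a point where its leading coefficient does not vanish every root extends the zero.
\<close>

lemma extend_zero_coord:
  assumes b: "b \<notin> B" "b \<in> M" and B: "B \<subseteq> M" and f: "polf (insert b B) f" "f \<notin> J"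
  shows "\<exists>g. polf B g \<and> g \<notin> J \<and> (\<forall>y\<in>zeros J B. g y \<noteq> 0 \<longrightarrow> (\<exists>t. y(b := t) \<in> zeros J (insert b B) \<and> f (y(b := t)) \<noteq> 0))"
proof (cases "\<exists>e. algebraic_over B b e")
  \<comment> \<open>Without any relation for \<open>b\<close>, every member of \<open>J\<close> has
    its coefficients in \<open>J\<close>, so every value of \<open>b\<close> extends the zero and
    only \<open>f\<close> has to be kept nonzero.\<close>
  case False
  obtain n c where c: "\<And>i. polf B (c i)" "\<And>x. f x = (\<Sum>i\<le>n. c i x * x b ^ i)"
    using polf_decomp[OF f(1)] by blast
  have "\<exists>i\<le>n. c i \<notin> J"
  proof (rule ccontr)
    assume "\<not> ?thesis"
    then have "(\<lambda>x. \<Sum>i\<le>n. x b ^ i * c i x) \<in> J"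
      using b by (intro sum mult polf_power polf_coord) auto
    then have "(\<lambda>x. f x) \<in> J" unfolding c(2) by (simp add: mult.commute)
    then show False using f by simp
  qed
  then obtain i where i: "i \<le> n" "c i \<notin> J" by blast
  show ?thesis
  proof (intro exI[of _ "c i"] conjI ballI impI)
    fix y assume y: "y \<in> zeros J B" "c i y \<noteq> 0"
    define p where "p = (\<Sum>i\<le>n. monom (c i y) i)"
    have p: "poly p t = f (y(b := t))" for t
      unfolding c(2) by (simp add: zeros_fun_upd[OF b(1) c(1)] p_def poly_sum poly_monom)
    have "coeff p i = c i y" using i by (simp add: p_def coeff_sum)
    then have "p \<noteq> 0" using y by auto
    then obtain t where "poly p t \<noteq> 0" using poly_all_0_iff_0 by blast
    moreover have "h (y(b := t)) = 0" if h: "h \<in> J" "polf (insert b B) h" for h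
    proof -
      obtain n d where d: "\<And>i. polf B (d i)" "\<And>x. h x = (\<Sum>i\<le>n. d i x * x b ^ i)"
        using polf_decomp[OF h(2)] by blast
      have "(\<lambda>x. \<Sum>i<Suc n. d i x * x b ^ i) \<in> J"
        using h(1) unfolding d(2)[abs_def] lessThan_Suc_atMost[symmetric] by (simp add: d(2)[symmetric])
      then have "d i \<in> J" if "i < Suc n" for i
        using coefficient_in_ideal[OF b(2) B, of "Suc n" d i] d(1) False that by blast
      then have "d i y = 0" if "i \<le> n" for i using that y(1) d(1) unfolding zeros_def by auto
      then show ?thesis unfolding d(2) by (simp add: zeros_fun_upd[OF b(1) d(1)])
    qed
    ultimately show "\<exists>t. y(b := t) \<in> zeros J (insert b B) \<and> f (y(b := t)) \<noteq> 0"
      using p unfolding zeros_def by auto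
  qed (use i c in auto)
next
  case True
  define e where "e = (LEAST e. algebraic_over B b e)"
  have e: "algebraic_over B b e" and emin: "\<And>e'. e' < e \<Longrightarrow> \<not> algebraic_over B b e'"
    unfolding e_def using True LeastI_ex not_less_Least by blast+
  have e0: "e > 0" using algebraic_over_pos[OF e] .
  obtain p D where p: "\<And>i. i \<le> e \<Longrightarrow> pold B D (p i)" "p e \<notin> J" "(\<lambda>x. \<Sum>i\<le>e. p i x * x b ^ i) \<in> J"
    by (rule algebraic_overE[OF e], rule that)
  have pB: "polf B (p i)" if "i \<le> e" for i using p(1)[OF that] unfolding polf_def by blast
  have pM: "polf M (p e)" using polf_mono[OF pB B] by simp
  have fM: "polf M f" by (rule polf_mono[OF f(1)]) (use B b(2) in auto)
  \<comment> \<open>The exponent is the degree of the divisor: if \<open>f\<close> vanished at all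
    its roots, the divisor would divide this power.\<close>
  obtain n where n: "pold (insert b B) n (\<lambda>x. f x ^ e)" using polf_power[OF f(1)] unfolding polf_def by blast
  obtain Q r where Q: "polf (insert b B) Q" and r: "\<And>i. i < e \<Longrightarrow> pold B (n + n * D) (r i)"
    and eq: "\<And>x. p e x ^ n * f x ^ e = Q x * (\<Sum>i\<le>e. p i x * x b ^ i) + (\<Sum>i<e. r i x * x b ^ i)"
    using pseudo_reduce[where p = p, OF p(1) e0 n] by blast
  have rB: "polf B (r i)" if "i < e" for i using r[OF that] unfolding polf_def by blast
  \<comment> \<open>Otherwise the product of powers of \<open>p e\<close> and \<open>f\<close> would
    lie in the prime ideal, although neither factor does.\<close>
  have "\<exists>i<e. r i \<notin> J"
  proof (rule ccontr)
    assume "\<not> ?thesis"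
    then have "(\<lambda>x. \<Sum>i<e. x b ^ i * r i x) \<in> J"
      using b by (intro sum mult polf_power polf_coord) auto
    moreover have "(\<lambda>x. Q x * (\<Sum>i\<le>e. p i x * x b ^ i)) \<in> J"
      using p(3) Q B b(2) polf_mono by (intro mult) blast+
    ultimately have "(\<lambda>x. p e x ^ n * f x ^ e) \<in> J"
      unfolding eq using add by (force simp: mult.commute)
    then have "(\<lambda>x. p e x ^ n) \<in> J \<or> (\<lambda>x. f x ^ e) \<in> J"
      using pM fM by (intro prime polf_power)
    then show False using prime_power pM fM p(2) f(2) by blast
  qed
  then obtain i where i: "i < e" "r i \<notin> J" by blast
  show ?thesis
  proof (intro exI[of _ "\<lambda>x. p e x * r i x"] conjI ballI impI)
    show "polf B (\<lambda>x. p e x * r i x)" using pB rB i by (auto intro: polf_mult)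
    show "(\<lambda>x. p e x * r i x) \<notin> J"
      using prime[OF pM polf_mono[OF rB[OF i(1)] B]] p(2) i(2) by blast
    fix y assume y: "y \<in> zeros J B" "p e y * r i y \<noteq> 0"
    define pY where "pY = (\<Sum>i\<le>e. monom (p i y) i)"
    define rY where "rY = (\<Sum>i<e. monom (r i y) i)"
    have ev_p: "(\<Sum>i\<le>e. p i (y(b := t)) * (y(b := t)) b ^ i) = poly pY t" for t
      using zeros_fun_upd[OF b(1) pB] by (simp add: pY_def poly_sum poly_monom)
    have ev_r: "(\<Sum>i<e. r i (y(b := t)) * (y(b := t)) b ^ i) = poly rY t" for t
      using zeros_fun_upd[OF b(1) rB] by (simp add: rY_def poly_sum poly_monom)
    have upd: "\<exists>q. \<forall>t. (y(b := t)) v = poly q t" for v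
      by (cases "v = b") (auto intro: exI[of _ "[:0, 1:]"] exI[of _ "[:y v:]"])
    obtain fY where fY: "\<And>t. f (y(b := t)) = poly fY t"
      using polf_univariate[OF f(1), of "\<lambda>v t. (y(b := t)) v", OF upd] by blast
    obtain QY where QY: "\<And>t. Q (y(b := t)) = poly QY t"
      using polf_univariate[OF Q, of "\<lambda>v t. (y(b := t)) v", OF upd] by blast
    have "coeff pY e = p e y" "coeff rY i = r i y"
      using i by (simp_all add: pY_def rY_def coeff_sum)
    then have nz: "pY \<noteq> 0" "rY \<noteq> 0" "coeff pY e \<noteq> 0" using y(2) by auto
    have "degree pY \<le> e" unfolding pY_def
      by (rule degree_sum_le) (auto intro: order_trans[OF degree_monom_le])
    then have dp: "degree pY = e" using le_degree[OF nz(3)] by simp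
    have dr: "degree rY < e" unfolding rY_def
      by (rule degree_sum_less) (use e0 in \<open>auto intro: le_less_trans[OF degree_monom_le]\<close>)
    \<comment> \<open>If \<open>f\<close> vanished at every root, the divisor would divide
      \<open>f ^ e\<close> and hence the remainder, which is nonzero of smaller degree.\<close>
    have "\<exists>t. poly pY t = 0 \<and> poly fY t \<noteq> 0"
    proof (rule ccontr)
      assume "\<not> ?thesis"
      then have "pY dvd fY ^ e" using roots_subset_imp_dvd_power[OF nz(1), of fY] dp by blast
      moreover have "Polynomial.smult (p e y ^ n) (fY ^ e) = QY * pY + rY"
        using eq[of "y(b := _)"] zeros_fun_upd[OF b(1) pB[of e]]
        by (intro poly_eqI_all) (simp add: ev_p[simplified] ev_r[simplified] fY QY)
      ultimately have "pY dvd rY"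
        by (metis dvd_add_right_iff dvd_smult dvd_triv_right)
      then show False using dvd_imp_degree_le[of pY rY] nz dp dr by simp
    qed
    then obtain t where t: "poly pY t = 0" "poly fY t \<noteq> 0" by blast
    \<comment> \<open>By minimality of \<open>e\<close> the remainder coefficients of
      \<open>h\<close> lie in \<open>J\<close> and vanish at \<open>y\<close>; at a root of the
      divisor \<open>p e ^ m * h\<close> is then 0, while \<open>p e\<close> is not.\<close>
    have "h (y(b := t)) = 0" if h: "h \<in> J" "polf (insert b B) h" for h
    proof -
      obtain m where m: "pold (insert b B) m h" using h unfolding polf_def by blast
      obtain Q' r' where Q': "polf (insert b B) Q'" and r': "\<And>i. i < e \<Longrightarrow> pold B (m + m * D) (r' i)"
        and eq': "\<And>x. p e x ^ m * h x = Q' x * (\<Sum>i\<le>e. p i x * x b ^ i) + (\<Sum>i<e. r' i x * x b ^ i)"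
        using pseudo_reduce[where p = p, OF p(1) e0 m] by blast
      have r'B: "polf B (r' i)" if "i < e" for i using r'[OF that] unfolding polf_def by blast
      have "(\<lambda>x. p e x ^ m * h x) \<in> J" using h(1) pM by (intro mult polf_power)
      moreover have "(\<lambda>x. Q' x * (\<Sum>i\<le>e. p i x * x b ^ i)) \<in> J"
        using p(3) Q' B b(2) polf_mono by (intro mult) blast+
      ultimately have "(\<lambda>x. p e x ^ m * h x - Q' x * (\<Sum>i\<le>e. p i x * x b ^ i)) \<in> J" by (rule diff)
      then have "(\<lambda>x. \<Sum>i<e. r' i x * x b ^ i) \<in> J" unfolding eq' by simp
      then have "r' i \<in> J" if "i < e" for i
        using coefficient_in_ideal[OF b(2) B, of e r' i] r'B emin that by blast
      then have "r' i y = 0" if "i < e" for i using that y(1) r'B unfolding zeros_def by auto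
      then have "p e y ^ m * h (y(b := t)) = 0"
        using eq'[of "y(b := t)"] zeros_fun_upd[OF b(1) pB[of e]] zeros_fun_upd[OF b(1) r'B] ev_p[of t] t(1) by simp
      then show ?thesis using y(2) by simp
    qed
    then have "y(b := t) \<in> zeros J (insert b B)" unfolding zeros_def by blast
    then show "\<exists>t. y(b := t) \<in> zeros J (insert b B) \<and> f (y(b := t)) \<noteq> 0"
      using t(2) fY by auto
  qed
qed

text \<open>The coordinate added last yields a condition on the earlier ones, and this condition
  becomes the function to be kept nonzero in the induction.\<close>

lemma extend_zero:
  assumes "finite D" "B \<subseteq> M" "D \<subseteq> M" "B \<inter> D = {}" "polf (B \<union> D) f" "f \<notin> J"
  shows "\<exists>g. polf B g \<and> g \<notin> J \<and> (\<forall>y\<in>zeros J B. g y \<noteq> 0 \<longrightarrow>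
     (\<exists>y'\<in>zeros J (B \<union> D). (\<forall>v\<in>B. y' v = y v) \<and> f y' \<noteq> 0))"
  using assms
proof (induction D arbitrary: f rule: finite_induct)
  case empty
  then show ?case by (intro exI[of _ f]) auto
next
  case (insert b D)
  then obtain g where g: "polf (B \<union> D) g" "g \<notin> J"
    "\<forall>y\<in>zeros J (B \<union> D). g y \<noteq> 0 \<longrightarrow> (\<exists>t. y(b := t) \<in> zeros J (insert b (B \<union> D)) \<and> f (y(b := t)) \<noteq> 0)"
    using extend_zero_coord[of b "B \<union> D" f] by auto
  then obtain g' where g': "polf B g'" "g' \<notin> J" "\<forall>y\<in>zeros J B. g' y \<noteq> 0 \<longrightarrow>
     (\<exists>y'\<in>zeros J (B \<union> D). (\<forall>v\<in>B. y' v = y v) \<and> g y' \<noteq> 0)" using insert by blast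
  show ?case
  proof (intro exI[of _ g'] conjI ballI impI g')
    fix y assume "y \<in> zeros J B" "g' y \<noteq> 0"
    then obtain y' where y': "y' \<in> zeros J (B \<union> D)" "\<forall>v\<in>B. y' v = y v" "g y' \<noteq> 0" using g' by blast
    then obtain t where t: "y'(b := t) \<in> zeros J (insert b (B \<union> D))" "f (y'(b := t)) \<noteq> 0" using g(3) by blast
    have "\<forall>v\<in>B. (y'(b := t)) v = y v" using y'(2) insert.prems by auto
    then show "\<exists>y'\<in>zeros J (B \<union> insert b D). (\<forall>v\<in>B. y' v = y v) \<and> f y' \<noteq> 0" using t
      by (intro bexI[of _ "y'(b := t)"]) auto
  qed
qed

text \<open>This is \<open>extend_zero\<close> over the empty set of coordinates: a proper ideal
  contains no nonzero constant, so no condition is left at the start.\<close>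

theorem nullstellensatz:
  assumes "finite M" "polf M f" "f \<notin> J"
  shows "\<exists>y\<in>zeros J M. f y \<noteq> 0"
proof -
  obtain g where g: "polf {} g" "g \<notin> J" "\<forall>y\<in>zeros J {}. g y \<noteq> 0 \<longrightarrow> (\<exists>y'\<in>zeros J ({} \<union> M). (\<forall>v\<in>{}. y' v = y v) \<and> f y' \<noteq> 0)"
    using extend_zero[of M "{}" f] assms by auto
  have const: "h = (\<lambda>x. h (\<lambda>v. 0))" if "polf {} h" for h :: "('v \<Rightarrow> 'a) \<Rightarrow> 'a"
    using polf_cong[OF that] by (intro ext) auto
  have "h y = 0" if h: "h \<in> J" "polf {} h" for h y
  proof (rule ccontr)
    assume nz: "h y \<noteq> 0"
    have "h x = h y" for x using polf_cong[OF h(2)] by auto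
    then have "(\<lambda>x. 1 / h y * h x) = (\<lambda>x. 1)" using nz by auto
    moreover have "(\<lambda>x. 1 / h y * h x) \<in> J" by (rule mult[OF h(1)]) simp
    ultimately show False using proper by simp
  qed
  then have "zeros J {} = UNIV" unfolding zeros_def by auto
  moreover have "g (\<lambda>v. 0) \<noteq> 0" using const[OF g(1)] g(2) zero by metis
  ultimately show ?thesis using g(3) by auto
qed

end

section \<open>Vanishing ideals, and chains of primes obtained by specialization\<close>

definition van :: "'v set \<Rightarrow> ('v \<Rightarrow> 'a::comm_ring_1) set \<Rightarrow> (('v \<Rightarrow> 'a) \<Rightarrow> 'a) set" where
  "van M V = {f. polf M f \<and> (\<forall>x\<in>V. f x = 0)}"

lemma prime_ideal_van:
  fixes V :: "('v \<Rightarrow> 'a::{alg_closed_field, field_char_0}) set"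
  assumes "pirr M V" shows "prime_ideal M (van M V)"
proof
  show "(\<lambda>x. 1) \<notin> van M V" using assms unfolding van_def pirr_def by auto
  fix f g assume fg: "polf M f" "polf M g" "(\<lambda>x. f x * g x) \<in> van M V"
  show "f \<in> van M V \<or> g \<in> van M V"
  proof (rule ccontr)
    assume "\<not> ?thesis"
    then have "\<exists>x\<in>V. f x \<noteq> 0" "\<exists>x\<in>V. g x \<noteq> 0" using fg unfolding van_def by auto
    then have "\<exists>x\<in>V. f x * g x \<noteq> 0" using assms fg unfolding pirr_def by blast
    then show False using fg unfolding van_def by auto
  qed
qed (auto simp: van_def intro: polf_add polf_mult)

text \<open>By the Nullstellensatz a function outside \<open>J\<close> is nonzero at some zero of
  \<open>J\<close>, so primality passes from the ideal to its zero set.\<close>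

lemma pirr_zeros:
  fixes J :: "(('v \<Rightarrow> 'a::{alg_closed_field, field_char_0}) \<Rightarrow> 'a) set"
  assumes "prime_ideal M J" "finite M" shows "pirr M (zeros J M)"
proof -
  interpret prime_ideal M J by fact
  show ?thesis unfolding pirr_def
  proof (intro conjI allI impI)
    show "zeros J M \<noteq> {}" using nullstellensatz[OF assms(2) _ proper] by auto
    fix f g :: "('v \<Rightarrow> 'a) \<Rightarrow> 'a"
    assume A: "polf M f \<and> polf M g \<and> (\<exists>x\<in>zeros J M. f x \<noteq> 0) \<and> (\<exists>x\<in>zeros J M. g x \<noteq> 0)"
    then have "f \<notin> J" "g \<notin> J" unfolding zeros_def by auto
    then have "(\<lambda>x. f x * g x) \<notin> J" using A prime by blast
    then show "\<exists>x\<in>zeros J M. f x * g x \<noteq> 0"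
      using nullstellensatz[OF assms(2)] A polf_mult by blast
  qed
qed

lemma poly_ideal_adjoin:
  fixes I :: "(('v \<Rightarrow> 'a::comm_ring_1) \<Rightarrow> 'a) set"
  assumes "poly_ideal M I" "polf M f"
  defines "I' \<equiv> {(\<lambda>x. j x + q x * f x) | j q. j \<in> I \<and> polf M q}"
  shows "poly_ideal M I'" "I \<subseteq> I'" "f \<in> I'"
proof -
  interpret poly_ideal M I by fact
  have mem: "(\<lambda>x. j x + q x * f x) \<in> I'" if "j \<in> I" "polf M q" for j q
    using that unfolding I'_def by blast
  have "j \<in> I'" if "j \<in> I" for j using mem[OF that, of "\<lambda>x. 0"] by simp
  then show sub: "I \<subseteq> I'" by blast
  show "f \<in> I'" using mem[OF zero, of "\<lambda>x. 1"] by simp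
  show "poly_ideal M I'"
  proof
    show "polf M h" if "h \<in> I'" for h
      using that assms(2) polf unfolding I'_def by (auto intro!: polf_add polf_mult)
    show "(\<lambda>x. 0) \<in> I'" using zero sub by blast
    fix h assume "h \<in> I'"
    then obtain j q where h: "h = (\<lambda>x. j x + q x * f x)" "j \<in> I" "polf M q" unfolding I'_def by blast
    show "(\<lambda>x. g x * h x) \<in> I'" if "polf M g" for g
      using mem[OF mult[OF h(2) that] polf_mult[OF that h(3)]] by (simp add: h(1) algebra_simps)
    fix h' assume "h' \<in> I'"
    then obtain j' q' where h': "h' = (\<lambda>x. j' x + q' x * f x)" "j' \<in> I" "polf M q'" unfolding I'_def by blast
    show "(\<lambda>x. h x + h' x) \<in> I'"
      using mem[OF add[OF h(2) h'(2)] polf_add[OF h(3) h'(3)]] by (simp add: h(1) h'(1) algebra_simps)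
  qed
qed

text \<open>The nonzero polynomials in \<open>B\<close> form a multiplicative set, and an ideal
  maximal among those avoiding it is prime. Zorn's lemma provides one above
  \<open>I\<close>.\<close>

lemma prime_ideal_avoiding:
  fixes I :: "(('v \<Rightarrow> 'a::{alg_closed_field, field_char_0}) \<Rightarrow> 'a) set"
  assumes I: "poly_ideal M I" and B: "B \<subseteq> M" and disj: "\<And>h. h \<in> I \<Longrightarrow> polf B h \<Longrightarrow> h = (\<lambda>x. 0)"
  shows "\<exists>J. prime_ideal M J \<and> I \<subseteq> J \<and> (\<forall>h\<in>J. polf B h \<longrightarrow> h = (\<lambda>x. 0))"
proof -
  define A where "A = {J. poly_ideal M J \<and> I \<subseteq> J \<and> (\<forall>h\<in>J. polf B h \<longrightarrow> h = (\<lambda>x. 0))}"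
  have "I \<in> A" using I disj unfolding A_def by blast
  have chain: "\<Union>C \<in> A" if C: "C \<noteq> {}" "subset.chain A C" for C
  proof -
    have CA: "C \<subseteq> A" and lin: "\<And>x y. x \<in> C \<Longrightarrow> y \<in> C \<Longrightarrow> x \<subseteq> y \<or> y \<subseteq> x"
      using C(2) unfolding subset_chain_def by blast+
    have id: "\<And>J. J \<in> C \<Longrightarrow> poly_ideal M J" using CA unfolding A_def by blast
    have "poly_ideal M (\<Union>C)"
    proof
      show "polf M f" if "f \<in> \<Union>C" for f using that id poly_ideal.polf by blast
      show "(\<lambda>x. 0) \<in> \<Union>C" using C(1) id poly_ideal.zero by blast
      show "(\<lambda>x. g x * f x) \<in> \<Union>C" if fg: "f \<in> \<Union>C" "polf M g" for f g
      proof -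
        obtain J where "J \<in> C" "f \<in> J" using fg(1) by blast
        then show ?thesis using poly_ideal.mult[OF id _ fg(2)] by blast
      qed
      fix f g assume "f \<in> \<Union>C" "g \<in> \<Union>C"
      then obtain J where "J \<in> C" "f \<in> J" "g \<in> J" using lin by blast
      then show "(\<lambda>x. f x + g x) \<in> \<Union>C" using poly_ideal.add[OF id] by blast
    qed
    then show ?thesis using CA C(1) unfolding A_def by blast
  qed
  obtain J where J: "J \<in> A" and max: "\<And>J'. J' \<in> A \<Longrightarrow> J \<subseteq> J' \<Longrightarrow> J' = J"
    using subset_Zorn_nonempty[of A] \<open>I \<in> A\<close> chain by blast
  interpret J: poly_ideal M J using J unfolding A_def by blast
  have disjJ: "\<And>h. h \<in> J \<Longrightarrow> polf B h \<Longrightarrow> h = (\<lambda>x. 0)" using J unfolding A_def by blast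
  have ext: "\<exists>h j q. j \<in> J \<and> polf M q \<and> polf B h \<and> h \<noteq> (\<lambda>x. 0) \<and> h = (\<lambda>x. j x + q x * f x)"
    if f: "polf M f" "f \<notin> J" for f
  proof -
    let ?J' = "{(\<lambda>x. j x + q x * f x) | j q. j \<in> J \<and> polf M q}"
    have J': "poly_ideal M ?J'" "J \<subseteq> ?J'" "f \<in> ?J'" using poly_ideal_adjoin[OF J.poly_ideal_axioms f(1)] by auto
    then have "?J' \<notin> A" using max f(2) by blast
    moreover have "I \<subseteq> ?J'" using J J'(2) unfolding A_def by blast
    ultimately have "\<exists>h\<in>?J'. polf B h \<and> h \<noteq> (\<lambda>x. 0)" using J'(1) unfolding A_def by blast
    then show ?thesis by blast
  qed
  have "prime_ideal M J"
  proof
    show "(\<lambda>x. 1) \<notin> J" using disjJ[of "\<lambda>x. 1"] by (auto simp: fun_eq_iff)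
    fix f g assume fg: "polf M f" "polf M g" "(\<lambda>x. f x * g x) \<in> J"
    show "f \<in> J \<or> g \<in> J"
    proof (rule ccontr)
      assume "\<not> ?thesis"
      then have nf: "f \<notin> J" "g \<notin> J" by auto
      obtain h j q where h: "j \<in> J" "polf M q" "polf B h" "h \<noteq> (\<lambda>x. 0)" "h = (\<lambda>x. j x + q x * f x)"
        using ext[OF fg(1) nf(1)] by blast
      obtain h' j' q' where h': "j' \<in> J" "polf M q'" "polf B h'" "h' \<noteq> (\<lambda>x. 0)" "h' = (\<lambda>x. j' x + q' x * g x)"
        using ext[OF fg(2) nf(2)] by blast
      have hM: "polf M h'" using h'(3) B polf_mono by blast
      \<comment> \<open>The three terms add up to \<open>h * h'\<close>, a nonzero polynomial in
        \<open>B\<close>, which cannot lie in \<open>J\<close>.\<close>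
      have "(\<lambda>x. h' x * j x) \<in> J" "(\<lambda>x. (q x * f x) * j' x) \<in> J" "(\<lambda>x. (q x * q' x) * (f x * g x)) \<in> J"
        by (intro J.mult h h' hM polf_mult fg)+
      from J.add[OF J.add[OF this(1,2)] this(3)] have "(\<lambda>x. h x * h' x) \<in> J"
        unfolding h(5) h'(5) by (simp add: algebra_simps)
      then have "(\<lambda>x. h x * h' x) = (\<lambda>x. 0)" using disjJ polf_mult[OF h(3) h'(3)] by blast
      moreover have "\<exists>x. h x * h' x \<noteq> 0"
        using pirr_UNIV[of B] h(3,4) h'(3,4) unfolding pirr_def by (auto simp: fun_eq_iff)
      ultimately show False by (auto simp: fun_eq_iff)
    qed
  qed
  then show ?thesis using J unfolding A_def by blast
qed

text \<open>
  A nonzero \<open>h\<close> in the coordinates \<open>B - {b}\<close> cannot lie in the ideal generated by \<open>J\<close> and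
  \<open>x\<^sub>b - y0\<^sub>b\<close>, since some zero of that ideal lies over a point where \<open>h\<close> does not vanish.
\<close>

lemma prime_ideal_step:
  fixes J :: "(('v \<Rightarrow> 'a::{alg_closed_field, field_char_0}) \<Rightarrow> 'a) set"
  assumes J: "prime_ideal M J" and M: "finite M" and B: "B \<subseteq> M" "b \<in> B"
    and indep: "\<And>h. h \<in> J \<Longrightarrow> polf B h \<Longrightarrow> h = (\<lambda>x. 0)"
  shows "\<exists>J'. prime_ideal M J' \<and> J \<subset> J' \<and> (\<forall>h\<in>J'. polf (B - {b}) h \<longrightarrow> h = (\<lambda>x. 0))"
proof -
  interpret prime_ideal M J by fact
  have zB: "zeros J B = UNIV" using indep unfolding zeros_def by auto
  have BM: "B \<union> (M - B) = M" using B by blast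
  obtain g where g: "polf B g" "g \<notin> J" "\<And>y. g y \<noteq> 0 \<Longrightarrow> \<exists>y'\<in>zeros J M. \<forall>v\<in>B. y' v = y v"
    using extend_zero[of "M - B" B "\<lambda>x. 1"] M B(1) proper unfolding BM zB by auto
  \<comment> \<open>The generic constant is \<open>y0 b\<close>: substituting it for the coordinate
    \<open>b\<close> leaves \<open>g\<close> a nonzero polynomial, as its value at \<open>y0\<close>
    does not change.\<close>
  obtain y0 where y0: "g y0 \<noteq> 0" using g(2) zero by (metis ext)
  define l where "l x = x b - y0 b" for x :: "'v \<Rightarrow> 'a"
  have bM: "b \<in> M" using B by blast
  have l: "polf {b} l" unfolding l_def by (intro polf_diff polf_coord) auto
  let ?I = "{(\<lambda>x. j x + q x * l x) | j q. j \<in> J \<and> polf M q}"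
  have lM: "polf M l" by (rule polf_mono[OF l]) (use bM in auto)
  note I = poly_ideal_adjoin[OF poly_ideal_axioms lM]
  have disj: "h = (\<lambda>x. 0)" if h: "h \<in> ?I" "polf (B - {b}) h" for h
  proof (rule ccontr)
    assume "h \<noteq> (\<lambda>x. 0)"
    then obtain z where z: "h z \<noteq> 0" by (auto simp: fun_eq_iff)
    obtain j q where jq: "j \<in> J" "h = (\<lambda>x. j x + q x * l x)" using h(1) by blast
    define G where "G = (\<lambda>x. g (\<lambda>v. (x(b := y0 b)) v))"
    have GB: "polf B G" unfolding G_def
    proof (rule polf_subst[OF g(1)])
      fix v assume "v \<in> B" then show "polf B (\<lambda>x. (x(b := y0 b)) v)" by (cases "v = b") (auto intro: polf_coord)
    qed
    have "G y0 \<noteq> 0" using y0 unfolding G_def fun_upd_triv .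
    moreover have hB: "polf B h" by (rule polf_mono[OF h(2)]) auto
    ultimately have "\<exists>y\<in>UNIV. G y * h y \<noteq> 0"
      using pirr_UNIV[of B, unfolded pirr_def, THEN conjunct2, rule_format, of G h] GB z by blast
    then obtain y where y: "g (y(b := y0 b)) \<noteq> 0" "h y \<noteq> 0"
      unfolding G_def by (auto simp del: fun_upd_apply)
    \<comment> \<open>Changing the coordinate \<open>b\<close> of \<open>y\<close> enforces the new
      equation without affecting \<open>h\<close>; the result then extends to a zero of
      \<open>J\<close>.\<close>
    obtain y' where y': "y' \<in> zeros J M" "\<forall>v\<in>B. y' v = (y(b := y0 b)) v" using g(3)[OF y(1)] by blast
    have "h y' = h y" by (rule polf_cong[OF h(2)]) (use y'(2) in auto)
    moreover have "j y' = 0" using y'(1) jq(1) polf unfolding zeros_def by blast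
    moreover have "l y' = 0" using y'(2) B(2) by (simp add: l_def)
    ultimately show False using y(2) jq(2) by simp
  qed
  obtain J' where J': "prime_ideal M J'" "?I \<subseteq> J'" "\<forall>h\<in>J'. polf (B - {b}) h \<longrightarrow> h = (\<lambda>x. 0)"
  proof -
    have "B - {b} \<subseteq> M" using B(1) by blast
    have "\<exists>J'. prime_ideal M J' \<and> ?I \<subseteq> J' \<and> (\<forall>h\<in>J'. polf (B - {b}) h \<longrightarrow> h = (\<lambda>x. 0))"
      by (rule prime_ideal_avoiding[OF I(1) \<open>B - {b} \<subseteq> M\<close>]) (rule disj)
    then show ?thesis using that by (elim exE conjE)
  qed
  have "l \<notin> J"
  proof
    assume "l \<in> J"
    then have "l = (\<lambda>x. 0)" using indep polf_mono[OF l, of B] B(2) by blast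
    then have "l (\<lambda>v. y0 b + 1) = 0" by simp
    then show False by (simp add: l_def)
  qed
  then have "J \<subset> J'" using I(2,3) J'(2) by blast
  then show ?thesis using J' by blast
qed

text \<open>Each step uses up one independent coordinate and leaves the others independent, so there
  is one strict inclusion per element of \<open>B\<close>.\<close>

lemma prime_ideal_chain:
  fixes J :: "(('v \<Rightarrow> 'a::{alg_closed_field, field_char_0}) \<Rightarrow> 'a) set"
  assumes "prime_ideal M J" "finite M" "B \<subseteq> M"
    and "\<And>h. h \<in> J \<Longrightarrow> polf B h \<Longrightarrow> h = (\<lambda>x. 0)"
  shows "\<exists>Js. Js 0 = J \<and> (\<forall>i\<le>card B. prime_ideal M (Js i)) \<and> (\<forall>i<card B. Js i \<subset> Js (Suc i))"
  using assms
proof (induction "card B" arbitrary: B J)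
  case 0
  then show ?case by (intro exI[of _ "\<lambda>i. J"]) auto
next
  case (Suc n)
  then obtain b where b: "b \<in> B" by fastforce
  have fB: "finite B" using Suc.prems(2,3) finite_subset by blast
  obtain J' where J': "prime_ideal M J'" "J \<subset> J'" "\<forall>h\<in>J'. polf (B - {b}) h \<longrightarrow> h = (\<lambda>x. 0)"
    using prime_ideal_step[OF Suc.prems(1,2,3) b Suc.prems(4)] by blast
  have n: "n = card (B - {b})" using Suc.hyps(2) b fB by simp
  obtain Js where Js: "Js 0 = J'" "\<forall>i\<le>n. prime_ideal M (Js i)" "\<forall>i<n. Js i \<subset> Js (Suc i)"
    using Suc.hyps(1)[OF n J'(1) Suc.prems(2)] Suc.prems(3) J'(3) unfolding n by blast
  show ?case unfolding Suc.hyps(2)[symmetric]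
  proof (intro exI[of _ "\<lambda>i. case i of 0 \<Rightarrow> J | Suc i' \<Rightarrow> Js i'"] conjI allI impI)
    fix i show "prime_ideal M (case i of 0 \<Rightarrow> J | Suc i' \<Rightarrow> Js i')" if "i \<le> Suc n"
      using that Js Suc.prems(1) by (cases i) auto
    show "(case i of 0 \<Rightarrow> J | Suc i' \<Rightarrow> Js i') \<subset> (case Suc i of 0 \<Rightarrow> J | Suc i' \<Rightarrow> Js i')" if "i < Suc n"
      using that Js J'(2) by (cases i) auto
  qed simp
qed

subsection \<open>Growth of the coordinate ring\<close>

lemma dimle_combination:
  assumes I: "finite I" and D: "\<And>i. i \<in> I \<Longrightarrow> dimle S (P i) N"
    and Q: "\<And>f. Q f \<Longrightarrow> \<exists>c. (\<forall>i\<in>I. P i (c i)) \<and> (\<forall>x\<in>S. f x = (\<Sum>i\<in>I. c i x * w i x))"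
  shows "dimle S Q (card I * N)"
proof -
  have "\<forall>i. \<exists>G. i \<in> I \<longrightarrow> finite G \<and> card G \<le> N \<and> (\<forall>f. P i f \<longrightarrow> (\<exists>c. \<forall>x\<in>S. f x = (\<Sum>g\<in>G. c g * g x)))"
    using D unfolding dimle_def by blast
  from choice[OF this] obtain G where G: "\<And>i. i \<in> I \<Longrightarrow> finite (G i)" "\<And>i. i \<in> I \<Longrightarrow> card (G i) \<le> N"
    "\<And>i f. i \<in> I \<Longrightarrow> P i f \<Longrightarrow> \<exists>c. \<forall>x\<in>S. f x = (\<Sum>g\<in>G i. c g * g x)" by blast
  show ?thesis
  proof (rule dimleI[of "Sigma I G" _ _ _ "\<lambda>(i, g) x. g x * w i x"])
    show "finite (Sigma I G)" using I G by blast
    have "card (Sigma I G) = (\<Sum>i\<in>I. card (G i))" using I G(1) by simp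
    also have "\<dots> \<le> card I * N" using sum_bounded_above[of I "\<lambda>i. card (G i)" N] G(2) by simp
    finally show "card (Sigma I G) \<le> card I * N" .
    fix f assume "Q f"
    then obtain c where c: "\<forall>i\<in>I. P i (c i)" "\<forall>x\<in>S. f x = (\<Sum>i\<in>I. c i x * w i x)" using Q by blast
    have "\<forall>i. \<exists>d. i \<in> I \<longrightarrow> (\<forall>x\<in>S. c i x = (\<Sum>g\<in>G i. d g * g x))" using c(1) G(3) by blast
    from choice[OF this] obtain d where d: "\<And>i x. i \<in> I \<Longrightarrow> x \<in> S \<Longrightarrow> c i x = (\<Sum>g\<in>G i. d i g * g x)" by blast
    have "f x = (\<Sum>j\<in>Sigma I G. (case j of (i, g) \<Rightarrow> d i g) * (case j of (i, g) \<Rightarrow> \<lambda>x. g x * w i x) x)" if x: "x \<in> S" for x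
    proof -
      have "f x = (\<Sum>i\<in>I. \<Sum>g\<in>G i. d i g * (g x * w i x))"
        using c(2) x by (auto intro!: sum.cong simp: d[OF _ x] sum_distrib_right mult.assoc)
      then show ?thesis using I G(1) by (simp add: sum.Sigma split_beta)
    qed
    then show "\<exists>c. \<forall>x\<in>S. f x = (\<Sum>j\<in>Sigma I G. c j * (case j of (i, g) \<Rightarrow> \<lambda>x. g x * w i x) x)"
      by (intro exI[of _ "\<lambda>j. case j of (i, g) \<Rightarrow> d i g"] ballI)
  qed
qed

lemma dimle_pold:
  "finite B \<Longrightarrow> dimle V (pold B n) ((n + 1) ^ card B)"
proof (induction B rule: finite_induct)
  case empty
  show ?case
  proof (rule dimleI[of "{()}" _ _ _ "\<lambda>_ x. 1"])
    fix f :: "('a \<Rightarrow> 'b) \<Rightarrow> 'b" assume "pold {} n f"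
    then have "polf {} f" unfolding polf_def by blast
    then have "f x = f (\<lambda>v. 0)" for x by (rule polf_cong) auto
    then show "\<exists>c. \<forall>x\<in>V. f x = (\<Sum>j\<in>{()}. c j * 1)" by (intro exI[of _ "\<lambda>_. f (\<lambda>v. 0)"]) simp
  qed auto
next
  case (insert b B)
  have "dimle V (pold (insert b B) n) (card {..n} * (n + 1) ^ card B)"
  proof (rule dimle_combination[where P = "\<lambda>i. pold B n" and w = "\<lambda>i x. x b ^ i"])
    fix f :: "('a \<Rightarrow> 'b) \<Rightarrow> 'b" assume "pold (insert b B) n f"
    from pold_decomp[OF this]
    show "\<exists>c. (\<forall>i\<in>{..n}. pold B n (c i)) \<and> (\<forall>x\<in>V. f x = (\<Sum>i\<le>n. c i x * x b ^ i))" by blast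
  qed (use insert in auto)
  then show ?case using insert by simp
qed

text \<open>The variable \<open>b\<close> is kept until last: forms of degree \<open>n\<close> in
  one variable are multiples of a single power, so only the other variables contribute to the
  exponent.\<close>

lemma dimle_homf:
  assumes "finite B" shows "dimle V (homf (insert b B) n) ((n + 1) ^ card (B - {b}))"
proof -
  have "finite D \<Longrightarrow> b \<notin> D \<Longrightarrow> dimle V (homf (insert b D) n) ((n + 1) ^ card D)" for D n
  proof (induction D arbitrary: n rule: finite_induct)
    case empty
    show ?case
    proof (rule dimleI[of "{()}" _ _ _ "\<lambda>_ x. x b ^ n"])
      fix f :: "('a \<Rightarrow> 'b) \<Rightarrow> 'b" assume "homf {b} n f"
      then have "f x = f (\<lambda>v. x b * 1)" for x by (rule hom_cong) auto
      then have eq: "f x = x b ^ n * f (\<lambda>v. 1)" for x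
        using hom_homog[OF \<open>homf {b} n f\<close>, of "x b" "\<lambda>v. 1"] by metis
      show "\<exists>c. \<forall>x\<in>V. f x = (\<Sum>j\<in>{()}. c j * x b ^ n)"
        by (intro exI[of _ "\<lambda>_. f (\<lambda>v. 1)"] ballI) (subst eq, simp add: mult.commute)
    qed auto
  next
    case (insert a D)
    have "dimle V (homf (insert a (insert b D)) n) (card {..n} * (n + 1) ^ card D)"
    proof (rule dimle_combination[where P = "\<lambda>i. homf (insert b D) (n - i)" and w = "\<lambda>i x. x a ^ i"])
      fix i assume "i \<in> {..n}"
      have "dimle V (homf (insert b D) (n - i)) ((n - i + 1) ^ card D)" using insert by auto
      then show "dimle V (homf (insert b D) (n - i)) ((n + 1) ^ card D)"
        by (rule dimle_mono) (auto intro: power_mono)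
    next
      fix f :: "('a \<Rightarrow> 'b) \<Rightarrow> 'b" assume "homf (insert a (insert b D)) n f"
      from hom_decomp[OF this]
      show "\<exists>c. (\<forall>i\<in>{..n}. homf (insert b D) (n - i) (c i)) \<and> (\<forall>x\<in>V. f x = (\<Sum>i\<le>n. c i x * x a ^ i))" by blast
    qed simp
    then show ?case using insert by (simp add: insert_commute)
  qed
  from this[of "B - {b}" n] show ?thesis using assms by simp
qed

definition pgrow :: "('v \<Rightarrow> 'a::field) set \<Rightarrow> 'v set \<Rightarrow> nat \<Rightarrow> bool" where
  "pgrow V B d \<longleftrightarrow> (\<exists>C. \<forall>n. dimle V (pold B n) (C * (n + 1) ^ d))"

text \<open>
  Multiplication by the \<open>n\<close>-th power of the leading coefficient is injective on \<open>V\<close> and turns a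
  function of degree \<open>n\<close> into a combination of the powers of \<open>x\<^sub>b\<close> below \<open>e\<close>.
\<close>

lemma pgrow_algebraic:
  fixes V :: "('v \<Rightarrow> 'a::{alg_closed_field, field_char_0}) set"
  assumes V: "pirr M V" and B: "B \<subseteq> M" "b \<in> M"
    and alg: "prime_ideal.algebraic_over (van M V) B b e" and g: "pgrow V B d"
  shows "pgrow V (insert b B) d"
proof -
  interpret prime_ideal M "van M V" by (rule prime_ideal_van[OF V])
  have e0: "e > 0" by (rule algebraic_over_pos[OF alg])
  obtain p D where p: "\<And>i. i \<le> e \<Longrightarrow> pold B D (p i)" "p e \<notin> van M V"
    "(\<lambda>x. \<Sum>i\<le>e. p i x * x b ^ i) \<in> van M V"
    by (rule algebraic_overE[OF alg], rule that)
  obtain C where C: "\<And>n. dimle V (pold B n) (C * (n + 1) ^ d)" using g unfolding pgrow_def by blast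
  have pM: "polf M (p e)" using polf_mono[of B "p e" M] p(1)[of e] B unfolding polf_def by auto
  have "dimle V (pold (insert b B) n) (e * C * (D + 1) ^ d * (n + 1) ^ d)" for n
  proof (rule dimle_of_indep_bound)
    fix h and q :: nat
    assume h: "\<And>i. i < q \<Longrightarrow> pold (insert b B) n (h i)" "indep_on V h {..<q}"
    \<comment> \<open>Remainders of degree below \<open>e\<close> in \<open>x b\<close>. Their
      dimension is at most \<open>e\<close> times that of the coefficients, whose degree
      \<open>n + n * D\<close> is linear in \<open>n\<close>.\<close>
    define R where "R f \<longleftrightarrow> (\<exists>r. (\<forall>i<e. pold B (n + n * D) (r i)) \<and> (\<forall>x\<in>V. f x = (\<Sum>i<e. r i x * x b ^ i)))"
      for f :: "('v \<Rightarrow> 'a) \<Rightarrow> 'a"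
    have "dimle V R (card {..<e} * (C * (n + n * D + 1) ^ d))"
      by (rule dimle_combination[where P = "\<lambda>i. pold B (n + n * D)" and w = "\<lambda>i x. x b ^ i"])
        (use C in \<open>auto simp: R_def\<close>)
    moreover have "R (\<lambda>x. p e x ^ n * h i x)" if "i \<in> {..<q}" for i
    proof -
      have hi: "pold (insert b B) n (h i)" using h(1) that by blast
      obtain Q r where r: "\<And>i. i < e \<Longrightarrow> pold B (n + n * D) (r i)"
        and eq: "\<And>x. p e x ^ n * h i x = Q x * (\<Sum>i\<le>e. p i x * x b ^ i) + (\<Sum>i<e. r i x * x b ^ i)"
        by (rule pseudo_reduce[where p = p and D = D, OF _ e0 hi], erule p(1), rule that, assumption+)
      have "\<forall>x\<in>V. p e x ^ n * h i x = (\<Sum>i<e. r i x * x b ^ i)"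
        using p(3) unfolding eq van_def by simp
      then show ?thesis using r unfolding R_def by blast
    qed
    moreover have "indep_on V (\<lambda>i x. p e x ^ n * h i x) {..<q}"
      unfolding indep_on_def
    proof (intro allI impI)
      fix c assume c: "\<forall>x\<in>V. (\<Sum>i<q. c i * (p e x ^ n * h i x)) = 0"
      define F where "F = (\<lambda>x. \<Sum>i<q. c i * h i x)"
      have Fp: "polf M F" unfolding F_def
      proof (intro polf_sum polf_scale)
        fix i assume "i \<in> {..<q}"
        then have "polf (insert b B) (h i)" using h(1) unfolding polf_def by blast
        then show "polf M (h i)" by (rule polf_mono) (use B in auto)
      qed
      have "(\<Sum>i<q. c i * (p e x ^ n * h i x)) = p e x ^ n * F x" for x
        by (simp add: F_def sum_distrib_left mult_ac)
      then have "(\<lambda>x. p e x ^ n * F x) \<in> van M V"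
        using c pM Fp unfolding van_def by (auto intro: polf_mult polf_power)
      then have "F \<in> van M V" using prime[OF polf_power[OF pM] Fp] prime_power[OF pM] p(2) by blast
      then show "\<forall>i\<in>{..<q}. c i = 0"
        using h(2)[unfolded indep_on_def, THEN spec, of c] unfolding van_def F_def by auto
    qed
    ultimately have "card {..<q} \<le> card {..<e} * (C * (n + n * D + 1) ^ d)"
      by (intro dimle_indep[where P = R and h = "\<lambda>i x. p e x ^ n * h i x"]) auto
    also have "\<dots> \<le> e * C * ((D + 1) * (n + 1)) ^ d"
      unfolding mult.assoc card_lessThan by (intro mult_le_mono2 power_mono) (auto simp: algebra_simps)
    finally show "q \<le> e * C * (D + 1) ^ d * (n + 1) ^ d" by (simp only: power_mult_distrib mult.assoc card_lessThan)
  qed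
  then show ?thesis unfolding pgrow_def by blast
qed

text \<open>For a largest set of coordinates without relations on \<open>V\<close>, every other
  coordinate is algebraic over it, and adjoining algebraic coordinates does not raise the exponent
  of growth.\<close>

theorem transcendence_basis:
  fixes V :: "('v \<Rightarrow> 'a::{alg_closed_field, field_char_0}) set"
  assumes V: "pirr M V" and M: "finite M"
  shows "\<exists>B\<subseteq>M. (\<forall>h\<in>van M V. polf B h \<longrightarrow> h = (\<lambda>x. 0)) \<and> pgrow V M (card B)"
proof -
  interpret prime_ideal M "van M V" by (rule prime_ideal_van[OF V])
  define ind where "ind B \<longleftrightarrow> B \<subseteq> M \<and> (\<forall>h\<in>van M V. polf B h \<longrightarrow> h = (\<lambda>x. 0))" for B
  have "ind {}" unfolding ind_def
  proof (intro conjI ballI impI)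
    fix h assume h: "h \<in> van M V" "polf {} h"
    obtain x where "x \<in> V" using V unfolding pirr_def by (elim conjE) blast
    then have "h x = 0" using h(1) unfolding van_def by blast
    then show "h = (\<lambda>x. 0)" using polf_cong[OF h(2)] by (metis empty_iff)
  qed simp
  moreover have "card B \<le> card M" if "ind B" for B using that M card_mono unfolding ind_def by blast
  ultimately obtain B where B: "ind B" "\<And>B'. ind B' \<Longrightarrow> card B' \<le> card B"
    using ex_has_greatest_nat[of ind "{}" card "Suc (card M)"] by (auto simp: less_Suc_eq_le)
  have BM: "B \<subseteq> M" and fB: "finite B" using B(1) M finite_subset unfolding ind_def by auto
  have alg: "\<exists>e. algebraic_over B b e" if b: "b \<in> M" "b \<notin> B" for b
  proof (rule ccontr)
    assume na: "\<not> ?thesis"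
    \<comment> \<open>Without a relation for \<open>b\<close>, the coefficients of a vanishing
      \<open>h\<close> vanish on \<open>V\<close>; being polynomials in \<open>B\<close>, they are
      zero.\<close>
    have "ind (insert b B)" unfolding ind_def
    proof (intro conjI ballI impI)
      fix h assume h: "h \<in> van M V" "polf (insert b B) h"
      obtain n c where c: "\<And>i. polf B (c i)" "\<And>x. h x = (\<Sum>i\<le>n. c i x * x b ^ i)"
        using polf_decomp[OF h(2)] by blast
      have "(\<lambda>x. \<Sum>i<Suc n. c i x * x b ^ i) \<in> van M V"
        using h(1) unfolding lessThan_Suc_atMost c(2)[symmetric] by simp
      then have "c i \<in> van M V" if "i < Suc n" for i
        using coefficient_in_ideal[OF b(1) BM, of "Suc n" c i] c(1) na that by blast
      then have "c i = (\<lambda>x. 0)" if "i \<le> n" for i using that B(1) c(1) unfolding ind_def by auto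
      then show "h = (\<lambda>x. 0)" by (intro ext) (simp add: c(2))
    qed (use BM b in auto)
    then have "card (insert b B) \<le> card B" by (rule B(2))
    then show False using fB b by simp
  qed
  have "pgrow V (B \<union> D) (card B)" if "D \<subseteq> M" "finite D" for D
    using that(2,1)
  proof (induction D rule: finite_induct)
    case empty
    show ?case using dimle_pold[OF fB, of V] unfolding pgrow_def by (intro exI[of _ 1]) simp
  next
    case (insert b D)
    show ?case
    proof (cases "b \<in> B")
      case True then show ?thesis using insert by (simp add: insert_absorb)
    next
      case False
      then obtain e where "algebraic_over B b e" using alg insert by blast
      then have "algebraic_over (B \<union> D) b e" by (rule algebraic_over_mono) simp
      then show ?thesis using pgrow_algebraic[OF V, of "B \<union> D" b e "card B"] insert BM by simp
    qed
  qed
  from this[of M] have "pgrow V M (card B)" using M BM by (simp add: Un_absorb1)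
  then show ?thesis using B(1) unfolding ind_def by blast
qed

section \<open>Frames and Pluecker coordinates\<close>

lemma span_family:
  fixes b :: "nat \<Rightarrow> 'a::field ^ 'n::finite"
  shows "x \<in> vec.span (b ` {..w}) \<longleftrightarrow> (\<exists>c. x = (\<Sum>l\<le>w. c l *s b l))"
proof
  let ?S = "{x. \<exists>c. x = (\<Sum>l\<le>w. c l *s b l)}"
  assume x: "x \<in> vec.span (b ` {..w})"
  have "b ` {..w} \<subseteq> ?S"
  proof
    fix y assume "y \<in> b ` {..w}"
    then obtain l where l: "l \<le> w" "y = b l" by auto
    have "y = (\<Sum>i\<le>w. (if i = l then 1 else 0) *s b i)"
      using l by (simp add: if_distrib[of "\<lambda>a. a *s _"] cong: if_cong)
    then show "y \<in> ?S" by (intro CollectI exI)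
  qed
  moreover have "vec.subspace ?S"
  proof (rule vec.subspaceI)
    have "0 = (\<Sum>l\<le>w. 0 *s b l)" by simp
    then show "0 \<in> ?S" by (intro CollectI exI)
    fix x y assume "x \<in> ?S" "y \<in> ?S"
    then obtain c d where "x = (\<Sum>l\<le>w. c l *s b l)" "y = (\<Sum>l\<le>w. d l *s b l)" by blast
    then have "x + y = (\<Sum>l\<le>w. (c l + d l) *s b l)" by (simp add: vector_sadd_rdistrib sum.distrib)
    then show "x + y \<in> ?S" by (intro CollectI exI)
  next
    fix a x assume "x \<in> ?S"
    then obtain c where "x = (\<Sum>l\<le>w. c l *s b l)" by blast
    then have "a *s x = (\<Sum>l\<le>w. (a * c l) *s b l)" by (simp add: vec.scale_sum_right)
    then show "a *s x \<in> ?S" by (intro CollectI exI)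
  qed
  ultimately show "\<exists>c. x = (\<Sum>l\<le>w. c l *s b l)" using x vec.span_minimal by blast
next
  assume "\<exists>c. x = (\<Sum>l\<le>w. c l *s b l)"
  then obtain c where c: "x = (\<Sum>l\<le>w. c l *s b l)" by blast
  show "x \<in> vec.span (b ` {..w})" unfolding c
    by (intro vec.span_sum vec.span_scale vec.span_base imageI)
qed

lemma dim_span_family:
  fixes b :: "nat \<Rightarrow> 'a::field ^ 'n::finite"
  shows "vec.dim (vec.span (b ` {..w})) = w + 1 \<longleftrightarrow>
    (\<forall>c. (\<Sum>l\<le>w. c l *s b l) = 0 \<longrightarrow> (\<forall>l\<le>w. c l = 0))" (is "?D \<longleftrightarrow> ?I")
proof
  assume ?D
  moreover have "vec.dim (vec.span (b ` {..w})) \<le> card (b ` {..w})" by (rule vec.dim_le_card) auto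
  moreover have "card (b ` {..w}) \<le> w + 1" using card_image_le[of "{..w}" b] by simp
  ultimately have c: "card (b ` {..w}) = w + 1" by simp
  then have inj: "inj_on b {..w}" by (intro eq_card_imp_inj_on) auto
  have "vec.independent (b ` {..w})"
    using vec.card_eq_dim[OF vec.span_superset[of "b ` {..w}"]] c \<open>?D\<close> by simp
  then have ind: "\<And>u v. (\<Sum>v\<in>b ` {..w}. u v *s v) = 0 \<Longrightarrow> v \<in> b ` {..w} \<Longrightarrow> u v = 0"
    using vec.dependent_finite[of "b ` {..w}"] by auto
  show ?I
  proof (intro allI impI)
    fix c l assume c: "(\<Sum>l\<le>w. c l *s b l) = 0" and l: "l \<le> w"
    have "(\<Sum>v\<in>b ` {..w}. c (the_inv_into {..w} b v) *s v) = 0"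
      using c by (simp add: sum.reindex[OF inj] the_inv_into_f_f[OF inj])
    from ind[OF this, of "b l"] show "c l = 0" using l by (simp add: the_inv_into_f_f[OF inj])
  qed
next
  assume I: ?I
  have inj: "inj_on b {..w}"
  proof (rule inj_onI, rule ccontr)
    fix i j assume ij: "i \<in> {..w}" "j \<in> {..w}" "b i = b j" "i \<noteq> j"
    define c where "c l = (if l = i then 1 else 0) - (if l = j then 1 else 0 :: 'a)" for l
    have "(\<Sum>l\<le>w. c l *s b l) = (\<Sum>l\<le>w. (if l = i then b l else 0) - (if l = j then b l else 0))"
      by (rule sum.cong) (auto simp: c_def)
    also have "\<dots> = b i - b j" using ij(1,2) by (simp add: sum_subtractf)
    finally have "(\<Sum>l\<le>w. c l *s b l) = 0" using ij(3) by simp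
    then have "c i = 0" using I ij(1) by auto
    then show False using ij(4) by (simp add: c_def)
  qed
  have "vec.independent (b ` {..w})"
  proof
    assume "vec.dependent (b ` {..w})"
    then obtain u v where u: "v \<in> b ` {..w}" "u v \<noteq> 0" "(\<Sum>v\<in>b ` {..w}. u v *s v) = 0"
      using vec.dependent_finite[of "b ` {..w}"] by auto
    then have "(\<Sum>l\<le>w. u (b l) *s b l) = 0" by (simp add: sum.reindex[OF inj])
    then have "\<forall>l\<le>w. u (b l) = 0" using I[THEN spec, of "\<lambda>l. u (b l)"] by blast
    then show False using u(1,2) by auto
  qed
  then show ?D using vec.dim_span_eq_card_independent card_image[OF inj] by fastforce
qed

lemma dim_span_familyD:
  fixes b :: "nat \<Rightarrow> 'a::field ^ 'n::finite"
  assumes "vec.dim (vec.span (b ` {..w})) = w + 1" "(\<Sum>l\<le>w. c l *s b l) = 0" "l \<le> w"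
  shows "c l = 0"
  using assms(1)[unfolded dim_span_family, THEN spec, of c] assms(2,3) by simp

lemma grassmannian_family:
  fixes L :: "('a::field ^ 'n::finite) set"
  assumes "L \<in> grassmannian w" obtains b where "L = vec.span (b ` {..w})"
proof -
  obtain B where B: "B \<subseteq> L" "vec.independent B" "L \<subseteq> vec.span B" "card B = vec.dim L"
    using vec.basis_exists by blast
  have L: "vec.subspace L" "card B = w + 1" using assms B(4) unfolding grassmannian_def by auto
  have "finite B" using L(2) by (intro card_ge_0_finite) simp
  then obtain h where "bij_betw h {0..<card B} B" using ex_bij_betw_nat_finite by blast
  then have "h ` {..w} = B" using L(2) by (auto simp: bij_betw_def lessThan_Suc_atMost[symmetric] atLeast0LessThan)
  moreover have "L = vec.span B" using B(1,3) L(1) vec.span_minimal by blast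
  ultimately show thesis using that by blast
qed

section \<open>Pluecker coordinates as determinants, and normalized frames\<close>

definition plucker_mat :: "nat \<Rightarrow> (nat \<Rightarrow> 'a::field ^ 'n) \<Rightarrow> 'n list \<Rightarrow> 'a mat" where
  "plucker_mat w b J = mat (Suc w) (Suc w) (\<lambda>(i, j). b i $ (J ! j))"

lemma plucker_mat_carrier: "plucker_mat w b J \<in> carrier_mat (Suc w) (Suc w)"
  by (simp add: plucker_mat_def)

lemma plucker_det:
  assumes "length J = Suc w" shows "plucker w b J = Determinant.det (plucker_mat w b J)"
proof -
  have "(\<Prod>i\<le>w. b i $ (J ! p i)) = (\<Prod>i = 0..<Suc w. plucker_mat w b J $$ (i, p i))"
    if "p permutes {0..<Suc w}" for p
    unfolding atLeast0LessThan lessThan_Suc_atMost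
    by (rule prod.cong) (use permutes_in_image[OF that] in \<open>auto simp: plucker_mat_def\<close>)
  then show ?thesis
    using assms unfolding plucker_def det_def'[OF plucker_mat_carrier]
    by (auto intro!: sum.cong simp: atLeast0LessThan lessThan_Suc_atMost)
qed

text \<open>Minors are multiplicative in the transition matrix. This is why they serve as
  homogeneous coordinates of the span.\<close>

lemma plucker_combination:
  assumes "\<And>l. l \<le> w \<Longrightarrow> b' l = (\<Sum>m\<le>w. A l m *s b m)"
  shows "plucker w b' J = Determinant.det (mat (Suc w) (Suc w) (\<lambda>(i, j). A i j)) * plucker w b J"
proof (cases "length J = Suc w")
  case True
  have "plucker_mat w b' J = mat (Suc w) (Suc w) (\<lambda>(i, j). A i j) * plucker_mat w b J"
    by (rule eq_matI) (auto simp: plucker_mat_def assms scalar_prod_def less_Suc_eq_le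
        atLeast0LessThan lessThan_Suc_atMost simp del: sum.lessThan_Suc intro!: sum.cong)
  then show ?thesis
    unfolding plucker_det[OF True] by (simp add: det_mult[OF _ plucker_mat_carrier])
qed (simp add: plucker_def)

lemma plucker_eq_scaled:
  assumes "b' ` {..w} \<subseteq> vec.span ((b :: nat \<Rightarrow> 'a::field ^ 'n::finite) ` {..w})"
  obtains \<delta> where "\<And>J. plucker w b' J = \<delta> * plucker w b J"
proof -
  have "\<forall>l. \<exists>c. l \<le> w \<longrightarrow> b' l = (\<Sum>m\<le>w. c m *s b m)" using assms span_family[of _ b w] by blast
  from choice[OF this] obtain A where "\<And>l. l \<le> w \<Longrightarrow> b' l = (\<Sum>m\<le>w. A l m *s b m)" by blast
  from plucker_combination[of w b' A b, OF this] show thesis by (rule that)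
qed

lemma plucker_nonzero_independent:
  fixes b :: "nat \<Rightarrow> 'a::field ^ 'n::finite"
  assumes "plucker w b J \<noteq> 0"
  shows "vec.dim (vec.span (b ` {..w})) = w + 1"
  unfolding dim_span_family
proof (intro allI impI, rule ccontr)
  fix c l assume c: "(\<Sum>l\<le>w. c l *s b l) = 0" and l: "l \<le> w" "c l \<noteq> 0"
  have J: "length J = Suc w" using assms by (auto simp: plucker_def split: if_splits)
  define A where "A = transpose_mat (plucker_mat w b J)"
  define v where "v = Matrix.vec (Suc w) c"
  have A: "A \<in> carrier_mat (Suc w) (Suc w)" by (simp add: A_def plucker_mat_carrier)
  have "v \<noteq> 0\<^sub>v (Suc w)"
  proof
    assume "v = 0\<^sub>v (Suc w)"
    then have "vec_index v l = vec_index (0\<^sub>v (Suc w)) l" by simp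
    then show False using l by (simp add: v_def)
  qed
  moreover have "A *\<^sub>v v = 0\<^sub>v (Suc w)"
  proof (rule eq_vecI)
    fix j assume j: "j < dim_vec (0\<^sub>v (Suc w) :: 'a Matrix.vec)"
    have "vec_index (A *\<^sub>v v) j = (\<Sum>l\<le>w. c l * b l $ (J ! j))"
      using j by (auto simp: A_def v_def plucker_mat_def scalar_prod_def atLeast0LessThan lessThan_Suc_atMost
          mult.commute simp del: sum.lessThan_Suc intro!: sum.cong)
    also have "\<dots> = (\<Sum>l\<le>w. c l *s b l) $ (J ! j)" by (simp add: sum_component)
    finally show "vec_index (A *\<^sub>v v) j = vec_index (0\<^sub>v (Suc w)) j" using c j by simp
  qed (use A in auto)
  ultimately have "Determinant.det A = 0"
    unfolding det_0_iff_vec_prod_zero_field[OF A] by (intro exI[of _ v]) (auto simp: v_def)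
  then show False using assms unfolding plucker_det[OF J] A_def
    by (simp add: det_transpose[OF plucker_mat_carrier])
qed

text \<open>Cutting \<open>L\<close> by a coordinate that is not identically zero on it lowers the
  dimension by exactly one; after \<open>n\<close> cuts only 0 is left.\<close>

lemma ex_separating_coordinates:
  fixes L :: "('a::field ^ 'n::finite) set"
  assumes "vec.subspace L" "vec.dim L = n"
  shows "\<exists>J. length J = n \<and> (\<forall>x\<in>L. (\<forall>j\<in>set J. x $ j = 0) \<longrightarrow> x = 0)"
  using assms
proof (induction n arbitrary: L)
  case 0
  then have "L \<subseteq> {0}" by (simp add: vec.dim_eq_0)
  then show ?case by auto
next
  case (Suc n)
  then have "\<not> L \<subseteq> {0}" using vec.dim_eq_0[of L] by simp
  then obtain v where v: "v \<in> L" "v \<noteq> 0" by blast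
  then obtain j where j: "v $ j \<noteq> 0" by (metis Finite_Cartesian_Product.vec_eq_iff Finite_Cartesian_Product.zero_index)
  define L' where "L' = {x \<in> L. x $ j = 0}"
  have L': "vec.subspace L'" using Suc.prems(1) unfolding L'_def vec.subspace_def by auto
  have "L \<subseteq> vec.span (insert v L')"
  proof
    fix x assume x: "x \<in> L"
    have "x - (x $ j / v $ j) *s v \<in> L'"
      using x v(1) j Suc.prems(1) unfolding L'_def
      by (auto intro!: vec.subspace_diff vec.subspace_scale)
    then show "x \<in> vec.span (insert v L')"
      by (metis vec.span_base vec.span_breakdown_eq)
  qed
  then have "vec.dim L \<le> vec.dim (insert v L')" by (rule vec.dim_mono)
  also have "\<dots> \<le> vec.dim L' + 1" by (simp add: vec.dim_insert)
  finally have "n \<le> vec.dim L'" using Suc.prems(2) by simp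
  moreover have "vec.dim L' < vec.dim L"
  proof (rule vec.dim_psubset)
    have sp: "vec.span L' = L'" "vec.span L = L" using L' Suc.prems(1) by (simp_all add: vec.span_eq_iff)
    have "L' \<subset> L" using v(1) j unfolding L'_def by auto
    then show "vec.span L' \<subset> vec.span L" unfolding sp .
  qed
  ultimately have "vec.dim L' = n" using Suc.prems(2) by simp
  then obtain J where J: "length J = n" "\<forall>x\<in>L'. (\<forall>j\<in>set J. x $ j = 0) \<longrightarrow> x = 0"
    using Suc.IH[OF L'] by blast
  then show ?case by (intro exI[of _ "j # J"]) (auto simp: L'_def)
qed

text \<open>Take coordinates that separate the vectors of the span. If their minor vanished, a
  nontrivial combination of the frame would be zero at all of them, hence zero, against
  independence.\<close>

lemma plucker_nonzero_exists:
  fixes b :: "nat \<Rightarrow> 'a::field ^ 'n::finite"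
  assumes "vec.dim (vec.span (b ` {..w})) = w + 1"
  obtains J where "plucker w b J \<noteq> 0"
proof -
  obtain J where J: "length J = Suc w" "\<And>x. x \<in> vec.span (b ` {..w}) \<Longrightarrow> (\<forall>j\<in>set J. x $ j = 0) \<Longrightarrow> x = 0"
    using ex_separating_coordinates[of "vec.span (b ` {..w})" "w + 1"] assms by auto
  define A where "A = transpose_mat (plucker_mat w b J)"
  have A: "A \<in> carrier_mat (Suc w) (Suc w)" by (simp add: A_def plucker_mat_carrier)
  have "plucker w b J \<noteq> 0"
  proof
    assume "plucker w b J = 0"
    then have "Determinant.det A = 0" unfolding plucker_det[OF J(1)] A_def
      by (simp add: det_transpose[OF plucker_mat_carrier])
    then obtain v where v: "v \<in> carrier_vec (Suc w)" "v \<noteq> 0\<^sub>v (Suc w)" "A *\<^sub>v v = 0\<^sub>v (Suc w)"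
      unfolding det_0_iff_vec_prod_zero_field[OF A] by blast
    define x where "x = (\<Sum>l\<le>w. vec_index v l *s b l)"
    have "x $ (J ! j) = 0" if j: "j < Suc w" for j
    proof -
      have "vec_index (A *\<^sub>v v) j = (\<Sum>l\<le>w. vec_index v l * b l $ (J ! j))"
        using j v(1) by (auto simp: A_def plucker_mat_def scalar_prod_def atLeast0LessThan lessThan_Suc_atMost
            mult.commute simp del: sum.lessThan_Suc intro!: sum.cong)
      also have "\<dots> = x $ (J ! j)" by (simp add: x_def sum_component)
      finally show ?thesis using v(3) j by simp
    qed
    then have "\<forall>j\<in>set J. x $ j = 0" using J(1) by (auto simp: in_set_conv_nth)
    moreover have "x \<in> vec.span (b ` {..w})" unfolding span_family x_def by blast
    ultimately have "x = 0" using J(2) by blast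
    then have "\<forall>l\<le>w. vec_index v l = 0"
      using assms[unfolded dim_span_family, THEN spec, of "vec_index v"] unfolding x_def by blast
    then have "v = 0\<^sub>v (Suc w)" using v(1) by (intro eq_vecI) auto
    then show False using v(2) by blast
  qed
  then show thesis by (rule that)
qed

text \<open>Frames normalized in this way parametrize the standard affine chart of the Grassmannian
  on which the Pluecker coordinate \<open>J\<close> is nonzero.\<close>

definition unit_block :: "nat \<Rightarrow> 'n list \<Rightarrow> (nat \<Rightarrow> 'a::field ^ 'n) \<Rightarrow> bool" where
  "unit_block w J b \<longleftrightarrow> (\<forall>l\<le>w. \<forall>m\<le>w. b l $ (J ! m) = (if l = m then 1 else 0))"

text \<open>By Cramer's rule, replacing one column of an identity matrix leaves one entry of the new
  column as determinant. The entries of a normalized frame are thus Pluecker coordinates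
  themselves.\<close>

lemma plucker_unit_block:
  assumes J: "length J = Suc w" and b: "unit_block w J b"
  shows "plucker w b J = 1" "l \<le> w \<Longrightarrow> plucker w b (J[l := j]) = b l $ j"
proof -
  have one: "plucker_mat w b J = 1\<^sub>m (Suc w)"
    using b by (intro eq_matI) (auto simp: plucker_mat_def unit_block_def)
  then show "plucker w b J = 1" by (simp add: plucker_det[OF J])
  assume l: "l \<le> w"
  define x where "x = Matrix.vec (Suc w) (\<lambda>i. b i $ j)"
  have x: "x \<in> carrier_vec (Suc w)" by (simp add: x_def)
  have "plucker_mat w b (J[l := j]) = replace_col (1\<^sub>m (Suc w)) (1\<^sub>m (Suc w) *\<^sub>v x) l"
    using b J x by (intro eq_matI)
      (auto simp: plucker_mat_def replace_col_def unit_block_def nth_list_update x_def)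
  then have "plucker w b (J[l := j]) = vec_index x l * Determinant.det (1\<^sub>m (Suc w))"
    using cramer_lemma_mat[of "1\<^sub>m (Suc w)" "Suc w" x l] x l J by (simp add: plucker_det)
  then show "plucker w b (J[l := j]) = b l $ j" using l by (simp add: x_def)
qed

text \<open>Being made of quotients of Pluecker coordinates, it depends only on the span and varies
  algebraically with it on the chart.\<close>

definition normal_frame :: "nat \<Rightarrow> (nat \<Rightarrow> 'a::field ^ 'n) \<Rightarrow> 'n list \<Rightarrow> nat \<Rightarrow> 'a ^ 'n" where
  "normal_frame w b J l = (\<chi> j. plucker w b (J[l := j]) / plucker w b J)"

text \<open>Multiplying \<open>b\<close> by the inverse of its \<open>J\<close>-block gives a
  normalized frame of the same span; its entries are its own Pluecker coordinates, which agree with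
  those of \<open>b\<close> up to a common factor.\<close>

lemma normal_frame:
  fixes b :: "nat \<Rightarrow> 'a::field ^ 'n::finite"
  assumes nz: "plucker w b J \<noteq> 0"
  shows "unit_block w J (normal_frame w b J)"
    and "vec.span (normal_frame w b J ` {..w}) = vec.span (b ` {..w})"
proof -
  have J: "length J = Suc w" using nz by (auto simp: plucker_def split: if_splits)
  have "Determinant.det (plucker_mat w b J) \<noteq> 0" using nz unfolding plucker_det[OF J] .
  then obtain A where A: "A \<in> carrier_mat (Suc w) (Suc w)" "A * plucker_mat w b J = 1\<^sub>m (Suc w)"
    using det_non_zero_imp_unit[OF plucker_mat_carrier[of w b J], where b = "()"] unfolding Units_def ring_mat_def by auto
  define B where "B l = (\<Sum>m\<le>w. A $$ (l, m) *s b m)" for l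
  have Bu: "unit_block w J B" unfolding unit_block_def
  proof (intro allI impI)
    fix l m assume lm: "l \<le> w" "m \<le> w"
    have "B l $ (J ! m) = (\<Sum>i\<le>w. A $$ (l, i) * b i $ (J ! m))" by (simp add: B_def sum_component)
    also have "\<dots> = (A * plucker_mat w b J) $$ (l, m)"
      using lm A(1) by (auto simp: plucker_mat_def scalar_prod_def atLeast0LessThan lessThan_Suc_atMost
          simp del: sum.lessThan_Suc intro!: sum.cong)
    finally show "B l $ (J ! m) = (if l = m then 1 else 0)" using lm by (simp add: A(2))
  qed
  obtain \<delta> where \<delta>: "\<And>J. plucker w B J = \<delta> * plucker w b J"
    using plucker_combination[of w B "\<lambda>l m. A $$ (l, m)" b] B_def by blast
  have \<delta>': "\<delta> * plucker w b J = 1" using plucker_unit_block(1)[OF J Bu] \<delta> by simp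
  have Bn: "B l = normal_frame w b J l" if "l \<le> w" for l
  proof (rule Finite_Cartesian_Product.vec_eq_iff[THEN iffD2], rule allI)
    fix j
    have "B l $ j = \<delta> * plucker w b (J[l := j])" using plucker_unit_block(2)[OF J Bu that] \<delta> by simp
    also have "\<dots> = plucker w b (J[l := j]) / plucker w b J" using \<delta>' nz by (simp add: field_simps)
    finally show "B l $ j = normal_frame w b J l $ j" by (simp add: normal_frame_def)
  qed
  then show "unit_block w J (normal_frame w b J)" using Bu unfolding unit_block_def by simp
  have im: "normal_frame w b J ` {..w} = B ` {..w}" using Bn by (intro image_cong) auto
  have sub: "B ` {..w} \<subseteq> vec.span (b ` {..w})"
    unfolding B_def by (intro image_subsetI vec.span_sum vec.span_scale vec.span_base imageI)
  have "vec.span (B ` {..w}) \<subseteq> vec.span (b ` {..w})"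
    using vec.span_minimal[OF sub] by simp
  moreover have "vec.dim (vec.span (B ` {..w})) = w + 1"
    using plucker_nonzero_independent[of w B J] plucker_unit_block(1)[OF J Bu] by simp
  moreover have "vec.dim (vec.span (b ` {..w})) = w + 1" by (rule plucker_nonzero_independent[OF nz])
  ultimately have "vec.span (B ` {..w}) = vec.span (b ` {..w})"
    by (intro vec.subspace_dim_equal) auto
  then show "vec.span (normal_frame w b J ` {..w}) = vec.span (b ` {..w})" unfolding im .
qed

lemma unit_block_coords:
  fixes b :: "nat \<Rightarrow> 'a::field ^ 'n::finite"
  assumes b: "unit_block w J b" and x: "x \<in> vec.span (b ` {..w})"
  shows "x = (\<Sum>l\<le>w. x $ (J ! l) *s b l)"
proof -
  obtain c where c: "x = (\<Sum>l\<le>w. c l *s b l)" using x span_family by blast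
  have "x $ (J ! m) = c m" if "m \<le> w" for m
  proof -
    have "x $ (J ! m) = (\<Sum>l\<le>w. if l = m then c l else 0)"
      unfolding c sum_component by (rule sum.cong) (use b that in \<open>auto simp: unit_block_def\<close>)
    then show ?thesis using that by simp
  qed
  then have "(\<Sum>l\<le>w. x $ (J ! l) *s b l) = (\<Sum>l\<le>w. c l *s b l)" by (intro sum.cong) auto
  then show ?thesis using c by simp
qed

lemma hom_plucker:
  assumes "\<And>l j. l \<le> w \<Longrightarrow> homf B e (\<lambda>x. b x l $ j)"
  shows "homf B (Suc w * e) (\<lambda>x. plucker w (b x) J)"
proof (cases "length J = w + 1")
  case True
  have "homf B (Suc w * e) (\<lambda>x. of_int (sign p) * (\<Prod>i\<le>w. b x i $ (J ! p i)))" for p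
    using hom_prod[of "{..w}" B "\<lambda>_. e" "\<lambda>i x. b x i $ (J ! p i)"] assms by (intro hom_scale) auto
  then show ?thesis unfolding plucker_def using True by (simp add: hom_sum)
next
  case False
  then show ?thesis unfolding plucker_def by (simp only: if_False) (rule homf.zero)
qed

section \<open>Topologies defined by forms\<close>

definition form :: "(('v \<Rightarrow> 'a::comm_ring_1) \<Rightarrow> 'a) \<Rightarrow> bool" where
  "form h \<longleftrightarrow> (\<exists>n. homf UNIV n h)"

lemma form_iff: "form h \<longleftrightarrow> (\<exists>F. homogeneous F \<and> mpoly_eval F = h)"
  unfolding form_def using hom_imp_form form_imp_hom by metis

lemma form_mult: "form f \<Longrightarrow> form g \<Longrightarrow> form (\<lambda>x. f x * g x)"
  unfolding form_def using hom_mult by blast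

lemma form_coord: "form (\<lambda>x. x v)"
  unfolding form_def using hom_coord[of v UNIV] by blast

lemma form_prod: "finite H \<Longrightarrow> (\<And>h. h \<in> H \<Longrightarrow> form (f h)) \<Longrightarrow> form (\<lambda>x. \<Prod>h\<in>H. f h x)"
proof (induction H rule: finite_induct)
  case empty
  show ?case unfolding form_def using homf.const[of UNIV 1] by auto
next
  case (insert h H)
  then show ?case by (simp add: form_mult)
qed

lemma form_polf: "form f \<Longrightarrow> polf UNIV f"
  unfolding form_def by (elim exE) (rule hom_polf)

text \<open>
  \<open>R p x\<close> means that \<open>x\<close> is a vector of homogeneous coordinates of \<open>p\<close>. This covers both projective
  spaces and Grassmannians with their Pluecker coordinates.
\<close>

locale form_topology =
  fixes \<Omega> :: "'p set" and R :: "'p \<Rightarrow> ('v \<Rightarrow> 'a::field) \<Rightarrow> bool" and T :: "'p topology"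
  assumes T: "T = topology_generated_by {{p \<in> \<Omega>. \<exists>x. R p x \<and> mpoly_eval F x \<noteq> 0} | F. homogeneous F}"
    and R_ex: "p \<in> \<Omega> \<Longrightarrow> \<exists>x. R p x"
    and R_unique: "p \<in> \<Omega> \<Longrightarrow> R p x \<Longrightarrow> R p y \<Longrightarrow> \<exists>c. c \<noteq> 0 \<and> y = (\<lambda>v. c * x v)"
begin

definition nz :: "(('v \<Rightarrow> 'a) \<Rightarrow> 'a) \<Rightarrow> 'p \<Rightarrow> bool" where
  "nz h p \<longleftrightarrow> p \<in> \<Omega> \<and> (\<exists>x. R p x \<and> h x \<noteq> 0)"

definition basic :: "'p set set" where
  "basic = {{p. nz h p} | h. form h}"

lemma nz_iff: "form h \<Longrightarrow> p \<in> \<Omega> \<Longrightarrow> R p x \<Longrightarrow> nz h p \<longleftrightarrow> h x \<noteq> 0"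
proof
  assume h: "form h" "p \<in> \<Omega>" "R p x"
  assume "nz h p"
  then obtain y where y: "R p y" "h y \<noteq> 0" unfolding nz_def by blast
  obtain c where c: "y = (\<lambda>v. c * x v)" using R_unique[OF h(2,3) y(1)] by blast
  obtain n where "homf UNIV n h" using h(1) unfolding form_def by blast
  from hom_homog[OF this, of c x] show "h x \<noteq> 0" using y(2) unfolding c by auto
qed (auto simp: nz_def)

lemma T_basic: "T = topology_generated_by basic"
proof -
  have "{{p \<in> \<Omega>. \<exists>x. R p x \<and> mpoly_eval F x \<noteq> 0} | F. homogeneous F} = basic"
    unfolding basic_def nz_def form_iff by auto
  then show ?thesis using T by simp
qed

lemma form_one: "form (\<lambda>x. 1)"
  unfolding form_def using homf.const by blast

lemma nz_one: "nz (\<lambda>x. 1) p \<longleftrightarrow> p \<in> \<Omega>"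
  unfolding nz_def using R_ex by auto

lemma topspace: "topspace T = \<Omega>"
proof -
  have "\<Omega> \<in> basic" unfolding basic_def using form_one nz_one by (intro CollectI exI[of _ "\<lambda>x. 1"]) auto
  then show ?thesis unfolding T_basic topology_generated_by_topspace unfolding basic_def nz_def by blast
qed

lemma open_basic: "form h \<Longrightarrow> openin T {p. nz h p}"
  unfolding T_basic by (rule topology_generated_by_Basis) (auto simp: basic_def)

text \<open>The nonvanishing loci serve as a subbasis, so a neighbourhood is described by a finite
  set of forms.\<close>

lemma open_basic_nbhd:
  assumes "openin T U" "p \<in> U"
  shows "\<exists>H. finite H \<and> (\<forall>h\<in>H. form h \<and> nz h p) \<and> (\<forall>q\<in>\<Omega>. (\<forall>h\<in>H. nz h q) \<longrightarrow> q \<in> U)"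
proof -
  have "generate_topology_on basic U" using assms(1) unfolding T_basic by (rule openin_topology_generated_by)
  then show ?thesis using assms(2)
  proof (induction rule: generate_topology_on.induct)
    case (Int a b)
    have p: "p \<in> a" "p \<in> b" using Int.prems by auto
    obtain H where H: "finite H" "\<forall>h\<in>H. form h \<and> nz h p" "\<forall>q\<in>\<Omega>. (\<forall>h\<in>H. nz h q) \<longrightarrow> q \<in> a"
      using Int.IH(1)[OF p(1)] by blast
    obtain H' where H': "finite H'" "\<forall>h\<in>H'. form h \<and> nz h p" "\<forall>q\<in>\<Omega>. (\<forall>h\<in>H'. nz h q) \<longrightarrow> q \<in> b"
      using Int.IH(2)[OF p(2)] by blast
    show ?case using H H' by (intro exI[of _ "H \<union> H'"]) auto
  next
    case (UN K)
    then obtain k where k: "k \<in> K" "p \<in> k" by blast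
    from UN.IH[OF this] obtain H where "finite H" "\<forall>h\<in>H. form h \<and> nz h p" "\<forall>q\<in>\<Omega>. (\<forall>h\<in>H. nz h q) \<longrightarrow> q \<in> k"
      by blast
    then show ?case using k by (intro exI[of _ H]) blast
  next
    case (Basis s)
    then obtain h where "form h" "s = {p. nz h p}" unfolding basic_def by blast
    then show ?case using Basis by (intro exI[of _ "{h}"]) auto
  qed simp
qed

lemma in_closure:
  assumes "p \<in> \<Omega>" "\<And>H. finite H \<Longrightarrow> (\<And>h. h \<in> H \<Longrightarrow> form h \<and> nz h p) \<Longrightarrow> \<exists>q\<in>Z. q \<in> \<Omega> \<and> (\<forall>h\<in>H. nz h q)"
  shows "p \<in> T closure_of Z"
  unfolding in_closure_of topspace
proof (intro conjI allI impI assms(1))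
  fix U assume U: "p \<in> U \<and> openin T U"
  obtain H where H: "finite H" "\<forall>h\<in>H. form h \<and> nz h p" "\<forall>q\<in>\<Omega>. (\<forall>h\<in>H. nz h q) \<longrightarrow> q \<in> U"
    using open_basic_nbhd[of U p] U by blast
  have "\<exists>q\<in>Z. q \<in> \<Omega> \<and> (\<forall>h\<in>H. nz h q)" by (rule assms(2)[OF H(1)]) (use H(2) in blast)
  then obtain q where "q \<in> Z" "q \<in> \<Omega>" "\<forall>h\<in>H. nz h q" by blast
  then show "\<exists>y. y \<in> Z \<and> y \<in> U" using H(3) by blast
qed

lemma closure_nz:
  assumes "form h" "nz h p" "p \<in> T closure_of Z"
  shows "\<exists>q\<in>Z. nz h q"
  using assms open_basic[OF assms(1)] unfolding in_closure_of by blast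

text \<open>Two open sets that both meet an irreducible set meet it in a common point; induction
  over \<open>H\<close> extends this to finitely many.\<close>

lemma irreducible_nz:
  assumes irr: "irreducible_in T C" and H: "finite H" "\<And>h. h \<in> H \<Longrightarrow> form h" "\<And>h. h \<in> H \<Longrightarrow> \<exists>p\<in>C. nz h p"
  shows "\<exists>p\<in>C. \<forall>h\<in>H. nz h p"
proof -
  have sub: "C \<subseteq> \<Omega>" and ne: "C \<noteq> {}" using irr unfolding irreducible_in_def topspace by auto
  have "\<exists>p\<in>C. (\<forall>h\<in>H. nz h p) \<and> openin T {p. \<forall>h\<in>H. p \<in> \<Omega> \<and> nz h p}" if "H \<noteq> {}"
    using H(1) that H(2,3)
  proof (induction H rule: finite_ne_induct)
    case (singleton h)
    have "{p. \<forall>h\<in>{h}. p \<in> \<Omega> \<and> nz h p} = {p. nz h p}" by (auto simp: nz_def)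
    then show ?case using open_basic[of h] singleton by auto
  next
    case (insert h H)
    let ?U = "{p. nz h p}" and ?V = "{p. \<forall>h\<in>H. p \<in> \<Omega> \<and> nz h p}"
    obtain p where p: "p \<in> C" "\<forall>h\<in>H. nz h p" "openin T ?V" using insert by blast
    obtain q where q: "q \<in> C" "nz h q" using insert by blast
    have U: "openin T ?U" using open_basic insert by simp
    have "\<exists>x\<in>C. x \<in> ?U \<inter> ?V"
    proof (rule ccontr)
      assume "\<not> ?thesis"
      then have "C \<subseteq> (topspace T - ?U) \<union> (topspace T - ?V)" using sub unfolding topspace by blast
      moreover have "closedin T (topspace T - ?U)" "closedin T (topspace T - ?V)" using U p(3) by blast+
      ultimately have "C \<subseteq> topspace T - ?U \<or> C \<subseteq> topspace T - ?V"
        using irr unfolding irreducible_in_def by blast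
      then show False using p(1,2) q sub by blast
    qed
    moreover have "openin T (?U \<inter> ?V)" using U p(3) by blast
    moreover have "?U \<inter> ?V = {p. \<forall>h\<in>insert h H. p \<in> \<Omega> \<and> nz h p}"
      using insert(2) unfolding nz_def by blast
    ultimately show ?case by auto
  qed
  then show ?thesis using ne by (cases "H = {}") auto
qed

text \<open>If each of the finitely many forms describing a neighbourhood of \<open>p\<close>
  outside \<open>C\<close> were nonzero somewhere on \<open>C\<close>, irreducibility would put a
  point of \<open>C\<close> into that neighbourhood.\<close>

lemma closed_separate:
  assumes "closedin T C" "irreducible_in T C" "p \<in> \<Omega>" "p \<notin> C"
  shows "\<exists>h. form h \<and> nz h p \<and> (\<forall>q\<in>C. \<not> nz h q)"
proof -
  have "openin T (\<Omega> - C)" using assms(1) unfolding closedin_def topspace by blast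
  then obtain H where H: "finite H" "\<forall>h\<in>H. form h \<and> nz h p" "\<forall>q\<in>\<Omega>. (\<forall>h\<in>H. nz h q) \<longrightarrow> q \<in> \<Omega> - C"
    using open_basic_nbhd[of "\<Omega> - C" p] assms(3,4) by blast
  show ?thesis
  proof (rule ccontr)
    assume "\<not> ?thesis"
    then have "\<forall>h\<in>H. \<exists>q\<in>C. nz h q" using H(2) by blast
    then obtain q where "q \<in> C" "\<forall>h\<in>H. nz h q" using irreducible_nz[OF assms(2) H(1)] H(2) by blast
    moreover have "q \<in> \<Omega>" using \<open>q \<in> C\<close> assms(2) unfolding irreducible_in_def topspace by blast
    ultimately show False using H(3) by blast
  qed
qed

lemma closure_strict:
  assumes "Z \<subseteq> Z'" "Z' \<subseteq> \<Omega>" "form h" "p \<in> Z'" "nz h p" "\<And>q. q \<in> Z \<Longrightarrow> \<not> nz h q"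
  shows "T closure_of Z \<subset> T closure_of Z'"
proof -
  have "p \<in> T closure_of Z'" using closure_of_subset[of Z' T] assms(2,4) unfolding topspace by blast
  moreover have "p \<notin> T closure_of Z" using closure_nz[OF assms(3,5)] assms(6) by blast
  moreover have "T closure_of Z \<subseteq> T closure_of Z'" by (rule closure_of_mono[OF assms(1)])
  ultimately show ?thesis by blast
qed

lemma irreducible_closure:
  assumes Z: "Z \<subseteq> \<Omega>" "Z \<noteq> {}"
    and irr: "\<And>H. finite H \<Longrightarrow> (\<And>h. h \<in> H \<Longrightarrow> form h \<and> (\<exists>p\<in>Z. nz h p)) \<Longrightarrow> \<exists>p\<in>Z. \<forall>h\<in>H. nz h p"
  shows "irreducible_in T (T closure_of Z)"
  unfolding irreducible_in_def
proof (intro conjI allI impI)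
  have sub: "Z \<subseteq> T closure_of Z" using Z(1) by (simp add: closure_of_subset topspace)
  show "T closure_of Z \<subseteq> topspace T" by (rule closure_of_subset_topspace)
  show "T closure_of Z \<noteq> {}" using sub Z(2) by blast
  fix A B assume AB: "closedin T A \<and> closedin T B \<and> T closure_of Z \<subseteq> A \<union> B"
  show "T closure_of Z \<subseteq> A \<or> T closure_of Z \<subseteq> B"
  proof (rule ccontr)
    assume "\<not> ?thesis"
    then have "\<not> Z \<subseteq> A" "\<not> Z \<subseteq> B" using AB closure_of_minimal by metis+
    then obtain p q where pq: "p \<in> Z" "p \<notin> A" "q \<in> Z" "q \<notin> B" by blast
    have "openin T (\<Omega> - A)" "openin T (\<Omega> - B)" using AB unfolding closedin_def topspace by auto
    note op = this
    have mem: "p \<in> \<Omega> - A" "q \<in> \<Omega> - B" using pq Z(1) by auto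
    obtain H where H: "finite H" "\<forall>h\<in>H. form h \<and> nz h p" "\<forall>q\<in>\<Omega>. (\<forall>h\<in>H. nz h q) \<longrightarrow> q \<in> \<Omega> - A"
      using open_basic_nbhd[OF op(1) mem(1)] by blast
    obtain H' where H': "finite H'" "\<forall>h\<in>H'. form h \<and> nz h q" "\<forall>q\<in>\<Omega>. (\<forall>h\<in>H'. nz h q) \<longrightarrow> q \<in> \<Omega> - B"
      using open_basic_nbhd[OF op(2) mem(2)] by blast
    have "\<exists>z\<in>Z. \<forall>h\<in>H \<union> H'. nz h z" using H H' pq by (intro irr) auto
    then obtain z where z: "z \<in> Z" "\<forall>h\<in>H \<union> H'. nz h z" by blast
    then have "z \<notin> A" "z \<notin> B" using H(3) H'(3) Z(1) by blast+
    then show False using z(1) sub AB by blast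
  qed
qed

end

section \<open>Chains of irreducible closed sets inside a closed subset\<close>

definition chain_in :: "'p topology \<Rightarrow> 'p set \<Rightarrow> (nat \<Rightarrow> 'p set) \<Rightarrow> nat \<Rightarrow> bool" where
  "chain_in T Y C n \<longleftrightarrow>
     (\<forall>i\<le>n. closedin T (C i) \<and> irreducible_in T (C i) \<and> C i \<subseteq> Y) \<and> (\<forall>i<n. C i \<subset> C (i + 1))"

lemma irreducible_in_subtopology:
  assumes "closedin T Y"
  shows "closedin (subtopology T Y) C \<and> irreducible_in (subtopology T Y) C \<longleftrightarrow>
     closedin T C \<and> irreducible_in T C \<and> C \<subseteq> Y"
proof -
  have Y: "Y \<subseteq> topspace T" using assms closedin_subset by blast
  have cl: "closedin (subtopology T Y) A \<longleftrightarrow> closedin T A \<and> A \<subseteq> Y" for A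
    using closedin_closed_subtopology[OF assms] by blast
  have "irreducible_in (subtopology T Y) C \<longleftrightarrow> irreducible_in T C" if "C \<subseteq> Y"
  proof
    assume i: "irreducible_in (subtopology T Y) C"
    show "irreducible_in T C" unfolding irreducible_in_def
    proof (intro conjI allI impI)
      show "C \<subseteq> topspace T" "C \<noteq> {}" using i that Y unfolding irreducible_in_def by auto
      fix A B assume AB: "closedin T A \<and> closedin T B \<and> C \<subseteq> A \<union> B"
      have "closedin (subtopology T Y) (A \<inter> Y)" "closedin (subtopology T Y) (B \<inter> Y)"
        using AB assms cl by auto
      moreover have "C \<subseteq> (A \<inter> Y) \<union> (B \<inter> Y)" using AB that by blast
      ultimately have "C \<subseteq> A \<inter> Y \<or> C \<subseteq> B \<inter> Y" using i unfolding irreducible_in_def by blast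
      then show "C \<subseteq> A \<or> C \<subseteq> B" by blast
    qed
  next
    assume "irreducible_in T C"
    then show "irreducible_in (subtopology T Y) C"
      using that Y unfolding irreducible_in_def cl by (auto simp: Int_absorb1)
  qed
  then show ?thesis using cl by blast
qed

lemma krull_dim_subtopology:
  assumes "closedin T Y"
  shows "krull_dim (subtopology T Y) = Sup {enat n | n. \<exists>C. chain_in T Y C n}"
  unfolding krull_dim_def chain_in_def irreducible_in_subtopology[OF assms] by simp

lemma krull_dim_eqI:
  assumes "closedin T Y" "chain_in T Y C d" "\<And>n C. chain_in T Y C n \<Longrightarrow> n \<le> d"
  shows "krull_dim (subtopology T Y) = enat d"
  unfolding krull_dim_subtopology[OF assms(1)]
proof (rule antisym)
  show "Sup {enat n | n. \<exists>C. chain_in T Y C n} \<le> enat d" using assms(3) by (intro Sup_least) auto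
  show "enat d \<le> Sup {enat n | n. \<exists>C. chain_in T Y C n}" using assms(2) by (intro Sup_upper) blast
qed

subsection \<open>Projective space\<close>

lemma span_singleton_eq:
  fixes x y :: "'a::field ^ 'n::finite"
  assumes "vec.span {x} = vec.span {y}" "vec.span {x} \<in> proj_space"
  shows "\<exists>c. c \<noteq> 0 \<and> y = c *s x"
proof -
  have "y \<in> vec.span {x}" using assms(1) vec.span_base[of y "{y}"] by simp
  then obtain c where c: "y = c *s x" unfolding vec.span_singleton by auto
  moreover have "c \<noteq> 0"
  proof
    assume "c = 0"
    then have "vec.span {x} = {0}" using c assms(1) by (simp add: vec.span_singleton)
    then show False using assms(2) unfolding grassmannian_def by simp
  qed
  ultimately show ?thesis by blast
qed

lemma proj_space_span_iff:
  fixes x :: "'a::field ^ 'n::finite"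
  shows "vec.span {x} \<in> proj_space \<longleftrightarrow> x \<noteq> 0"
  unfolding grassmannian_def by simp

lemma proj_space_generator:
  assumes "P \<in> (proj_space :: ('a::field ^ 'n::finite) set set)"
  obtains x where "P = vec.span {x}" "x \<noteq> 0"
proof -
  obtain b where "P = vec.span (b ` {..0::nat})" using grassmannian_family[OF assms] by blast
  then have "P = vec.span {b 0}" by simp
  then show thesis using that assms proj_space_span_iff by blast
qed

definition proj_rep :: "('a::field ^ 'n) set \<Rightarrow> ('n \<Rightarrow> 'a) \<Rightarrow> bool" where
  "proj_rep P x \<longleftrightarrow> P = vec.span {\<chi> i. x i}"

interpretation proj: form_topology "proj_space :: ('a::field ^ 'n::finite) set set" proj_rep proj_zariski
proof
  have "proj_nonzero_locus F = {P \<in> proj_space. \<exists>x. proj_rep P x \<and> mpoly_eval F x \<noteq> 0}"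
    for F :: "('n, 'a) mpoly"
  proof -
    have "(\<exists>x. P = vec.span {x} \<and> mpoly_eval F (\<lambda>i. x $ i) \<noteq> 0) \<longleftrightarrow> (\<exists>x. proj_rep P x \<and> mpoly_eval F x \<noteq> 0)"
      for P :: "('a ^ 'n) set"
    proof
      assume "\<exists>x. P = vec.span {x} \<and> mpoly_eval F (\<lambda>i. x $ i) \<noteq> 0"
      then obtain x where "P = vec.span {x}" "mpoly_eval F (\<lambda>i. x $ i) \<noteq> 0" by blast
      then show "\<exists>x. proj_rep P x \<and> mpoly_eval F x \<noteq> 0" unfolding proj_rep_def
        by (intro exI[of _ "\<lambda>i. x $ i"]) simp
    next
      assume "\<exists>x. proj_rep P x \<and> mpoly_eval F x \<noteq> 0"
      then obtain x where "proj_rep P x" "mpoly_eval F x \<noteq> 0" by blast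
      then show "\<exists>x. P = vec.span {x} \<and> mpoly_eval F (\<lambda>i. x $ i) \<noteq> 0" unfolding proj_rep_def
        by (intro exI[of _ "\<chi> i. x i"]) simp
    qed
    then show ?thesis unfolding proj_nonzero_locus_def by simp
  qed
  then show "proj_zariski = topology_generated_by
      {{P \<in> (proj_space :: ('a ^ 'n) set set). \<exists>x. proj_rep P x \<and> mpoly_eval F x \<noteq> 0} | F. homogeneous F}"
    unfolding proj_zariski_def by simp
  fix P :: "('a ^ 'n) set" assume P: "P \<in> proj_space"
  obtain x where "P = vec.span {x}" using proj_space_generator[OF P] by blast
  then show "\<exists>x. proj_rep P x" unfolding proj_rep_def by (intro exI[of _ "\<lambda>i. x $ i"]) simp
  fix x y assume "proj_rep P x" "proj_rep P y"
  then obtain c where "c \<noteq> 0" "(\<chi> i. y i) = c *s (\<chi> i. x i)"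
    using span_singleton_eq[of "\<chi> i. x i" "\<chi> i. y i"] P unfolding proj_rep_def by metis
  then show "\<exists>c. c \<noteq> 0 \<and> y = (\<lambda>v. c * x v)"
    by (intro exI[of _ c]) (auto simp: Finite_Cartesian_Product.vec_eq_iff)
qed

text \<open>For a set \<open>C\<close> of projective points this is the affine cone without its
  apex, since the zero vector spans no point.\<close>

definition pcone :: "('a::field ^ 'n) set set \<Rightarrow> ('n \<Rightarrow> 'a) set" where
  "pcone C = {x. vec.span {\<chi> i. x i} \<in> C}"

lemma proj_nz_iff_cone:
  assumes "C \<subseteq> proj_space" "form h"
  shows "(\<exists>P\<in>C. proj.nz h P) \<longleftrightarrow> (\<exists>x\<in>pcone C. h x \<noteq> 0)"
proof
  assume "\<exists>P\<in>C. proj.nz h P"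
  then show "\<exists>x\<in>pcone C. h x \<noteq> 0" unfolding proj.nz_def proj_rep_def pcone_def by blast
next
  assume "\<exists>x\<in>pcone C. h x \<noteq> 0"
  then obtain x where "vec.span {\<chi> i. x i} \<in> C" "h x \<noteq> 0" unfolding pcone_def by blast
  then show "\<exists>P\<in>C. proj.nz h P" using assms unfolding proj.nz_def proj_rep_def by blast
qed

lemma hirr_cone:
  fixes C :: "('a::field ^ 'n::finite) set set"
  assumes "irreducible_in proj_zariski C"
  shows "hirr UNIV (pcone C)"
  unfolding hirr_def
proof (intro conjI allI impI)
  have sub: "C \<subseteq> proj_space" and ne: "C \<noteq> {}"
    using assms unfolding irreducible_in_def proj.topspace by auto
  then obtain P where P: "P \<in> C" by blast
  obtain x where "proj_rep P x" using proj.R_ex sub P by blast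
  then have "x \<in> pcone C" using P unfolding proj_rep_def pcone_def by simp
  then show "pcone C \<noteq> {}" by blast
  fix n m f g
  assume A: "homf UNIV n f \<and> homf UNIV m g \<and> (\<exists>x\<in>pcone C. f x \<noteq> 0) \<and> (\<exists>x\<in>pcone C. g x \<noteq> 0)"
  then have fg: "form f" "form g" unfolding form_def by auto
  have "\<exists>P\<in>C. \<forall>h\<in>{f, g}. proj.nz h P"
    by (rule proj.irreducible_nz[OF assms]) (use fg A proj_nz_iff_cone[OF sub] in auto)
  then obtain P where P: "P \<in> C" "proj.nz f P" "proj.nz g P" by blast
  then obtain x where x: "proj_rep P x" using proj.R_ex sub by blast
  have "f x \<noteq> 0" "g x \<noteq> 0" using P x fg sub proj.nz_iff by blast+
  moreover have "x \<in> pcone C" using P x unfolding proj_rep_def pcone_def by simp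
  ultimately show "\<exists>x\<in>pcone C. f x * g x \<noteq> 0" by auto
qed

text \<open>Strict inclusions of closed sets are witnessed on the cones by forms. The linear form
  for the growth argument is a coordinate that is nonzero at a point of the smallest cone.\<close>

lemma proj_chain_bound:
  fixes Y :: "('a::field ^ 'n::finite) set set"
  assumes "chain_in proj_zariski Y C n" "grow UNIV (pcone Y) d"
  shows "n \<le> d"
proof -
  have C: "\<And>i. i \<le> n \<Longrightarrow> closedin proj_zariski (C i)" "\<And>i. i \<le> n \<Longrightarrow> irreducible_in proj_zariski (C i)"
    "\<And>i. i \<le> n \<Longrightarrow> C i \<subseteq> Y" "\<And>i. i < n \<Longrightarrow> C i \<subset> C (Suc i)"
    using assms(1) unfolding chain_in_def by auto
  have sub: "C i \<subseteq> proj_space" if "i \<le> n" for i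
    using C(2)[OF that] unfolding irreducible_in_def proj.topspace by blast
  obtain x where x: "x \<in> pcone (C 0)" using hirr_cone[OF C(2)[of 0]] unfolding hirr_def by auto
  then have "(\<chi> i. x i) \<noteq> 0" using sub[of 0] proj_space_span_iff unfolding pcone_def by blast
  then obtain v where v: "x v \<noteq> 0" by (auto simp: Finite_Cartesian_Product.vec_eq_iff)
  show ?thesis
  proof (rule grow_chain[where Y = "\<lambda>i. pcone (C i)" and B = UNIV and u = "\<lambda>x. x v"])
    show "hirr UNIV (pcone (C i))" if "i \<le> n" for i using hirr_cone C(2) that by blast
    show "pcone (C i) \<subseteq> pcone (C (Suc i))" if "i < n" for i using C(4)[OF that] unfolding pcone_def by blast
    show "homf UNIV 1 (\<lambda>x. x v)" by (rule hom_coord) simp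
    show "\<exists>x\<in>pcone (C 0). x v \<noteq> 0" using x v by blast
    have "pcone (C n) \<subseteq> pcone Y" using C(3)[of n] unfolding pcone_def by auto
    then show "grow UNIV (pcone (C n)) d" by (rule grow_subset[OF assms(2)])
    fix i assume i: "i < n"
    obtain P where P: "P \<in> C (Suc i)" "P \<notin> C i" using C(4)[OF i] by blast
    have "P \<in> proj_space" using P sub[of "Suc i"] i by auto
    then obtain h where h: "form h" "proj.nz h P" "\<forall>q\<in>C i. \<not> proj.nz h q"
      using proj.closed_separate[OF C(1)[of i] C(2)[of i] _ P(2)] i by auto
    have "\<forall>x\<in>pcone (C i). h x = 0" using proj_nz_iff_cone[OF sub h(1), of i] h(3) i by auto
    moreover have "\<exists>x\<in>pcone (C (Suc i)). h x \<noteq> 0"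
      using proj_nz_iff_cone[OF sub h(1), of "Suc i"] h(2) P(1) i by auto
    ultimately show "\<exists>e g. homf UNIV e g \<and> (\<forall>x\<in>pcone (C i). g x = 0) \<and> (\<exists>x\<in>pcone (C (Suc i)). g x \<noteq> 0)"
      using h(1) unfolding form_def by blast
  qed
qed

subsection \<open>Grassmannians\<close>

definition grass_rep :: "nat \<Rightarrow> ('a::field ^ 'n) set \<Rightarrow> ('n list \<Rightarrow> 'a) \<Rightarrow> bool" where
  "grass_rep w L x \<longleftrightarrow> (\<exists>b. L = vec.span (b ` {..w}) \<and> x = plucker w b)"

interpretation grass: form_topology "grassmannian w :: ('a::field ^ 'n::finite) set set" "grass_rep w" "grass_zariski w"
  for w
proof
  have "grass_nonzero_locus w F = {L \<in> grassmannian w. \<exists>x. grass_rep w L x \<and> mpoly_eval F x \<noteq> 0}"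
    for F :: "('n list, 'a) mpoly"
    unfolding grass_nonzero_locus_def grass_rep_def by blast
  then show "grass_zariski w = topology_generated_by
      {{L \<in> (grassmannian w :: ('a ^ 'n) set set). \<exists>x. grass_rep w L x \<and> mpoly_eval F x \<noteq> 0} | F. homogeneous F}"
    unfolding grass_zariski_def by simp
  fix L :: "('a ^ 'n) set" assume L: "L \<in> grassmannian w"
  show "\<exists>x. grass_rep w L x" using grassmannian_family[OF L] unfolding grass_rep_def by blast
  fix x y assume "grass_rep w L x" "grass_rep w L y"
  then obtain b b' where b: "L = vec.span (b ` {..w})" "x = plucker w b" "L = vec.span (b' ` {..w})" "y = plucker w b'"
    unfolding grass_rep_def by blast
  have "b' ` {..w} \<subseteq> vec.span (b ` {..w})" using vec.span_superset[of "b' ` {..w}"] b(1,3) by simp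
  from plucker_eq_scaled[OF this] obtain \<delta> where \<delta>: "\<And>J. plucker w b' J = \<delta> * plucker w b J" by blast
  have "vec.dim (vec.span (b' ` {..w})) = w + 1" using L b(3) unfolding grassmannian_def by simp
  then obtain J where "plucker w b' J \<noteq> 0" using plucker_nonzero_exists by blast
  then have "\<delta> \<noteq> 0" using \<delta> by auto
  then show "\<exists>c. c \<noteq> 0 \<and> y = (\<lambda>v. c * x v)" using \<delta> b(2,4) by (intro exI[of _ \<delta>]) auto
qed

lemma grass_nz_frame:
  fixes b :: "nat \<Rightarrow> 'a::field ^ 'n::finite"
  assumes "form h" "vec.span (b ` {..w}) \<in> grassmannian w"
  shows "grass.nz w h (vec.span (b ` {..w})) \<longleftrightarrow> h (plucker w b) \<noteq> 0"
  by (rule grass.nz_iff[OF assms]) (auto simp: grass_rep_def)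

lemma span_family_in_grassmannian:
  fixes b :: "nat \<Rightarrow> 'a::field ^ 'n::finite"
  shows "vec.span (b ` {..w}) \<in> grassmannian w \<longleftrightarrow> (\<exists>J. plucker w b J \<noteq> 0)"
  using plucker_nonzero_exists[of b w] plucker_nonzero_independent[of w b]
  unfolding grassmannian_def by auto

section \<open>Configurations of points of the variety\<close>

lemma proj_point_span:
  fixes P :: "('a::field ^ 'n::finite) set"
  assumes "P \<in> proj_space" "x \<in> P" "x \<noteq> 0"
  shows "P = vec.span {x}"
proof -
  obtain y where y: "P = vec.span {y}" "y \<noteq> 0" using proj_space_generator[OF assms(1)] by blast
  then obtain c where c: "x = c *s y" using assms(2) unfolding vec.span_singleton by auto
  then have "c \<noteq> 0" using assms(3) by auto
  then have "y = inverse c *s x" using c by simp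
  then have "y \<in> vec.span {x}" unfolding vec.span_singleton by blast
  moreover have "x \<in> vec.span {y}" using assms(2) y(1) by simp
  ultimately show ?thesis unfolding y(1) by (intro antisym vec.span_minimal) auto
qed

text \<open>A basis of a proper span could be extended to the whole space; dropping one of the new
  vectors would leave a hyperplane containing \<open>X\<close>.\<close>

lemma nondegenerate_span:
  fixes X :: "('a::field ^ 'n::finite) set set"
  assumes "nondegenerate X" shows "vec.span (\<Union>X) = UNIV"
proof (rule ccontr)
  assume ne: "vec.span (\<Union>X) \<noteq> UNIV"
  obtain B0 where B0: "B0 \<subseteq> \<Union>X" "vec.independent B0" "\<Union>X \<subseteq> vec.span B0"
    using vec.basis_exists by metis
  obtain B where B: "B0 \<subseteq> B" "vec.independent B" "UNIV \<subseteq> vec.span B"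
    using vec.maximal_independent_subset_extend[of B0 UNIV] B0(2) by auto
  have "B \<noteq> B0"
  proof
    assume "B = B0"
    then have "vec.span (\<Union>X) = UNIV" using B(3) vec.span_mono[OF B0(1)] by auto
    then show False using ne by blast
  qed
  then obtain v where v: "v \<in> B" "v \<notin> B0" using B(1) by blast
  have fB: "finite B" by (rule vec.finiteI_independent[OF B(2)])
  have cB: "card B = CARD('n)"
    using vec.dim_eq_card_independent[OF B(2)] vec.dim_span[of B] B(3) vec_dim_card by (metis top.extremum_unique)
  define H where "H = vec.span (B - {v})"
  have "vec.dim H = card (B - {v})" unfolding H_def
    by (intro vec.dim_span_eq_card_independent vec.independent_mono[OF B(2)]) auto
  then have "vec.dim H + 1 = CARD('n)" using cB fB v(1) card_Suc_Diff1[OF fB v(1)] by simp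
  moreover have "vec.subspace H" unfolding H_def by simp
  moreover have "\<forall>P\<in>X. P \<subseteq> H"
    using B0(3) vec.span_mono[of B0 "B - {v}"] B(1) v(2) unfolding H_def by blast
  ultimately show False using assms unfolding nondegenerate_def by blast
qed

lemma independent_family_exists:
  fixes X :: "('a::field ^ 'n::finite) set set"
  assumes "vec.span (\<Union>X) = UNIV" "Suc m \<le> CARD('n)"
  obtains x where "\<And>i. i \<le> m \<Longrightarrow> x i \<in> \<Union>X" "vec.dim (vec.span (x ` {..m})) = m + 1"
proof -
  obtain B where B: "B \<subseteq> \<Union>X" "vec.independent B" "\<Union>X \<subseteq> vec.span B" "card B = vec.dim (\<Union>X)"
    using vec.basis_exists by metis
  have "card B = CARD('n)" using B(4) vec.dim_span[of "\<Union>X"] assms(1) vec_dim_card by metis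
  then obtain B' where B': "B' \<subseteq> B" "card B' = Suc m" "finite B'"
    using obtain_subset_with_card_n[of "Suc m" B] assms(2) by auto
  then obtain h where h: "bij_betw h {0..<Suc m} B'" using ex_bij_betw_nat_finite[of B'] by auto
  then have im: "h ` {..m} = B'" by (auto simp: bij_betw_def lessThan_Suc_atMost[symmetric] atLeast0LessThan)
  show thesis
  proof (rule that[of h])
    show "h i \<in> \<Union>X" if "i \<le> m" for i using that im B'(1) B(1) by blast
    have "vec.independent B'" using vec.independent_mono[OF B(2) B'(1)] .
    then show "vec.dim (vec.span (h ` {..m})) = m + 1"
      unfolding im using vec.dim_span_eq_card_independent B'(2) by fastforce
  qed
qed

definition frame :: "(nat \<times> 'n \<Rightarrow> 'a) \<Rightarrow> nat \<Rightarrow> 'a ^ 'n" where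
  "frame y l = (\<chi> j. y (l, j))"

text \<open>
  A configuration \<open>t\<close> consists of vectors \<open>x\<^sub>i\<close> on the cone over \<open>X\<close> (the coordinates \<open>Inr (i, j)\<close>)
  and of a coefficient matrix (the coordinates \<open>Inl (l, i)\<close>); its rows are the corresponding linear
  combinations of the \<open>x\<^sub>i\<close>. The index \<open>s'\<close> is \<open>s - 1\<close>.
\<close>

definition config_point :: "((nat \<times> nat) + (nat \<times> 'r) \<Rightarrow> 'a) \<Rightarrow> nat \<Rightarrow> 'a ^ 'r" where
  "config_point t i = (\<chi> j. t (Inr (i, j)))"

definition config_row :: "nat \<Rightarrow> ((nat \<times> nat) + (nat \<times> 'r) \<Rightarrow> 'a::field) \<Rightarrow> nat \<Rightarrow> 'a ^ 'r" where
  "config_row s' t l = (\<Sum>i\<le>s'. t (Inl (l, i)) *s config_point t i)"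

locale secant_setup =
  fixes X :: "('a::{alg_closed_field, field_char_0} ^ 'r::finite) set set"
    and s' w :: nat
  assumes X: "irreducible_projective_variety X" and nondeg: "nondegenerate X"
    and s'_less: "s' < CARD('r)" and w_le: "w \<le> s'"
begin

lemma X_sub: "X \<subseteq> proj_space"
  using X unfolding irreducible_projective_variety_def irreducible_in_def proj.topspace by blast

text \<open>Unlike \<open>pcone X\<close>, this cone contains the apex 0, so it is closed under
  scaling by every constant, as required for passing from forms to all polynomials.\<close>

definition Xhat :: "('r \<Rightarrow> 'a) set" where
  "Xhat = {x. (\<chi> j. x j) \<in> \<Union>X}"

lemma Xhat_span: "(\<chi> j. x j) \<noteq> 0 \<Longrightarrow> x \<in> Xhat \<longleftrightarrow> vec.span {\<chi> j. x j} \<in> X"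
  unfolding Xhat_def using proj_point_span X_sub vec.span_base[of "\<chi> j. x j" "{\<chi> j. x j}"] by blast

lemma Xhat_scale: "x \<in> Xhat \<Longrightarrow> (\<lambda>j. t * x j) \<in> Xhat"
proof -
  assume "x \<in> Xhat"
  then obtain P where P: "P \<in> X" "(\<chi> j. x j) \<in> P" unfolding Xhat_def by blast
  then have "vec.subspace P" using X_sub unfolding grassmannian_def by blast
  then have "t *s (\<chi> j. x j) \<in> P" using P(2) by (rule vec.subspace_scale)
  moreover have "t *s (\<chi> j. x j) = (\<chi> j. t * x j)" by (simp add: Finite_Cartesian_Product.vec_eq_iff)
  ultimately show ?thesis using P(1) unfolding Xhat_def by auto
qed

lemma cone_sub_Xhat: "pcone X \<subseteq> Xhat"
  unfolding pcone_def Xhat_def using vec.span_base by blast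

text \<open>The two cones differ only in the apex, and a form that is nonzero there is a nonzero
  constant.\<close>

lemma Xhat_nonzero_cone:
  assumes "homf UNIV n f" "\<exists>x\<in>Xhat. f x \<noteq> 0" shows "\<exists>x\<in>pcone X. f x \<noteq> 0"
proof -
  obtain x where x: "x \<in> Xhat" "f x \<noteq> 0" using assms(2) by blast
  obtain y where y: "y \<in> pcone X"
    using hirr_nonempty[OF hirr_cone[of X]] X unfolding irreducible_projective_variety_def by blast
  show ?thesis
  proof (cases "(\<chi> j. x j) = 0")
    case True
    then have "x = (\<lambda>v. 0 * y v)" by (auto simp: Finite_Cartesian_Product.vec_eq_iff)
    then have "f y \<noteq> 0" using hom_homog[OF assms(1), of 0 y] x(2) by (metis mult_zero_right)
    then show ?thesis using y by blast
  next
    case False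
    then have "x \<in> pcone X" using x(1) Xhat_span unfolding pcone_def by blast
    then show ?thesis using x(2) by blast
  qed
qed

lemma pirr_Xhat: "pirr UNIV Xhat"
proof (rule hirr_imp_pirr_cone)
  have h: "hirr UNIV (pcone X)" using hirr_cone X unfolding irreducible_projective_variety_def by blast
  show "hirr UNIV Xhat" unfolding hirr_def
  proof (intro conjI allI impI)
    show "Xhat \<noteq> {}" using hirr_nonempty[OF h] cone_sub_Xhat by blast
    fix n m f g
    assume A: "homf UNIV n f \<and> homf UNIV m g \<and> (\<exists>x\<in>Xhat. f x \<noteq> 0) \<and> (\<exists>x\<in>Xhat. g x \<noteq> 0)"
    then have "\<exists>x\<in>pcone X. f x \<noteq> 0" "\<exists>x\<in>pcone X. g x \<noteq> 0" using Xhat_nonzero_cone by blast+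
    then have "\<exists>x\<in>pcone X. f x * g x \<noteq> 0" using hirrD[OF h] A by blast
    then show "\<exists>x\<in>Xhat. f x * g x \<noteq> 0" using cone_sub_Xhat by blast
  qed
qed (rule Xhat_scale)

definition configs :: "((nat \<times> nat) + (nat \<times> 'r) \<Rightarrow> 'a) set" where
  "configs = {t. \<forall>i\<le>s'. (\<lambda>j. t (Inr (i, j))) \<in> Xhat}"

text \<open>Irreducibility of a product, factor by factor: a configuration with \<open>f\<close>
  nonzero and one with \<open>g\<close> nonzero are made equal step by step, each time choosing a
  common value by irreducibility of one factor. After \<open>m\<close> steps they can differ only in
  the vectors with index from \<open>m\<close> to \<open>s'\<close>.\<close>

lemma configs_merge:
  fixes f g :: "((nat \<times> nat) + (nat \<times> 'r) \<Rightarrow> 'a) \<Rightarrow> 'a"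
  assumes f: "polf UNIV f" "\<exists>t\<in>configs. f t \<noteq> 0" and g: "polf UNIV g" "\<exists>t\<in>configs. g t \<noteq> 0"
  shows "m \<le> Suc s' \<Longrightarrow> \<exists>u\<in>configs. \<exists>u'\<in>configs. f u \<noteq> 0 \<and> g u' \<noteq> 0 \<and>
    (\<forall>v. (\<forall>i j. v = Inr (i, j) \<longrightarrow> \<not> (m \<le> i \<and> i \<le> s')) \<longrightarrow> u v = u' v)"
proof (induction m)
  case 0
  \<comment> \<open>The start equalizes all coordinates that are not constrained to the
    cone.\<close>
  define free where "free v \<longleftrightarrow> (\<forall>i j. v = Inr (i, j) \<longrightarrow> \<not> i \<le> s')" for v :: "(nat \<times> nat) + (nat \<times> 'r)"
  define mix where "mix t z v = (if free v then z v else t v)" for t z :: "(nat \<times> nat) + (nat \<times> 'r) \<Rightarrow> 'a" and v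
  obtain t where t: "t \<in> configs" "f t \<noteq> 0" using f by blast
  obtain t' where t': "t' \<in> configs" "g t' \<noteq> 0" using g by blast
  have pm: "polf UNIV (\<lambda>z. mix t z v)" for t v
    unfolding mix_def by (cases "free v") (auto intro: polf_coord)
  have "polf UNIV (\<lambda>z. f (mix t z))" "polf UNIV (\<lambda>z. g (mix t' z))"
    using polf_subst[OF f(1), of UNIV "\<lambda>v z. mix t z v"] polf_subst[OF g(1), of UNIV "\<lambda>v z. mix t' z v"] pm by auto
  moreover have "mix t t = t" for t by (auto simp: mix_def)
  then have "\<exists>z\<in>UNIV. f (mix t z) \<noteq> 0" "\<exists>z\<in>UNIV. g (mix t' z) \<noteq> 0" using t t' by (metis UNIV_I)+
  ultimately have "\<exists>z\<in>UNIV. f (mix t z) * g (mix t' z) \<noteq> 0"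
    using pirr_UNIV[of UNIV, unfolded pirr_def, THEN conjunct2, rule_format, of "\<lambda>z. f (mix t z)" "\<lambda>z. g (mix t' z)"]
    by blast
  then obtain z where z: "f (mix t z) \<noteq> 0" "g (mix t' z) \<noteq> 0" by auto
  have "mix t z \<in> configs" "mix t' z \<in> configs"
    using t(1) t'(1) unfolding configs_def mix_def free_def by auto
  moreover have "\<forall>v. free v \<longrightarrow> mix t z v = mix t' z v" unfolding mix_def by simp
  ultimately show ?case using z unfolding free_def by (metis le0)
next
  case (Suc m)
  then obtain u u' where u: "u \<in> configs" "u' \<in> configs" "f u \<noteq> 0" "g u' \<noteq> 0"
    and eq: "\<And>v. (\<forall>i j. v = Inr (i, j) \<longrightarrow> \<not> (m \<le> i \<and> i \<le> s')) \<Longrightarrow> u v = u' v" by (metis Suc_leD)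
  have m: "m \<le> s'" using Suc.prems by simp
  define mix where "mix t z v = (case v of Inl p \<Rightarrow> t v | Inr p \<Rightarrow> if fst p = m then z (snd p) else t v)"
    for t :: "(nat \<times> nat) + (nat \<times> 'r) \<Rightarrow> 'a" and z v
  have pm: "polf UNIV (\<lambda>z. mix t z v)" for t v
  proof (cases v)
    case (Inr p) then show ?thesis unfolding mix_def by (cases "fst p = m") (auto intro: polf_coord)
  qed (auto simp: mix_def)
  have "polf UNIV (\<lambda>z. f (mix u z))" "polf UNIV (\<lambda>z. g (mix u' z))"
    using polf_subst[OF f(1), of UNIV "\<lambda>v z. mix u z v"] polf_subst[OF g(1), of UNIV "\<lambda>v z. mix u' z v"] pm by auto
  moreover have "mix t (\<lambda>j. t (Inr (m, j))) = t" for t by (auto simp: mix_def fun_eq_iff split: sum.split)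
  then have "\<exists>z\<in>Xhat. f (mix u z) \<noteq> 0" "\<exists>z\<in>Xhat. g (mix u' z) \<noteq> 0"
    using u m unfolding configs_def by (metis (mono_tags, lifting) mem_Collect_eq)+
  ultimately have "\<exists>z\<in>Xhat. f (mix u z) * g (mix u' z) \<noteq> 0"
    using pirr_Xhat[unfolded pirr_def, THEN conjunct2, rule_format, of "\<lambda>z. f (mix u z)" "\<lambda>z. g (mix u' z)"]
    by blast
  then obtain z where z: "z \<in> Xhat" "f (mix u z) \<noteq> 0" "g (mix u' z) \<noteq> 0" by auto
  have "(\<lambda>j. mix t z (Inr (i, j))) = (if i = m then z else (\<lambda>j. t (Inr (i, j))))" for t i
    by (auto simp: mix_def)
  then have "mix u z \<in> configs" "mix u' z \<in> configs"
    using u(1,2) z(1) unfolding configs_def by auto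
  moreover have "mix u z v = mix u' z v" if "\<forall>i j. v = Inr (i, j) \<longrightarrow> \<not> (Suc m \<le> i \<and> i \<le> s')" for v
    using eq[of v] that unfolding mix_def by (cases v) auto
  ultimately show ?case using z(2,3) by blast
qed

lemma pirr_configs: "pirr UNIV configs"
  unfolding pirr_def
proof (intro conjI allI impI)
  obtain x where "x \<in> Xhat" using pirr_nonempty[OF pirr_Xhat] by blast
  then have "(\<lambda>v. case v of Inl p \<Rightarrow> 0 | Inr p \<Rightarrow> x (snd p)) \<in> configs" unfolding configs_def by simp
  then show "configs \<noteq> {}" by blast
  fix f g :: "((nat \<times> nat) + (nat \<times> 'r) \<Rightarrow> 'a) \<Rightarrow> 'a"
  assume "polf UNIV f \<and> polf UNIV g \<and> (\<exists>x\<in>configs. f x \<noteq> 0) \<and> (\<exists>x\<in>configs. g x \<noteq> 0)"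
  then obtain u u' where u: "u \<in> configs" "f u \<noteq> 0" "g u' \<noteq> 0"
    "\<forall>v. (\<forall>i j. v = Inr (i, j) \<longrightarrow> \<not> (Suc s' \<le> i \<and> i \<le> s')) \<longrightarrow> u v = u' v"
    using configs_merge[of f g "Suc s'"] by blast
  then have "u = u'" by (intro ext) auto
  then show "\<exists>x\<in>configs. f x * g x \<noteq> 0" using u by auto
qed

definition GS0 :: "('a ^ 'r) set set" where
  "GS0 = {L \<in> grassmannian w. \<exists>S. S \<subseteq> X \<and> finite S \<and> card S = Suc s' \<and> independent_points S \<and> L \<subseteq> lin_span S}"

lemma config_row_span: "config_row s' t l \<in> vec.span (config_point t ` {..s'})"
  unfolding config_row_def by (intro vec.span_sum vec.span_scale vec.span_base imageI)

lemma config_point_X: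
  assumes "t \<in> configs" "i \<le> s'" "config_point t i \<noteq> 0"
  shows "vec.span {config_point t i} \<in> X"
  using assms Xhat_span[of "\<lambda>j. t (Inr (i, j))"] unfolding configs_def config_point_def by auto

lemma independent_configE:
  assumes ind: "vec.dim (vec.span (config_point t ` {..s'})) = s' + 1"
  shows "i \<le> s' \<Longrightarrow> config_point t i \<noteq> 0"
    and "i \<le> s' \<Longrightarrow> j \<le> s' \<Longrightarrow> i \<noteq> j \<Longrightarrow> config_point t i \<notin> vec.span {config_point t j}"
proof -
  show nz: "config_point t i \<noteq> 0" if "i \<le> s'" for i
  proof
    assume z: "config_point t i = 0"
    have "(\<Sum>l\<le>s'. (if l = i then 1 else 0) *s config_point t l) = 0"
      by (rule sum.neutral) (use z in auto)
    from dim_span_familyD[OF ind this that] show False by simp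
  qed
  assume ij: "i \<le> s'" "j \<le> s'" "i \<noteq> j"
  show "config_point t i \<notin> vec.span {config_point t j}"
  proof
    assume "config_point t i \<in> vec.span {config_point t j}"
    then obtain c where c: "config_point t i = c *s config_point t j" unfolding vec.span_singleton by auto
    define d where "d l = (if l = i then 1 else 0) - (if l = j then c else 0)" for l
    have "(\<Sum>l\<le>s'. d l *s config_point t l) =
       (\<Sum>l\<le>s'. (if l = i then config_point t l else 0) - (if l = j then c *s config_point t l else 0))"
      by (rule sum.cong) (auto simp: d_def)
    also have "\<dots> = 0" using ij c by (simp add: sum_subtractf)
    finally have "d i = 0" by (rule dim_span_familyD[OF ind _ ij(1)])
    then show False using ij(3) by (simp add: d_def)
  qed
qed

text \<open>Independence makes the spanned points pairwise distinct, so that there are exactly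
  \<open>Suc s'\<close> of them.\<close>

lemma config_in_GS0:
  assumes t: "t \<in> configs" and ind: "vec.dim (vec.span (config_point t ` {..s'})) = s' + 1"
    and L: "L \<in> grassmannian w" "L \<subseteq> vec.span (config_point t ` {..s'})"
  shows "L \<in> GS0"
proof -
  let ?x = "config_point t"
  define P where "P i = vec.span {?x i}" for i
  have inj: "inj_on P {..s'}"
  proof (rule inj_onI, rule ccontr)
    fix i j assume ij: "i \<in> {..s'}" "j \<in> {..s'}" "P i = P j" "i \<noteq> j"
    have "?x i \<in> P i" by (simp add: P_def vec.span_base)
    then have "?x i \<in> P j" using ij(3) by simp
    then show False using independent_configE(2)[OF ind, of i j] ij unfolding P_def by auto
  qed
  define S where "S = P ` {..s'}"
  have "S \<subseteq> X" unfolding S_def P_def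
    using config_point_X[OF t] independent_configE(1)[OF ind] by auto
  moreover have "finite S" "card S = Suc s'" unfolding S_def using card_image[OF inj] by auto
  moreover have "independent_points S" unfolding independent_points_def
  proof (intro exI[of _ "\<lambda>Q. ?x (the_inv_into {..s'} P Q)"] conjI ballI)
    fix Q assume "Q \<in> S"
    then show "Q = vec.span {?x (the_inv_into {..s'} P Q)}"
      unfolding S_def using the_inv_into_f_f[OF inj] by (auto simp: P_def)
  next
    have eq: "?x (the_inv_into {..s'} P (P i)) = ?x i" if "i \<le> s'" for i
      using the_inv_into_f_f[OF inj] that by auto
    have im: "(\<lambda>Q. ?x (the_inv_into {..s'} P Q)) ` S = ?x ` {..s'}"
      unfolding S_def image_image by (rule image_cong) (use eq in auto)
    have c: "card (?x ` {..s'}) = Suc s'"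
    proof (rule antisym)
      show "card (?x ` {..s'}) \<le> Suc s'" using card_image_le[of "{..s'}" ?x] by simp
      show "Suc s' \<le> card (?x ` {..s'})"
        using vec.dim_le_card[of "vec.span (?x ` {..s'})" "?x ` {..s'}"] ind by simp
    qed
    show "inj_on (\<lambda>Q. ?x (the_inv_into {..s'} P Q)) S"
      using im c \<open>card S = Suc s'\<close> \<open>finite S\<close> by (intro eq_card_imp_inj_on) auto
    show "vec.independent ((\<lambda>Q. ?x (the_inv_into {..s'} P Q)) ` S)"
      unfolding im using vec.card_eq_dim[OF vec.span_superset[of "?x ` {..s'}"]] c ind by simp
  qed
  moreover have "L \<subseteq> lin_span S"
  proof -
    have "?x ` {..s'} \<subseteq> \<Union>S" unfolding S_def P_def using vec.span_base by blast
    then show ?thesis using L(2) vec.span_mono unfolding lin_span_def by blast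
  qed
  ultimately show ?thesis using L(1) unfolding GS0_def by blast
qed

lemma GS0_config:
  assumes "L \<in> GS0" "L = vec.span (b ` {..w})"
  obtains t where "t \<in> configs" "\<And>l. l \<le> w \<Longrightarrow> config_row s' t l = b l"
    "vec.dim (vec.span (config_point t ` {..s'})) = s' + 1"
proof -
  obtain S where S: "S \<subseteq> X" "finite S" "card S = Suc s'" "independent_points S" "L \<subseteq> lin_span S"
    using assms(1) unfolding GS0_def by blast
  obtain v where v: "\<And>P. P \<in> S \<Longrightarrow> P = vec.span {v P}" "inj_on v S" "vec.independent (v ` S)"
    using S(4) unfolding independent_points_def by blast
  obtain h where h: "bij_betw h {0..<Suc s'} S" using ex_bij_betw_nat_finite[OF S(2)] S(3) by auto
  then have im: "h ` {..s'} = S" by (auto simp: bij_betw_def lessThan_Suc_atMost[symmetric] atLeast0LessThan)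
  define x where "x i = v (h i)" for i
  have imx: "x ` {..s'} = v ` S" unfolding x_def im[symmetric] by (simp add: image_image)
  have sp: "lin_span S \<subseteq> vec.span (x ` {..s'})"
  proof -
    have "\<Union>S \<subseteq> vec.span (x ` {..s'})"
    proof
      fix y assume "y \<in> \<Union>S"
      then obtain P where P: "P \<in> S" "y \<in> P" by blast
      then have "y \<in> vec.span {v P}" using v(1) by blast
      moreover have "{v P} \<subseteq> x ` {..s'}" using P(1) imx by blast
      ultimately show "y \<in> vec.span (x ` {..s'})" using vec.span_mono by blast
    qed
    then show ?thesis unfolding lin_span_def by (intro vec.span_minimal) auto
  qed
  have "\<forall>l. \<exists>c. l \<le> w \<longrightarrow> b l = (\<Sum>i\<le>s'. c i *s x i)"
  proof (intro allI)
    fix l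
    have "b l \<in> L" if "l \<le> w" using vec.span_base[of "b l" "b ` {..w}"] that unfolding assms(2) by simp
    then show "\<exists>c. l \<le> w \<longrightarrow> b l = (\<Sum>i\<le>s'. c i *s x i)"
      using S(5) sp span_family[of "b l" x s'] by blast
  qed
  from choice[OF this] obtain c where c: "\<And>l. l \<le> w \<Longrightarrow> b l = (\<Sum>i\<le>s'. c l i *s x i)" by blast
  define t :: "(nat \<times> nat) + (nat \<times> 'r) \<Rightarrow> 'a" where "t = (\<lambda>v. case v of Inl p \<Rightarrow> c (fst p) (snd p) | Inr p \<Rightarrow> x (fst p) $ snd p)"
  have cp: "config_point t i = x i" for i
    by (simp add: config_point_def t_def)
  show thesis
  proof (rule that[of t])
    have "x i \<in> \<Union>X" if "i \<le> s'" for i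
    proof -
      have "h i \<in> S" using im that by blast
      then have "x i \<in> h i" using v(1)[of "h i"] vec.span_base[of "x i" "{x i}"] unfolding x_def by auto
      then show ?thesis using \<open>h i \<in> S\<close> S(1) by blast
    qed
    then show "t \<in> configs" unfolding configs_def Xhat_def t_def by simp
    show "config_row s' t l = b l" if "l \<le> w" for l
      unfolding config_row_def cp c[OF that] by (simp add: t_def)
    have "vec.dim (vec.span (x ` {..s'})) = card (v ` S)"
      unfolding imx by (rule vec.dim_span_eq_card_independent[OF v(3)])
    then show "vec.dim (vec.span (config_point t ` {..s'})) = s' + 1"
      unfolding cp using card_image[OF v(2)] S(3) by simp
  qed
qed

text \<open>Nondegeneracy supplies \<open>s' + 1\<close> independent vectors on the cone; with an
  identity matrix of coefficients the rows are these vectors.\<close>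

lemma independent_config_exists:
  obtains t where "t \<in> configs" "vec.dim (vec.span (config_point t ` {..s'})) = s' + 1"
    "\<And>l. l \<le> w \<Longrightarrow> config_row s' t l = config_point t l"
proof -
  obtain x where x: "\<And>i. i \<le> s' \<Longrightarrow> x i \<in> \<Union>X" "vec.dim (vec.span (x ` {..s'})) = s' + 1"
    using independent_family_exists[OF nondegenerate_span[OF nondeg], of s'] s'_less by (metis Suc_leI)
  define t :: "(nat \<times> nat) + (nat \<times> 'r) \<Rightarrow> 'a" where "t = (\<lambda>v. case v of Inl p \<Rightarrow> (if fst p = snd p then 1 else 0) | Inr p \<Rightarrow> x (fst p) $ snd p)"
  have cp: "config_point t i = x i" for i by (simp add: config_point_def t_def)
  show thesis
  proof (rule that[of t])
    show "t \<in> configs" using x(1) unfolding configs_def Xhat_def t_def by simp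
    show "vec.dim (vec.span (config_point t ` {..s'})) = s' + 1" unfolding cp by (rule x(2))
    fix l assume "l \<le> w"
    then have "l \<in> {..s'}" using w_le by simp
    have "config_row s' t l = (\<Sum>i\<le>s'. if i = l then x i else 0)"
      unfolding config_row_def cp by (rule sum.cong) (auto simp: t_def)
    then show "config_row s' t l = config_point t l" using \<open>l \<in> {..s'}\<close> by (simp add: cp)
  qed
qed

lemma hom_config_point: "homf UNIV 1 (\<lambda>t. config_point t i $ j)"
  unfolding config_point_def using hom_coord[of "Inr (i, j)" UNIV] by simp

lemma hom_config_row: "homf UNIV 2 (\<lambda>t. config_row s' t l $ j)"
proof -
  have "homf UNIV 2 (\<lambda>t. \<Sum>i\<le>s'. t (Inl (l, i)) * config_point t i $ j)"
  proof (rule hom_sum)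
    fix i
    show "homf UNIV 2 (\<lambda>t. t (Inl (l, i)) * config_point t i $ j)"
      using hom_mult[OF hom_coord[of "Inl (l, i)" UNIV] hom_config_point[of i j]] by (simp add: numeral_2_eq_2)
  qed
  then show ?thesis unfolding config_row_def by (simp add: sum_component)
qed

text \<open>Independence of the points and of the first \<open>w + 1\<close> rows follows from
  nonvanishing Pluecker coordinates, which are polynomial in the configuration. One configuration
  satisfies both conditions, so irreducibility allows them to be imposed along with the given
  ones.\<close>

lemma generic_config:
  assumes I: "finite I" "\<And>i. i \<in> I \<Longrightarrow> polf UNIV (f i)" "\<And>i. i \<in> I \<Longrightarrow> \<exists>t\<in>configs. f i t \<noteq> 0"
  obtains t where "t \<in> configs" "\<And>i. i \<in> I \<Longrightarrow> f i t \<noteq> 0"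
    "vec.dim (vec.span (config_point t ` {..s'})) = s' + 1"
    "vec.span (config_row s' t ` {..w}) \<in> GS0"
proof -
  obtain t0 where t0: "t0 \<in> configs" "vec.dim (vec.span (config_point t0 ` {..s'})) = s' + 1"
    "\<And>l. l \<le> w \<Longrightarrow> config_row s' t0 l = config_point t0 l" by (rule independent_config_exists) blast
  obtain J where J: "plucker s' (config_point t0) J \<noteq> 0" using plucker_nonzero_exists[OF t0(2)] by blast
  have "vec.dim (vec.span (config_row s' t0 ` {..w})) = w + 1"
    unfolding dim_span_family
  proof (intro allI impI)
    fix c l assume c: "(\<Sum>l\<le>w. c l *s config_row s' t0 l) = 0" and l: "l \<le> w"
    define d where "d l = (if l \<le> w then c l else 0)" for l
    have "(\<Sum>l\<le>s'. d l *s config_point t0 l) = (\<Sum>l\<le>w. d l *s config_point t0 l)"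
      by (rule sum.mono_neutral_right) (use w_le in \<open>auto simp: d_def\<close>)
    also have "\<dots> = 0" using c t0(3) by (simp add: d_def)
    finally have "d l = 0" using dim_span_familyD[OF t0(2)] l w_le by simp
    then show "c l = 0" using l by (simp add: d_def)
  qed
  then obtain J' where J': "plucker w (config_row s' t0) J' \<noteq> 0" using plucker_nonzero_exists by blast
  define p where "p t = plucker s' (config_point t) J * plucker w (config_row s' t) J'" for t :: "_ \<Rightarrow> 'a"
  have pp: "polf UNIV p" unfolding p_def
    by (intro polf_mult hom_polf[OF hom_plucker[OF hom_config_point]] hom_polf[OF hom_plucker[OF hom_config_row]])
  have "\<exists>t\<in>configs. (\<Prod>i\<in>I. f i t) \<noteq> 0" by (rule pirr_finite[OF pirr_configs I])
  then have "\<exists>t\<in>configs. (\<Prod>i\<in>I. f i t) * p t \<noteq> 0"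
    using pirr_configs[unfolded pirr_def, THEN conjunct2, rule_format, of "\<lambda>t. \<Prod>i\<in>I. f i t" p]
      pp polf_prod[of I UNIV f] I(2) t0(1) J J' unfolding p_def by auto
  then obtain t where t: "t \<in> configs" "(\<Prod>i\<in>I. f i t) \<noteq> 0" "plucker s' (config_point t) J \<noteq> 0"
    "plucker w (config_row s' t) J' \<noteq> 0" unfolding p_def by auto
  have ind: "vec.dim (vec.span (config_point t ` {..s'})) = s' + 1"
    by (rule plucker_nonzero_independent[OF t(3)])
  show thesis
  proof (rule that[OF t(1) _ ind])
    show "f i t \<noteq> 0" if "i \<in> I" for i using t(2) I(1) that by (simp add: prod_zero_iff)
    show "vec.span (config_row s' t ` {..w}) \<in> GS0"
    proof (rule config_in_GS0[OF t(1) ind])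
      show "vec.span (config_row s' t ` {..w}) \<in> grassmannian w"
        unfolding span_family_in_grassmannian using t(4) by blast
      show "vec.span (config_row s' t ` {..w}) \<subseteq> vec.span (config_point t ` {..s'})"
        by (rule vec.span_minimal) (use config_row_span in auto)
    qed
  qed
qed

lemma GS0_sub: "GS0 \<subseteq> grassmannian w"
  unfolding GS0_def by blast

lemma GS0_nonempty: "GS0 \<noteq> {}"
proof -
  obtain t where "vec.span (config_row s' t ` {..w}) \<in> GS0"
    by (rule generic_config[of "{} :: nat set" "\<lambda>_ _. 0"]) auto
  then show ?thesis by blast
qed

text \<open>The span of the first \<open>w + 1\<close> rows of a generic configuration lies in
  \<open>GS0\<close>, every member of \<open>GS0\<close> arises as such a span, and forms in
  Pluecker coordinates pull back to polynomials on configurations.\<close>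

lemma GS0_irreducible:
  assumes H: "finite H" "\<And>h. h \<in> H \<Longrightarrow> form h" "\<And>h. h \<in> H \<Longrightarrow> \<exists>L\<in>GS0. grass.nz w h L"
  shows "\<exists>L\<in>GS0. \<forall>h\<in>H. grass.nz w h L"
proof -
  define f where "f h t = h (plucker w (config_row s' t))"
    for h :: "('r list \<Rightarrow> 'a) \<Rightarrow> 'a" and t :: "(nat \<times> nat) + (nat \<times> 'r) \<Rightarrow> 'a"
  obtain t where t: "t \<in> configs" "\<And>h. h \<in> H \<Longrightarrow> f h t \<noteq> 0" "vec.span (config_row s' t ` {..w}) \<in> GS0"
  proof (rule generic_config[of H f])
    fix h assume h: "h \<in> H"
    obtain n where "homf UNIV n h" using H(2)[OF h] unfolding form_def by blast
    from hom_subst[OF this hom_plucker[OF hom_config_row]]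
    show "polf UNIV (f h)" unfolding f_def by (rule hom_polf)
    obtain L where L: "L \<in> GS0" "grass.nz w h L" using H(3)[OF h] by blast
    then obtain b where b: "L = vec.span (b ` {..w})" using GS0_sub grassmannian_family by blast
    have "L \<in> grassmannian w" using L(1) GS0_sub by blast
    then have hb: "h (plucker w b) \<noteq> 0" using grass_nz_frame[OF H(2)[OF h], of b w] L(2) b by simp
    obtain t where t: "t \<in> configs" "\<And>l. l \<le> w \<Longrightarrow> config_row s' t l = b l" using GS0_config[OF L(1) b] by blast
    have "plucker w (config_row s' t) = plucker w b"
      by (rule ext) (auto simp: plucker_def t(2) intro!: sum.cong prod.cong)
    then have "f h t \<noteq> 0" using hb unfolding f_def by (simp only: not_False_eq_True)
    then show "\<exists>t\<in>configs. f h t \<noteq> 0" using t(1) by (rule bexI)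
  qed (use H(1) in auto)
  have "grass.nz w h (vec.span (config_row s' t ` {..w}))" if h: "h \<in> H" for h
    using grass_nz_frame[OF H(2)[OF h], of "config_row s' t" w] t(2)[OF h] t(3) GS0_sub unfolding f_def by blast
  then show ?thesis using t(3) by blast
qed

end

section \<open>Affine charts of the Grassmann secant variety\<close>

lemma frame_uncurry [simp]: "frame (\<lambda>(l, j). b l $ j) = b"
  by (rule ext) (simp add: frame_def)

text \<open>On a normalized frame the coordinate \<open>J\<close> equals 1 and the entry
  \<open>(l, j)\<close> is the coordinate \<open>J[l := j]\<close>. Powers of the coordinate
  \<open>J\<close> raise constants to the required degree.\<close>

lemma homogenize:
  fixes f :: "(nat \<times> 'r::finite \<Rightarrow> 'a::field) \<Rightarrow> 'a"
  assumes J: "length J = Suc w"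
  shows "pold ({..w} \<times> UNIV) n f \<Longrightarrow>
    \<exists>h. homf UNIV n h \<and> (\<forall>y. unit_block w J (frame y) \<longrightarrow> h (plucker w (frame y)) = f y)"
proof (induction rule: pold.induct)
  case (const n c)
  show ?case
  proof (intro exI[of _ "\<lambda>p. c * p J ^ n"] conjI allI impI)
    show "homf UNIV n (\<lambda>p. c * p J ^ n)"
      using hom_scale[OF hom_power[OF hom_coord[of J UNIV], of n]] by simp
    fix y :: "nat \<times> 'r \<Rightarrow> 'a" assume "unit_block w J (frame y)"
    from plucker_unit_block(1)[OF J this] show "c * plucker w (frame y) J ^ n = c" by simp
  qed
next
  case (var n f v)
  obtain l j where v: "v = (l, j)" "l \<le> w" using var.hyps(2) by auto
  obtain h where h: "homf UNIV n h" "\<And>y. unit_block w J (frame y) \<Longrightarrow> h (plucker w (frame y)) = f y"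
    using var.IH by blast
  show ?case
  proof (intro exI[of _ "\<lambda>p. p (J[l := j]) * h p"] conjI allI impI)
    show "homf UNIV (Suc n) (\<lambda>p. p (J[l := j]) * h p)" by (rule homf.var[OF h(1)]) simp
    fix y :: "nat \<times> 'r \<Rightarrow> 'a" assume y: "unit_block w J (frame y)"
    show "plucker w (frame y) (J[l := j]) * h (plucker w (frame y)) = y v * f y"
      using plucker_unit_block(2)[OF J y v(2)] h(2)[OF y] v(1) by (simp add: frame_def)
  qed
next
  case (add n f g)
  then obtain h h' where "homf UNIV n h" "\<forall>y. unit_block w J (frame y) \<longrightarrow> h (plucker w (frame y)) = f y"
    "homf UNIV n h'" "\<forall>y. unit_block w J (frame y) \<longrightarrow> h' (plucker w (frame y)) = g y" by blast
  then show ?case by (intro exI[of _ "\<lambda>p. h p + h' p"]) (simp add: homf.add)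
qed

lemma polf_form_frame:
  fixes h :: "('r::finite list \<Rightarrow> 'a::field) \<Rightarrow> 'a"
  assumes "form h" shows "polf ({..w} \<times> UNIV) (\<lambda>y. h (plucker w (frame y)))"
proof -
  obtain n where h: "homf UNIV n h" using assms unfolding form_def by blast
  have "homf ({..w} \<times> UNIV) (Suc w * 1) (\<lambda>y. plucker w (frame y) J)" for J :: "'r list"
  proof (rule hom_plucker)
    fix l and j :: 'r assume "l \<le> w"
    then show "homf ({..w} \<times> UNIV) 1 (\<lambda>y. frame y l $ j)"
      unfolding frame_def using hom_coord[of "(l, j)" "{..w} \<times> UNIV"] by simp
  qed
  from hom_subst[OF h this] show ?thesis by (rule hom_polf)
qed

lemma unit_block_in_grassmannian:
  assumes "length J = Suc w" "unit_block w J b"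
  shows "vec.span (b ` {..w}) \<in> grassmannian w"
  unfolding span_family_in_grassmannian
  using plucker_unit_block(1)[OF assms] by (intro exI[of _ J]) simp

lemma form_nz_frame:
  assumes "length J = Suc w" "unit_block w J b" "form h"
  shows "grass.nz w h (vec.span (b ` {..w})) \<longleftrightarrow> h (plucker w b) \<noteq> 0"
  by (rule grass_nz_frame[OF assms(3) unit_block_in_grassmannian[OF assms(1,2)]])

context secant_setup
begin

definition chart :: "'r list \<Rightarrow> (nat \<times> 'r \<Rightarrow> 'a) set" where
  "chart J = {y. unit_block w J (frame y) \<and> vec.span (frame y ` {..w}) \<in> GS0}"

abbreviation MV :: "(nat \<times> 'r) set" where
  "MV \<equiv> {..w} \<times> UNIV"

lemma chart_normal:
  assumes "L \<in> GS0" "grass.nz w (\<lambda>p. p J) L"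
  shows "\<exists>y\<in>chart J. vec.span (frame y ` {..w}) = L"
proof -
  obtain b where b: "L = vec.span (b ` {..w})" using assms(1) GS0_sub grassmannian_family by blast
  have "plucker w b J \<noteq> 0"
    using grass_nz_frame[OF form_coord, of b w J] assms GS0_sub b by blast
  note n = normal_frame[OF this]
  let ?y = "\<lambda>(l, j). normal_frame w b J l $ j"
  have "?y \<in> chart J" using n assms(1) b unfolding chart_def by simp
  moreover have "vec.span (frame ?y ` {..w}) = L" using n(2) b by simp
  ultimately show ?thesis by blast
qed

lemma chart_nonempty:
  obtains J where "length J = Suc w" "chart J \<noteq> {}"
proof -
  obtain L where L: "L \<in> GS0" using GS0_nonempty by blast
  then have Lg: "L \<in> grassmannian w" using GS0_sub by blast
  then obtain b where b: "L = vec.span (b ` {..w})" using grassmannian_family by blast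
  then obtain J where J: "plucker w b J \<noteq> 0" using span_family_in_grassmannian[of b w] Lg by auto
  then have "grass.nz w (\<lambda>p. p J) L" using grass_nz_frame[OF form_coord, of b w J] Lg b by simp
  then have "chart J \<noteq> {}" using chart_normal[OF L] by blast
  moreover have "length J = Suc w" using J by (auto simp: plucker_def split: if_splits)
  ultimately show thesis using that by blast
qed

lemma pirr_chart:
  assumes J: "length J = Suc w" and ne: "chart J \<noteq> {}"
  shows "pirr MV (chart J)"
  unfolding pirr_def
proof (intro conjI allI impI ne)
  fix f g :: "(nat \<times> 'r \<Rightarrow> 'a) \<Rightarrow> 'a"
  assume A: "polf MV f \<and> polf MV g \<and> (\<exists>x\<in>chart J. f x \<noteq> 0) \<and> (\<exists>x\<in>chart J. g x \<noteq> 0)"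
  then obtain y z where yz: "y \<in> chart J" "z \<in> chart J" "f y \<noteq> 0" "g z \<noteq> 0" by blast
  obtain n m where "pold MV n f" "pold MV m g" using A unfolding polf_def by blast
  then obtain h h' where h: "form h" "\<And>y. unit_block w J (frame y) \<Longrightarrow> h (plucker w (frame y)) = f y"
    and h': "form h'" "\<And>y. unit_block w J (frame y) \<Longrightarrow> h' (plucker w (frame y)) = g y"
    using homogenize[OF J, of n f] homogenize[OF J, of m g] unfolding form_def by blast
  have ub: "unit_block w J (frame x)" "vec.span (frame x ` {..w}) \<in> GS0" if "x \<in> chart J" for x
    using that unfolding chart_def by auto
  have "grass.nz w h (vec.span (frame y ` {..w}))" "grass.nz w h' (vec.span (frame z ` {..w}))"
    using form_nz_frame[OF J ub(1)[OF yz(1)]] form_nz_frame[OF J ub(1)[OF yz(2)]] h h' yz ub by simp_all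
  moreover have "grass.nz w (\<lambda>p. p J) (vec.span (frame y ` {..w}))"
    using form_nz_frame[OF J ub(1)[OF yz(1)] form_coord[of J]]
      plucker_unit_block(1)[OF J ub(1)[OF yz(1)]] by simp
  \<comment> \<open>The third form keeps the common point inside the chart.\<close>
  ultimately have "\<exists>L\<in>GS0. \<forall>h\<in>{h, h', \<lambda>p. p J}. grass.nz w h L"
    using ub(2)[OF yz(1)] ub(2)[OF yz(2)] h(1) h'(1) form_coord by (intro GS0_irreducible) auto
  then obtain L where L: "L \<in> GS0" "grass.nz w h L" "grass.nz w h' L" "grass.nz w (\<lambda>p. p J) L" by blast
  then obtain x where x: "x \<in> chart J" "vec.span (frame x ` {..w}) = L" using chart_normal by blast
  have "f x \<noteq> 0" "g x \<noteq> 0"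
    using L(2,3) form_nz_frame[OF J ub(1)[OF x(1)]] h h' ub(1)[OF x(1)] x(2) by auto
  then show "\<exists>x\<in>chart J. f x * g x \<noteq> 0" using x(1) by auto
qed

definition GS :: "('a ^ 'r) set set" where
  "GS = grass_zariski w closure_of GS0"

text \<open>The chain consists of the closures of the sets of spans of zeros of the primes. It is
  indexed backwards because larger ideals have fewer zeros.\<close>

lemma GS_chain_exists:
  assumes J: "length J = Suc w" and ne: "chart J \<noteq> {}" and B: "B \<subseteq> MV"
    and indep: "\<And>h. h \<in> van MV (chart J) \<Longrightarrow> polf B h \<Longrightarrow> h = (\<lambda>x. 0)"
  shows "\<exists>C. chain_in (grass_zariski w) GS C (card B)"
proof -
  define V where "V = van MV (chart J)"
  have fin: "finite MV" by simp
  obtain Js where Js: "Js 0 = V" "\<And>i. i \<le> card B \<Longrightarrow> prime_ideal MV (Js i)"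
    "\<And>i. i < card B \<Longrightarrow> Js i \<subset> Js (Suc i)"
    using prime_ideal_chain[OF prime_ideal_van[OF pirr_chart[OF J ne]] fin B indep] unfolding V_def by blast
  have VJs: "V \<subseteq> Js i" if "i \<le> card B" for i using that
    by (induction i) (use Js(1,3) in \<open>auto dest!: Suc_le_lessD\<close>)
  define L where "L y = vec.span (frame y ` {..w})" for y :: "nat \<times> 'r \<Rightarrow> 'a"
  \<comment> \<open>The equations of a normalized frame vanish on the chart, so they belong to
    \<open>V\<close> and to every larger prime.\<close>
  have ub: "unit_block w J (frame y)" if y: "y \<in> zeros (Js i) MV" "i \<le> card B" for y i
    unfolding unit_block_def
  proof (intro allI impI)
    fix l m assume lm: "l \<le> w" "m \<le> w"
    define f where "f = (\<lambda>x :: nat \<times> 'r \<Rightarrow> 'a. x (l, J ! m) - (if l = m then 1 else 0))"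
    have pf: "polf MV f" unfolding f_def using lm by (intro polf_diff polf_coord) auto
    have "f x = 0" if "x \<in> chart J" for x
      using that lm unfolding chart_def unit_block_def f_def frame_def by auto
    then have "f \<in> V" using pf unfolding V_def van_def by blast
    then have "f y = 0" using y VJs pf unfolding zeros_def by blast
    then show "frame y l $ (J ! m) = (if l = m then 1 else 0)" unfolding f_def frame_def by simp
  qed
  have LG: "L y \<in> grassmannian w" if "y \<in> zeros (Js i) MV" "i \<le> card B" for y i
    unfolding L_def by (rule unit_block_in_grassmannian[OF J ub[OF that]])
  define Z where "Z i = L ` zeros (Js i) MV" for i
  define C where "C i = grass_zariski w closure_of Z (card B - i)" for i
  have ZG: "Z i \<subseteq> grassmannian w" if "i \<le> card B" for i using LG that unfolding Z_def by blast
  have nzL: "grass.nz w h (L y) \<longleftrightarrow> h (plucker w (frame y)) \<noteq> 0"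
    if "y \<in> zeros (Js i) MV" "i \<le> card B" "form h" for y i h
    unfolding L_def by (rule form_nz_frame[OF J ub[OF that(1,2)] that(3)])
  \<comment> \<open>A zero need not lie in the chart itself. But forms that are nonzero at its span
    do not vanish identically on the chart, and irreducibility of the chart gives a point where all
    of them are nonzero.\<close>
  have ZGS: "Z i \<subseteq> GS" if i: "i \<le> card B" for i
  proof
    fix P assume "P \<in> Z i"
    then obtain y where y: "y \<in> zeros (Js i) MV" "P = L y" unfolding Z_def by blast
    show "P \<in> GS" unfolding GS_def
    proof (rule grass.in_closure)
      show "P \<in> grassmannian w" using LG y i by blast
      fix H assume H: "finite H" "\<And>h. h \<in> H \<Longrightarrow> form h \<and> grass.nz w h P"
      define f where "f h z = h (plucker w (frame z))"
        for h :: "('r list \<Rightarrow> 'a) \<Rightarrow> 'a" and z :: "nat \<times> 'r \<Rightarrow> 'a"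
      have "\<exists>z\<in>chart J. (\<Prod>h\<in>H. f h z) \<noteq> 0"
      proof (rule pirr_finite[OF pirr_chart[OF J ne] H(1)])
        fix h assume h: "h \<in> H"
        show pf: "polf MV (f h)" unfolding f_def using polf_form_frame H(2)[OF h] by blast
        have "f h y \<noteq> 0" using nzL[OF y(1) i, of h] H(2)[OF h] y(2) unfolding f_def by blast
        then have "f h \<notin> V" using y(1) pf VJs[OF i] unfolding zeros_def by blast
        then show "\<exists>z\<in>chart J. f h z \<noteq> 0" using pf unfolding V_def van_def by blast
      qed
      then obtain z where z: "z \<in> chart J" "\<And>h. h \<in> H \<Longrightarrow> f h z \<noteq> 0"
        using H(1) by (auto simp: prod_zero_iff)
      have "L z \<in> GS0" "unit_block w J (frame z)" using z(1) unfolding chart_def L_def by auto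
      moreover have "grass.nz w h (L z)" if "h \<in> H" for h
        using form_nz_frame[OF J calculation(2), of h] H(2)[OF that] z(2)[OF that] unfolding L_def f_def by blast
      ultimately show "\<exists>q\<in>GS0. q \<in> grassmannian w \<and> (\<forall>h\<in>H. grass.nz w h q)" using GS0_sub by blast
    qed
  qed
  have clGS: "closedin (grass_zariski w) GS" unfolding GS_def by simp
  have Zne: "Z i \<noteq> {}" if "i \<le> card B" for i
    using pirr_nonempty[OF pirr_zeros[OF Js(2)[OF that] fin]] unfolding Z_def by blast
  have irr: "irreducible_in (grass_zariski w) (grass_zariski w closure_of Z i)" if i: "i \<le> card B" for i
  proof (rule grass.irreducible_closure[OF ZG[OF i] Zne[OF i]])
    fix H assume H: "finite H" "\<And>h. h \<in> H \<Longrightarrow> form h \<and> (\<exists>p\<in>Z i. grass.nz w h p)"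
    have "\<exists>z\<in>zeros (Js i) MV. (\<Prod>h\<in>H. h (plucker w (frame z))) \<noteq> 0"
    proof (rule pirr_finite[OF pirr_zeros[OF Js(2)[OF i] fin] H(1)])
      fix h assume h: "h \<in> H"
      show "polf MV (\<lambda>z. h (plucker w (frame z)))" using polf_form_frame H(2)[OF h] by blast
      show "\<exists>z\<in>zeros (Js i) MV. h (plucker w (frame z)) \<noteq> 0"
        using H(2)[OF h] nzL[OF _ i] unfolding Z_def by blast
    qed
    then obtain z where z: "z \<in> zeros (Js i) MV" "\<forall>h\<in>H. h (plucker w (frame z)) \<noteq> 0"
      using H(1) by (auto simp: prod_zero_iff)
    then have "\<forall>h\<in>H. grass.nz w h (L z)" using nzL[OF z(1) i] H(2) by blast
    then show "\<exists>p\<in>Z i. \<forall>h\<in>H. grass.nz w h p" using z(1) unfolding Z_def by blast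
  qed
  \<comment> \<open>A function of the larger prime outside the smaller one is nonzero at some zero
    of the smaller one by the Nullstellensatz; homogenized, it separates the closures.\<close>
  have strict: "grass_zariski w closure_of Z (Suc i) \<subset> grass_zariski w closure_of Z i" if i: "i < card B" for i
  proof -
    have "zeros (Js (Suc i)) MV \<subseteq> zeros (Js i) MV" using Js(3)[OF i] unfolding zeros_def by blast
    then have "grass_zariski w closure_of Z (Suc i) \<subseteq> grass_zariski w closure_of Z i"
      unfolding Z_def by (intro closure_of_mono image_mono)
    moreover obtain f where f: "f \<in> Js (Suc i)" "f \<notin> Js i" using Js(3)[OF i] by blast
    interpret S: prime_ideal MV "Js (Suc i)" using Js(2) i by simp
    interpret I: prime_ideal MV "Js i" using Js(2) i by simp
    have pf: "polf MV f" by (rule S.polf[OF f(1)])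
    obtain y where y: "y \<in> zeros (Js i) MV" "f y \<noteq> 0" using I.nullstellensatz[OF fin pf f(2)] by blast
    obtain n where n: "pold MV n f" using pf unfolding polf_def by blast
    obtain h where h: "homf UNIV n h" "\<And>y. unit_block w J (frame y) \<Longrightarrow> h (plucker w (frame y)) = f y"
      using homogenize[OF J n] by blast
    have fh: "form h" using h(1) unfolding form_def by blast
    have "grass.nz w h (L y)" using nzL[OF y(1) _ fh] h(2)[OF ub[OF y(1)]] y(2) i by simp
    moreover have "\<not> grass.nz w h P" if "P \<in> Z (Suc i)" for P
    proof -
      obtain z where z: "z \<in> zeros (Js (Suc i)) MV" "P = L z" using \<open>P \<in> Z (Suc i)\<close> unfolding Z_def by blast
      have "f z = 0" using z(1) f(1) pf unfolding zeros_def by blast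
      then show ?thesis using nzL[OF z(1) _ fh] h(2)[OF ub[OF z(1)]] z(2) i by simp
    qed
    ultimately have "L y \<notin> grass_zariski w closure_of Z (Suc i)" using grass.closure_nz[OF fh] by blast
    moreover have "L y \<in> grass_zariski w closure_of Z i"
      using closure_of_subset[of "Z i" "grass_zariski w"] ZG[of i] y(1) i unfolding grass.topspace Z_def by auto
    ultimately show ?thesis
      using \<open>grass_zariski w closure_of Z (Suc i) \<subseteq> grass_zariski w closure_of Z i\<close> by blast
  qed
  have "chain_in (grass_zariski w) GS C (card B)"
    unfolding chain_in_def
  proof (intro conjI allI impI)
    fix i assume i: "i \<le> card B"
    show "closedin (grass_zariski w) (C i)" unfolding C_def by simp
    show "irreducible_in (grass_zariski w) (C i)" unfolding C_def by (rule irr) simp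
    show "C i \<subseteq> GS" unfolding C_def by (rule closure_of_minimal[OF ZGS clGS]) simp
  next
    fix i assume i: "i < card B"
    then have "card B - i = Suc (card B - (i + 1))" by simp
    then show "C i \<subset> C (i + 1)" unfolding C_def using strict[of "card B - (i + 1)"] i by simp
  qed
  then show ?thesis by blast
qed

end

section \<open>The secant variety of the Segre variety\<close>

lemma segre_point_span:
  fixes l0 :: "'a::field ^ 'k::finite" and x0 :: "'a ^ 'r::finite"
  shows "segre_point (vec.span {l0}) (vec.span {x0}) = vec.span {\<chi> p. l0 $ fst p * x0 $ snd p}"
    (is "_ = vec.span {?z}")
proof
  have "(\<chi> p. l $ fst p * x $ snd p) \<in> vec.span {?z}" if lx: "l \<in> vec.span {l0}" "x \<in> vec.span {x0}" for l x
  proof -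
    obtain c d where "l = c *s l0" "x = d *s x0" using lx unfolding vec.span_singleton by auto
    then have "(\<chi> p. l $ fst p * x $ snd p) = (c * d) *s ?z"
      by (simp add: Finite_Cartesian_Product.vec_eq_iff)
    then show ?thesis unfolding vec.span_singleton by blast
  qed
  then show "segre_point (vec.span {l0}) (vec.span {x0}) \<subseteq> vec.span {?z}"
    unfolding segre_point_def by (intro vec.span_minimal) auto
  have "l0 \<in> vec.span {l0}" "x0 \<in> vec.span {x0}" by (auto intro: vec.span_base)
  then show "vec.span {?z} \<subseteq> segre_point (vec.span {l0}) (vec.span {x0})"
    unfolding segre_point_def by (intro vec.span_mono) blast
qed

section \<open>Forms on matrices, pulled back to products of a coefficient matrix and a
  frame\<close>

definition mat_comb :: "nat \<Rightarrow> ('k \<times> nat \<Rightarrow> 'a::field) \<Rightarrow> (nat \<times> 'r \<Rightarrow> 'a) \<Rightarrow> 'k \<times> 'r \<Rightarrow> 'a" where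
  "mat_comb w A y = (\<lambda>(a, j). \<Sum>l\<le>w. A (a, l) * y (l, j))"

text \<open>A space containing the pullbacks of forms of degree \<open>n\<close> along the matrix
  product. It is homogeneous in the first factor, where one dimension is to be saved, and only of
  bounded degree in the affine chart.\<close>

inductive biform :: "nat \<Rightarrow> nat \<Rightarrow> (('k \<times> nat \<Rightarrow> 'a::field) \<times> (nat \<times> 'r \<Rightarrow> 'a) \<Rightarrow> 'a) \<Rightarrow> bool" for w where
  zero: "biform w n (\<lambda>p. 0)"
| mult: "homf (UNIV \<times> {..w}) n h \<Longrightarrow> pold ({..w} \<times> UNIV) n g \<Longrightarrow> biform w n (\<lambda>p. h (fst p) * g (snd p))"
| add: "biform w n f \<Longrightarrow> biform w n g \<Longrightarrow> biform w n (\<lambda>p. f p + g p)"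

lemma biform_sum: "(\<And>i. i \<in> I \<Longrightarrow> biform w n (f i)) \<Longrightarrow> biform w n (\<lambda>p. \<Sum>i\<in>I. f i p)"
  by (induction I rule: infinite_finite_induct) (auto intro: biform.zero biform.add)

lemma biform_coord_mult:
  "biform w n f \<Longrightarrow> l \<le> w \<Longrightarrow> biform w (Suc n) (\<lambda>p. fst p (a, l) * snd p (l, j) * f p)"
proof (induction rule: biform.induct)
  case (zero n) then show ?case using biform.zero[of w "Suc n"] by simp
next
  case (mult n h g)
  have "homf (UNIV \<times> {..w}) (Suc n) (\<lambda>x. x (a, l) * h x)" "pold ({..w} \<times> UNIV) (Suc n) (\<lambda>y. y (l, j) * g y)"
    using mult by (auto intro: homf.var pold.var)
  from biform.mult[OF this] show ?case by (simp add: mult_ac)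
next
  case (add n f g) then show ?case using biform.add[of w "Suc n"] by (simp add: distrib_left)
qed

lemma biform_mat_comb:
  fixes F :: "('k \<times> 'r \<Rightarrow> 'a::field) \<Rightarrow> 'a"
  shows "homf UNIV n F \<Longrightarrow> biform w n (\<lambda>p. F (mat_comb w (fst p) (snd p)))"
proof (induction rule: homf.induct)
  case (zero n) show ?case by (rule biform.zero)
next
  case (const c)
  from biform.mult[of w 0 "\<lambda>_. c" "\<lambda>_. 1"] show ?case by (simp add: homf.const pold.const)
next
  case (var n f v)
  obtain a j where v: "v = (a, j)" by (cases v)
  have "biform w (Suc n) (\<lambda>p. \<Sum>l\<le>w. fst p (a, l) * snd p (l, j) * f (mat_comb w (fst p) (snd p)))"
    by (intro biform_sum biform_coord_mult var.IH) simp
  moreover have "(\<Sum>l\<le>w. fst p (a, l) * snd p (l, j) * f (mat_comb w (fst p) (snd p))) =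
      mat_comb w (fst p) (snd p) v * f (mat_comb w (fst p) (snd p))" for p :: "('k \<times> nat \<Rightarrow> 'a) \<times> (nat \<times> 'r \<Rightarrow> 'a)"
    by (simp add: v mat_comb_def sum_distrib_right)
  ultimately show ?case by simp
next
  case (add n f g)
  from biform.add[OF add.IH] show ?case .
qed

lemma dimle_biform:
  fixes V :: "(nat \<times> 'r \<Rightarrow> 'a::field) set"
  assumes "dimle (UNIV :: ('k \<times> nat \<Rightarrow> 'a) set) (homf (UNIV \<times> {..w}) n) N1" "dimle V (pold ({..w} \<times> UNIV) n) N2"
  shows "dimle ((UNIV :: ('k \<times> nat \<Rightarrow> 'a) set) \<times> V) (biform w n) (N1 * N2)"
proof -
  obtain G1 where G1: "finite G1" "card G1 \<le> N1"
    "\<And>f. homf (UNIV \<times> {..w}) n f \<Longrightarrow> \<exists>c. \<forall>x. f x = (\<Sum>g\<in>G1. c g * g (x :: 'k \<times> nat \<Rightarrow> 'a))"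
    using assms(1) unfolding dimle_def by auto
  obtain G2 where G2: "finite G2" "card G2 \<le> N2"
    "\<And>f. pold ({..w} \<times> UNIV) n f \<Longrightarrow> \<exists>c. \<forall>x\<in>V. f x = (\<Sum>g\<in>G2. c g * g x)"
    using assms(2) unfolding dimle_def by auto
  show ?thesis
  proof (rule dimleI[of "G1 \<times> G2" _ _ _ "\<lambda>(g1, g2) p. g1 (fst p) * g2 (snd p)"])
    show "card (G1 \<times> G2) \<le> N1 * N2" using G1(2) G2(2) by (simp add: card_cartesian_product mult_le_mono)
    fix f :: "('k \<times> nat \<Rightarrow> 'a) \<times> (nat \<times> 'r \<Rightarrow> 'a) \<Rightarrow> 'a" assume "biform w n f"
    then show "\<exists>c. \<forall>p\<in>UNIV \<times> V. f p = (\<Sum>g\<in>G1 \<times> G2. c g * (case g of (g1, g2) \<Rightarrow> \<lambda>p. g1 (fst p) * g2 (snd p)) p)"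
      using G1(3) G2(3)
    proof (induction rule: biform.induct)
      case (zero n) show ?case by (rule exI[of _ "\<lambda>_. 0"]) simp
    next
      case (mult n h g)
      obtain c where c: "\<forall>x. h x = (\<Sum>g\<in>G1. c g * g x)" using mult.prems(1)[OF mult.hyps(1)] by (elim exE)
      obtain d where d: "\<forall>x\<in>V. g x = (\<Sum>g\<in>G2. d g * g x)" using mult.prems(2)[OF mult.hyps(2)] by (elim exE)
      show ?case
      proof (rule exI[of _ "\<lambda>(g1, g2). c g1 * d g2"], rule ballI)
        fix p :: "('k \<times> nat \<Rightarrow> 'a) \<times> (nat \<times> 'r \<Rightarrow> 'a)" assume p: "p \<in> UNIV \<times> V"
        then have "snd p \<in> V" by auto
        have "h (fst p) * g (snd p) = (\<Sum>g1\<in>G1. c g1 * g1 (fst p)) * (\<Sum>g2\<in>G2. d g2 * g2 (snd p))"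
          by (rule arg_cong2[where f = times, OF c[rule_format] d[rule_format, OF \<open>snd p \<in> V\<close>]])
        also have "\<dots> = (\<Sum>(g1, g2)\<in>G1 \<times> G2. (c g1 * g1 (fst p)) * (d g2 * g2 (snd p)))"
          by (simp add: sum_product sum.cartesian_product)
        finally show "h (fst p) * g (snd p) = (\<Sum>g\<in>G1 \<times> G2. (case g of (g1, g2) \<Rightarrow> c g1 * d g2) *
            (case g of (g1, g2) \<Rightarrow> \<lambda>p. g1 (fst p) * g2 (snd p)) p)"
          by (simp add: split_beta mult_ac)
      qed
    next
      case (add n f g)
      from add.IH(1)[OF add.prems] obtain c where c: "\<forall>p\<in>UNIV \<times> V. f p = (\<Sum>g\<in>G1 \<times> G2. c g * (case g of (g1, g2) \<Rightarrow> \<lambda>p. g1 (fst p) * g2 (snd p)) p)" by blast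
      from add.IH(2)[OF add.prems] obtain d where d: "\<forall>p\<in>UNIV \<times> V. g p = (\<Sum>g\<in>G1 \<times> G2. d g * (case g of (g1, g2) \<Rightarrow> \<lambda>p. g1 (fst p) * g2 (snd p)) p)" by blast
      show ?case using c d
        by (intro exI[of _ "\<lambda>g. c g + d g"]) (simp add: distrib_right sum.distrib)
    qed
  qed (use G1(1) G2(1) in auto)
qed

locale segre_setup = secant_setup X s' w
  for X :: "('a::{alg_closed_field, field_char_0} ^ 'r::finite) set set" and s' w +
  fixes \<rho> :: "'k::finite \<Rightarrow> nat" and k :: nat
  assumes \<rho>: "bij_betw \<rho> UNIV {..k}" and w: "w = min k s'"
begin

definition config_mat :: "((nat \<times> nat) + (nat \<times> 'r) \<Rightarrow> 'a) \<Rightarrow> 'k \<times> 'r \<Rightarrow> 'a" where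
  "config_mat t = (\<lambda>(a, j). config_row s' t (\<rho> a) $ j)"

definition sec0 :: "('a ^ ('k \<times> 'r)) set set" where
  "sec0 = {Q \<in> proj_space. \<exists>S. S \<subseteq> segre X \<and> finite S \<and> card S = Suc s' \<and> Q \<subseteq> lin_span S}"

definition sec :: "('a ^ ('k \<times> 'r)) set set" where
  "sec = proj_zariski closure_of sec0"

lemma \<rho>_le: "\<rho> a \<le> k"
  using \<rho> unfolding bij_betw_def by auto

lemma inv_\<rho>: "inv_into UNIV \<rho> (\<rho> a) = a"
  using \<rho> unfolding bij_betw_def by (simp add: inv_f_f)

lemma \<rho>_inv: "l \<le> k \<Longrightarrow> \<rho> (inv_into UNIV \<rho> l) = l"
  using \<rho> unfolding bij_betw_def by (metis atMost_iff f_inv_into_f)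

text \<open>A point in the span of decomposable matrices is a combination of them; each coefficient
  is absorbed into the left vector, which becomes a column of the coefficient matrix.\<close>

lemma sec0_config:
  assumes "Q \<in> sec0" "Q = vec.span {\<chi> p. q p}"
  shows "\<exists>t\<in>configs. config_mat t = q"
proof -
  obtain S where S: "S \<subseteq> segre X" "finite S" "card S = Suc s'" "Q \<subseteq> lin_span S"
    using assms(1) unfolding sec0_def by blast
  obtain h where h: "bij_betw h {0..<Suc s'} S" using ex_bij_betw_nat_finite[OF S(2)] S(3) by auto
  then have im: "h ` {..s'} = S" by (auto simp: bij_betw_def lessThan_Suc_atMost[symmetric] atLeast0LessThan)
  have "\<forall>i. \<exists>lx. i \<le> s' \<longrightarrow> snd lx \<in> \<Union>X \<and> h i = vec.span {\<chi> p. fst lx $ fst p * snd lx $ snd p}"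
  proof (intro allI)
    fix i
    show "\<exists>lx. i \<le> s' \<longrightarrow> snd lx \<in> \<Union>X \<and> h i = vec.span {\<chi> p. fst lx $ fst p * snd lx $ snd p}"
    proof (cases "i \<le> s'")
      case True
      then have "h i \<in> segre X" using im S(1) by blast
      then obtain L P where LP: "L \<in> proj_space" "P \<in> X" "h i = segre_point L P" unfolding segre_def by auto
      obtain l where l: "L = vec.span {l}" using proj_space_generator[OF LP(1)] by blast
      have "P \<in> proj_space" using LP(2) X_sub by blast
      then obtain x where x: "P = vec.span {x}" by (rule proj_space_generator)
      have "x \<in> P" unfolding x by (intro vec.span_base) simp
      then show ?thesis using LP(2,3) segre_point_span[of l x] l x by (intro exI[of _ "(l, x)"]) auto
    qed simp
  qed
  from choice[OF this] obtain lx where lx: "\<And>i. i \<le> s' \<Longrightarrow> snd (lx i) \<in> \<Union>X"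
    "\<And>i. i \<le> s' \<Longrightarrow> h i = vec.span {\<chi> p. fst (lx i) $ fst p * snd (lx i) $ snd p}" by blast
  define z where "z i = (\<chi> p. fst (lx i) $ fst p * snd (lx i) $ snd p)" for i
  have "\<Union>S \<subseteq> vec.span (z ` {..s'})"
  proof
    fix v assume "v \<in> \<Union>S"
    then obtain i where i: "i \<le> s'" "v \<in> h i" using im by auto
    then have "v \<in> vec.span {z i}" using lx(2) unfolding z_def by simp
    moreover have "{z i} \<subseteq> z ` {..s'}" using i(1) by blast
    ultimately show "v \<in> vec.span (z ` {..s'})" using vec.span_mono by blast
  qed
  then have "lin_span S \<subseteq> vec.span (z ` {..s'})" unfolding lin_span_def by (intro vec.span_minimal) auto
  moreover have "(\<chi> p. q p) \<in> Q" unfolding assms(2) by (intro vec.span_base) simp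
  ultimately obtain c where c: "(\<chi> p. q p) = (\<Sum>i\<le>s'. c i *s z i)"
    using S(4) span_family[of "\<chi> p. q p" z s'] by blast
  define t :: "(nat \<times> nat) + (nat \<times> 'r) \<Rightarrow> 'a" where
    "t = (\<lambda>v. case v of Inl (l, i) \<Rightarrow> c i * fst (lx i) $ inv_into UNIV \<rho> l | Inr (i, j) \<Rightarrow> snd (lx i) $ j)"
  have "t \<in> configs" unfolding configs_def Xhat_def t_def using lx(1) by simp
  moreover have "config_mat t (a, j) = q (a, j)" for a j
  proof -
    have "q (a, j) = (\<chi> p. q p) $ (a, j)" by simp
    also have "\<dots> = (\<Sum>i\<le>s'. c i * (fst (lx i) $ a * snd (lx i) $ j))"
      unfolding c z_def by (simp add: sum_component)
    also have "\<dots> = config_mat t (a, j)"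
      unfolding config_mat_def config_row_def config_point_def
      by (simp add: t_def sum_component inv_\<rho> mult.assoc)
    finally show ?thesis by simp
  qed
  ultimately show ?thesis by (intro bexI[of _ t] ext) auto
qed

lemma config_sec0:
  assumes t: "t \<in> configs" and ind: "vec.dim (vec.span (config_point t ` {..s'})) = s' + 1"
    and Q: "vec.span {\<chi> p. config_mat t p} \<in> proj_space"
  shows "vec.span {\<chi> p. config_mat t p} \<in> sec0"
proof -
  let ?x = "config_point t"
  define lam :: "nat \<Rightarrow> 'a ^ 'k" where "lam i = (\<chi> a. t (Inl (\<rho> a, i)))" for i
  \<comment> \<open>A zero column gives no point of the Segre variety, but exactly
    \<open>Suc s'\<close> points are required; it is replaced by the all-ones vector, whose term
    then gets coefficient 0.\<close>
  define lam' where "lam' i = (if lam i = 0 then \<chi> a. 1 else lam i)" for i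
  define z :: "nat \<Rightarrow> 'a ^ ('k \<times> 'r)" where "z i = (\<chi> p. lam' i $ fst p * ?x i $ snd p)" for i
  define S where "S = (\<lambda>i. vec.span {z i}) ` {..s'}"
  have nz: "lam' i \<noteq> 0" for i unfolding lam'_def by (auto simp: Finite_Cartesian_Product.vec_eq_iff)
  have inj: "inj_on (\<lambda>i. vec.span {z i}) {..s'}"
  proof (rule inj_onI, rule ccontr)
    fix i j assume ij: "i \<in> {..s'}" "j \<in> {..s'}" "vec.span {z i} = vec.span {z j}" "i \<noteq> j"
    have "z i \<in> vec.span {z i}" by (intro vec.span_base) simp
    then have "z i \<in> vec.span {z j}" using ij(3) by simp
    then obtain c where c: "z i = c *s z j" unfolding vec.span_singleton by auto
    obtain a where a: "lam' i $ a \<noteq> 0" using nz[of i] by (auto simp: Finite_Cartesian_Product.vec_eq_iff)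
    \<comment> \<open>Equal points give proportional rank-one matrices; comparing the row
      \<open>a\<close> makes two vectors of the configuration proportional, against
      independence.\<close>
    have "?x i $ m = (c * lam' j $ a / lam' i $ a) * ?x j $ m" for m
    proof -
      have "z i $ (a, m) = c * z j $ (a, m)" using c by simp
      then show ?thesis using a unfolding z_def by (simp add: field_simps)
    qed
    then have "?x i = (c * lam' j $ a / lam' i $ a) *s ?x j" by (simp add: Finite_Cartesian_Product.vec_eq_iff)
    then have "?x i \<in> vec.span {?x j}" unfolding vec.span_singleton by blast
    then show False using independent_configE(2)[OF ind, of i j] ij by simp
  qed
  have "S \<subseteq> segre X"
  proof
    fix P assume "P \<in> S"
    then obtain i where i: "i \<le> s'" "P = vec.span {z i}" unfolding S_def by blast
    have "vec.span {?x i} \<in> X" using config_point_X[OF t i(1)] independent_configE(1)[OF ind i(1)] by blast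
    moreover have "vec.span {lam' i} \<in> proj_space" using nz proj_space_span_iff by blast
    moreover have "P = segre_point (vec.span {lam' i}) (vec.span {?x i})"
      unfolding i(2) z_def segre_point_span by simp
    ultimately show "P \<in> segre X" unfolding segre_def by blast
  qed
  moreover have "finite S" "card S = Suc s'" unfolding S_def using card_image[OF inj] by auto
  moreover have "vec.span {\<chi> p. config_mat t p} \<subseteq> lin_span S"
  proof -
    have "(\<chi> p. config_mat t p) = (\<Sum>i\<le>s'. (if lam i = 0 then 0 else 1) *s z i)"
    proof -
      have "config_row s' t (\<rho> a) $ j = (\<Sum>i\<le>s'. (if lam i = 0 then 0 else 1) * (lam' i $ a * ?x i $ j))" for a j
        unfolding config_row_def sum_component
      proof (rule sum.cong)
        fix i
        have "t (Inl (\<rho> a, i)) = lam i $ a" by (simp add: lam_def)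
        then show "(t (Inl (\<rho> a, i)) *s ?x i) $ j = (if lam i = 0 then 0 else 1) * (lam' i $ a * ?x i $ j)"
          by (simp add: lam'_def)
      qed simp
      then show ?thesis
        by (auto simp: Finite_Cartesian_Product.vec_eq_iff config_mat_def z_def sum_component)
    qed
    moreover have "z i \<in> vec.span (\<Union>S)" if "i \<le> s'" for i
      using that vec.span_base[of "z i" "{z i}"] unfolding S_def by (intro vec.span_base) auto
    ultimately have "(\<chi> p. config_mat t p) \<in> vec.span (\<Union>S)"
      by (simp only:) (intro vec.span_sum vec.span_scale; simp)
    then show ?thesis unfolding lin_span_def by (intro vec.span_minimal) auto
  qed
  ultimately show ?thesis using Q unfolding sec0_def by blast
qed

lemma sec0_sub: "sec0 \<subseteq> proj_space"
  unfolding sec0_def by blast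

lemma sec_sub: "sec \<subseteq> proj_space"
  unfolding sec_def using closure_of_subset_topspace[of proj_zariski sec0] unfolding proj.topspace .

lemma closedin_sec: "closedin proj_zariski sec"
  unfolding sec_def by simp

text \<open>For a generic configuration \<open>F\<close> is nonzero and the row space lies in the
  chart, so the matrix factors through the normalized frame of its row space.\<close>

lemma sec_dense:
  assumes J: "length J = Suc w" "chart J \<noteq> {}" and F: "homf UNIV n F" "\<exists>q\<in>pcone sec. F q \<noteq> 0"
  shows "\<exists>A. \<exists>y\<in>chart J. F (mat_comb w A y) \<noteq> 0"
proof -
  have fF: "form F" using F(1) unfolding form_def by blast
  obtain P where "P \<in> sec" "proj.nz F P" using F(2) proj_nz_iff_cone[OF sec_sub fF] by blast
  then obtain Q where Q: "Q \<in> sec0" "proj.nz F Q" using proj.closure_nz[OF fF] unfolding sec_def by blast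
  then obtain q where q: "Q = vec.span {\<chi> p. q p}" "F q \<noteq> 0" unfolding proj.nz_def proj_rep_def by blast
  obtain t1 where t1: "t1 \<in> configs" "config_mat t1 = q" using sec0_config[OF Q(1) q(1)] by blast
  obtain y where y: "y \<in> chart J" using J(2) by blast
  obtain t2 where t2: "t2 \<in> configs" "\<And>l. l \<le> w \<Longrightarrow> config_row s' t2 l = frame y l"
    using GS0_config[of "vec.span (frame y ` {..w})" "frame y"] y unfolding chart_def by blast
  have "plucker w (config_row s' t2) J = plucker w (frame y) J"
    by (auto simp: plucker_def t2(2) intro!: sum.cong prod.cong)
  then have p2: "plucker w (config_row s' t2) J \<noteq> 0"
    using plucker_unit_block(1)[OF J(1), of "frame y"] y unfolding chart_def by auto
  define f where "f i t = (if i then F (config_mat t) else plucker w (config_row s' t) J)" for i t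
  have "\<forall>v. homf UNIV 2 (\<lambda>t. config_mat t v)"
    unfolding config_mat_def using hom_config_row by (auto simp: split_beta)
  then have "homf UNIV (n * 2) (\<lambda>t. F (\<lambda>v. config_mat t v))" by (intro hom_subst[OF F(1)]) blast
  then have pT: "polf UNIV (f True)" unfolding f_def by (simp add: hom_polf)
  have pF: "polf UNIV (f False)" unfolding f_def using hom_polf[OF hom_plucker[OF hom_config_row]] by simp
  obtain t where t: "t \<in> configs" "\<And>i. i \<in> UNIV \<Longrightarrow> f i t \<noteq> 0"
    "vec.dim (vec.span (config_point t ` {..s'})) = s' + 1" "vec.span (config_row s' t ` {..w}) \<in> GS0"
  proof (rule generic_config[of "UNIV :: bool set" f])
    show "polf UNIV (f i)" for i using pT pF by (cases i) auto
    show "\<exists>t\<in>configs. f i t \<noteq> 0" for i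
      using t1 t2(1) p2 q(2) unfolding f_def by (cases i) auto
  qed auto
  let ?b = "config_row s' t"
  \<comment> \<open>The value of \<open>w\<close> enters here. If \<open>w = k\<close>, there are no
    rows beyond the first \<open>w + 1\<close>; if \<open>w = s'\<close>, these rows already span
    the whole span of the \<open>s' + 1\<close> points.\<close>
  have rows: "?b l \<in> vec.span (?b ` {..w})" if l: "l \<le> k" for l
  proof (cases "w = k")
    case True
    then show ?thesis using l by (intro vec.span_base) simp
  next
    case False
    then have ws: "w = s'" using w by auto
    have "vec.span (?b ` {..w}) \<subseteq> vec.span (config_point t ` {..s'})"
      by (rule vec.span_minimal) (use config_row_span in auto)
    moreover have "vec.dim (vec.span (?b ` {..w})) = s' + 1" using t(4) GS0_sub ws unfolding grassmannian_def by auto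
    ultimately have "vec.span (?b ` {..w}) = vec.span (config_point t ` {..s'})"
      using t(3) by (intro vec.subspace_dim_equal) auto
    then show ?thesis using config_row_span by simp
  qed
  have Ft: "F (config_mat t) \<noteq> 0" "plucker w ?b J \<noteq> 0" using t(2)[of True] t(2)[of False] unfolding f_def by auto
  note nf = normal_frame[OF Ft(2)]
  define y' where "y' = (\<lambda>(l, j). normal_frame w ?b J l $ j)"
  have fy: "frame y' = normal_frame w ?b J" unfolding y'_def by simp
  have "y' \<in> chart J" using nf t(4) by (simp add: chart_def fy)
  moreover have "config_mat t = mat_comb w (\<lambda>(a, l). ?b (\<rho> a) $ (J ! l)) y'"
  proof (rule ext, clarify)
    fix a j
    have "?b (\<rho> a) \<in> vec.span (normal_frame w ?b J ` {..w})" unfolding nf(2) by (rule rows[OF \<rho>_le])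
    from unit_block_coords[OF nf(1) this]
    have "?b (\<rho> a) $ j = (\<Sum>l\<le>w. ?b (\<rho> a) $ (J ! l) *s normal_frame w ?b J l) $ j" by simp
    then show "config_mat t (a, j) = mat_comb w (\<lambda>(a, l). ?b (\<rho> a) $ (J ! l)) y' (a, j)"
      unfolding config_mat_def mat_comb_def y'_def by (simp add: sum_component)
  qed
  ultimately show ?thesis using Ft(1) by metis
qed

text \<open>By density, forms independent on the secant variety stay independent on products
  \<open>A y\<close>. The \<open>(k + 1) * (w + 1)\<close> entries of \<open>A\<close> enter
  homogeneously and contribute their number minus one to the exponent; the chart contributes
  \<open>d\<close>.\<close>

lemma grow_sec:
  assumes J: "length J = Suc w" "chart J \<noteq> {}" and g: "pgrow (chart J) MV d"
  shows "grow UNIV (pcone sec) (d + (k + 1) * (w + 1) - 1)"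
proof -
  obtain C where C: "\<And>n. dimle (chart J) (pold MV n) (C * (n + 1) ^ d)" using g unfolding pgrow_def by blast
  define D where "D = (UNIV :: 'k set) \<times> {..w}"
  have ck: "CARD('k) = k + 1" using bij_betw_same_card[OF \<rho>] by simp
  have D: "finite D" "card D = (k + 1) * (w + 1)" unfolding D_def using ck by (auto simp: card_cartesian_product)
  obtain b where b: "b \<in> D" unfolding D_def by auto
  have "dimle (UNIV :: ('k \<times> nat \<Rightarrow> 'a) set) (homf D n) ((n + 1) ^ (card D - 1))" for n
    using dimle_homf[OF D(1), of UNIV b n] b D(1) by (simp add: insert_absorb)
  then have bf: "dimle (UNIV \<times> chart J) (biform w n :: (('k \<times> nat \<Rightarrow> 'a) \<times> (nat \<times> 'r \<Rightarrow> 'a) \<Rightarrow> 'a) \<Rightarrow> bool)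
      ((n + 1) ^ (card D - 1) * (C * (n + 1) ^ d))" for n
    unfolding D_def by (rule dimle_biform) (rule C)
  have "dimle (pcone sec) (homf UNIV n) (C * (n + 1) ^ (d + (k + 1) * (w + 1) - 1))" for n
  proof (rule dimle_of_indep_bound)
    fix h and q :: nat
    assume h: "\<And>i. i < q \<Longrightarrow> homf UNIV n (h i)" "indep_on (pcone sec) h {..<q}"
    have "card {..<q} \<le> (n + 1) ^ (card D - 1) * (C * (n + 1) ^ d)"
    proof (rule dimle_indep[OF bf, where h = "\<lambda>i p. h i (mat_comb w (fst p) (snd p))"])
      show "biform w n (\<lambda>p. h i (mat_comb w (fst p) (snd p)))" if "i \<in> {..<q}" for i
        using biform_mat_comb h(1) that by blast
      show "indep_on (UNIV \<times> chart J) (\<lambda>i p. h i (mat_comb w (fst p) (snd p))) {..<q}"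
        unfolding indep_on_def
      proof (intro allI impI)
        fix c assume c: "\<forall>x\<in>UNIV \<times> chart J. (\<Sum>i<q. c i * h i (mat_comb w (fst x) (snd x))) = 0"
        define F where "F = (\<lambda>x. \<Sum>i<q. c i * h i x)"
        have F: "homf UNIV n F" unfolding F_def using h(1) by (intro hom_sum hom_scale) auto
        have "F (mat_comb w A y) = 0" if "y \<in> chart J" for A y
          using c[rule_format, of "(A, y)"] that unfolding F_def by simp
        then have "\<forall>x\<in>pcone sec. F x = 0" using sec_dense[OF J F] by blast
        then show "\<forall>i\<in>{..<q}. c i = 0"
          using h(2)[unfolded indep_on_def, THEN spec, of c] unfolding F_def by simp
      qed
    qed simp
    also have "\<dots> = C * (n + 1) ^ (d + (k + 1) * (w + 1) - 1)"
    proof -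
      have "card D - 1 + d = d + (k + 1) * (w + 1) - 1" unfolding D(2) by simp
      then show ?thesis by (metis mult.left_commute power_add)
    qed
    finally show "q \<le> C * (n + 1) ^ (d + (k + 1) * (w + 1) - 1)" by simp
  qed
  then show ?thesis unfolding grow_def by blast
qed

end

section \<open>Chains in the secant variety\<close>

lemma vec_nonzero_coord: "(\<chi> p. q p) \<noteq> (0 :: 'a::zero ^ 'n::finite) \<longleftrightarrow> (\<exists>p. q p \<noteq> 0)"
  by (auto simp: Finite_Cartesian_Product.vec_eq_iff)

definition rows_in :: "('k \<times> 'r \<Rightarrow> 'a) \<Rightarrow> ('a ^ 'r) set \<Rightarrow> bool" where
  "rows_in q L \<longleftrightarrow> (\<forall>a. (\<chi> j. q (a, j)) \<in> L)"

definition proj_of :: "('n \<Rightarrow> 'a::field) set \<Rightarrow> ('a ^ 'n) set set" where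
  "proj_of W = {vec.span {\<chi> p. q p} | q. q \<in> W \<and> (\<chi> p. q p) \<noteq> 0}"

lemma proj_of_sub: "proj_of W \<subseteq> (proj_space :: ('a::field ^ 'n::finite) set set)"
  unfolding proj_of_def using proj_space_span_iff by blast

lemma proj_of_mono: "W \<subseteq> W' \<Longrightarrow> proj_of W \<subseteq> proj_of W'"
  unfolding proj_of_def by blast

lemma proj_nz_span:
  fixes q :: "'n::finite \<Rightarrow> 'a::field"
  assumes "form h" "(\<chi> p. q p) \<noteq> 0"
  shows "proj.nz h (vec.span {\<chi> p. q p}) \<longleftrightarrow> h q \<noteq> 0"
  by (rule proj.nz_iff[OF assms(1)]) (use assms(2) proj_space_span_iff in \<open>auto simp: proj_rep_def\<close>)

lemma proj_ofE:
  assumes "P \<in> proj_of W" obtains q where "q \<in> W" "(\<chi> p. q p) \<noteq> 0" "P = vec.span {\<chi> p. q p}"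
  using assms unfolding proj_of_def by blast

text \<open>A coordinate that is nonzero at \<open>q0\<close> is added to the forms, so that the
  vector found is nonzero and spans a projective point.\<close>

lemma common_nonzero:
  fixes W :: "('n::finite \<Rightarrow> 'a::field_char_0) set"
  assumes line: "\<And>x y t. x \<in> W \<Longrightarrow> y \<in> W \<Longrightarrow> (\<lambda>v. x v + t * (y v - x v)) \<in> W"
    and ne: "q0 \<in> W" "(\<chi> p. q0 p) \<noteq> 0"
    and H: "finite H" "\<And>h. h \<in> H \<Longrightarrow> form h" "\<And>h. h \<in> H \<Longrightarrow> \<exists>q\<in>W. h q \<noteq> 0"
  shows "\<exists>P\<in>proj_of W. \<forall>h\<in>H. proj.nz h P"
proof -
  obtain p0 where p0: "q0 p0 \<noteq> 0" using ne(2) vec_nonzero_coord by blast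
  have W: "pirr UNIV W" by (rule pirr_affine_closed) (use ne(1) line in auto)
  have "\<exists>q\<in>W. (\<Prod>h\<in>H. h q) \<noteq> 0" by (rule pirr_finite[OF W H(1)]) (use H form_polf in auto)
  moreover have "polf UNIV (\<lambda>q. \<Prod>h\<in>H. h q)" using H form_polf by (intro polf_prod) auto
  moreover have "polf UNIV (\<lambda>q. q p0)" by (rule polf_coord) simp
  moreover have "\<exists>q\<in>W. q p0 \<noteq> 0" using ne(1) p0 by blast
  ultimately have "\<exists>q\<in>W. (\<Prod>h\<in>H. h q) * q p0 \<noteq> 0" using pirrD[OF W] by blast
  then obtain q where q: "q \<in> W" "(\<Prod>h\<in>H. h q) \<noteq> 0" "q p0 \<noteq> 0" by auto
  then have nz: "(\<chi> p. q p) \<noteq> 0" using vec_nonzero_coord by blast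
  have "h q \<noteq> 0" if "h \<in> H" for h using q(2) H(1) that by (simp add: prod_zero_iff)
  then have "\<forall>h\<in>H. proj.nz h (vec.span {\<chi> p. q p})" using proj_nz_span[OF H(2) nz] by blast
  then show ?thesis using q(1) nz unfolding proj_of_def by blast
qed

lemma irreducible_proj_of:
  fixes W :: "('n::finite \<Rightarrow> 'a::field_char_0) set"
  assumes line: "\<And>x y t. x \<in> W \<Longrightarrow> y \<in> W \<Longrightarrow> (\<lambda>v. x v + t * (y v - x v)) \<in> W"
    and ne: "q0 \<in> W" "(\<chi> p. q0 p) \<noteq> 0"
  shows "irreducible_in proj_zariski (proj_zariski closure_of proj_of W)"
proof (rule proj.irreducible_closure[OF proj_of_sub])
  show "proj_of W \<noteq> {}" using ne unfolding proj_of_def by blast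
  fix H assume H: "finite H" "\<And>h. h \<in> H \<Longrightarrow> form h \<and> (\<exists>p\<in>proj_of W. proj.nz h p)"
  show "\<exists>p\<in>proj_of W. \<forall>h\<in>H. proj.nz h p"
  proof (rule common_nonzero[OF line ne H(1)])
    fix h assume h: "h \<in> H"
    show "form h" using H(2)[OF h] by blast
    obtain P where P: "P \<in> proj_of W" "proj.nz h P" using H(2)[OF h] by blast
    obtain q where "q \<in> W" "(\<chi> p. q p) \<noteq> 0" "P = vec.span {\<chi> p. q p}" by (rule proj_ofE[OF P(1)])
    then show "\<exists>q\<in>W. h q \<noteq> 0" using proj_nz_span[OF \<open>form h\<close>, of q] P(2) by blast
  qed
qed

lemma rows_in_line:
  assumes "vec.subspace L" "rows_in x L" "rows_in y L"
  shows "rows_in (\<lambda>v. x v + t * (y v - x v)) L"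
  unfolding rows_in_def
proof
  fix a
  have "(\<chi> j. x (a, j)) + t *s ((\<chi> j. y (a, j)) - (\<chi> j. x (a, j))) \<in> L"
    using assms unfolding rows_in_def
    by (intro vec.subspace_add vec.subspace_scale vec.subspace_diff) auto
  moreover have "(\<chi> j. x (a, j)) + t *s ((\<chi> j. y (a, j)) - (\<chi> j. x (a, j))) = (\<chi> j. x (a, j) + t * (y (a, j) - x (a, j)))"
    by (simp add: Finite_Cartesian_Product.vec_eq_iff right_diff_distrib)
  ultimately show "(\<chi> j. x (a, j) + t * (y (a, j) - x (a, j))) \<in> L" by simp
qed

text \<open>
  In the chart \<open>J\<close> a matrix with rows in \<open>L\<close> is the product of its \<open>J\<close>-columns with the normalized
  frame of \<open>L\<close>; keeping the first factor fixed and varying \<open>L\<close> turns a form on matrices into a form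
  in the Pluecker coordinates.
\<close>

lemma form_transfer:
  fixes F :: "('k::finite \<times> 'r::finite \<Rightarrow> 'a::field) \<Rightarrow> 'a"
  assumes F: "form F" and L: "L \<in> grassmannian w" and q: "rows_in q L" "F q \<noteq> 0"
  shows "\<exists>G. form G \<and> grass.nz w G L \<and>
     (\<forall>L'\<in>grassmannian w. grass.nz w G L' \<longrightarrow> (\<exists>q'. rows_in q' L' \<and> F q' \<noteq> 0))"
proof -
  obtain n where n: "homf UNIV n F" using F unfolding form_def by blast
  obtain b where b: "L = vec.span (b ` {..w})" using grassmannian_family[OF L] by blast
  obtain J where J: "plucker w b J \<noteq> 0" using L span_family_in_grassmannian[of b w] b by auto
  define A where "A = (\<lambda>(a, l). q (a, J ! l))"
  define Q where "Q p = (\<lambda>(a, j). \<Sum>l\<le>w. A (a, l) * p (J[l := j]))" for p :: "'r list \<Rightarrow> 'a"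
  \<comment> \<open>On Pluecker coordinates \<open>Q p\<close> is the product matrix scaled by
    \<open>p J\<close>, which clears the denominators of the normalized frame. The extra factor
    \<open>p J\<close> confines the nonvanishing of \<open>G\<close> to the chart.\<close>
  define G where "G p = p J * F (Q p)" for p
  define N where "N b = (\<lambda>(l, j). normal_frame w b J l $ j)" for b :: "nat \<Rightarrow> 'a ^ 'r"
  have "homf UNIV 1 (\<lambda>p. Q p v)" for v
    unfolding Q_def by (cases v) (auto intro!: hom_sum hom_scale hom_coord simp del: One_nat_def)
  then have "homf UNIV (n * 1) (\<lambda>p. F (\<lambda>v. Q p v))" by (intro hom_subst[OF n])
  then have G: "form G" unfolding G_def by (intro form_mult form_coord) (auto simp: form_def)
  have Qp: "F (Q (plucker w b')) = plucker w b' J ^ n * F (mat_comb w A (N b'))" if "plucker w b' J \<noteq> 0" for b'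
  proof -
    have "Q (plucker w b') = (\<lambda>v. plucker w b' J * mat_comb w A (N b') v)"
      using that unfolding Q_def mat_comb_def N_def
      by (auto simp: fun_eq_iff normal_frame_def sum_distrib_left)
    then show ?thesis using hom_homog[OF n] by simp
  qed
  have row: "(\<chi> j. mat_comb w A (N b') (a, j)) = (\<Sum>l\<le>w. A (a, l) *s normal_frame w b' J l)" for a b'
    by (simp add: Finite_Cartesian_Product.vec_eq_iff mat_comb_def N_def sum_component)
  have "mat_comb w A (N b) = q"
  proof (rule ext, clarify)
    fix a j
    have "(\<chi> j. q (a, j)) \<in> vec.span (normal_frame w b J ` {..w})"
      using q(1) unfolding normal_frame(2)[OF J] b rows_in_def by blast
    from unit_block_coords[OF normal_frame(1)[OF J] this]
    have "(\<chi> j. q (a, j)) = (\<Sum>l\<le>w. A (a, l) *s normal_frame w b J l)" by (simp add: A_def)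
    then have "(\<chi> j. mat_comb w A (N b) (a, j)) = (\<chi> j. q (a, j))" unfolding row by simp
    then show "mat_comb w A (N b) (a, j) = q (a, j)" by (simp add: Finite_Cartesian_Product.vec_eq_iff)
  qed
  then have "G (plucker w b) \<noteq> 0" unfolding G_def using Qp[OF J] J q(2) by simp
  then have "grass.nz w G L" using grass_nz_frame[OF G, of b w] L b by simp
  moreover have "\<exists>q'. rows_in q' L' \<and> F q' \<noteq> 0" if L': "L' \<in> grassmannian w" "grass.nz w G L'" for L'
  proof -
    obtain b' where b': "L' = vec.span (b' ` {..w})" using grassmannian_family[OF L'(1)] by blast
    have "G (plucker w b') \<noteq> 0" using grass_nz_frame[OF G, of b' w] L' b' by simp
    then have nz: "plucker w b' J \<noteq> 0" "F (Q (plucker w b')) \<noteq> 0" unfolding G_def by auto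
    then have "F (mat_comb w A (N b')) \<noteq> 0" using Qp[OF nz(1)] by auto
    moreover have "rows_in (mat_comb w A (N b')) L'"
      unfolding rows_in_def row b' normal_frame(2)[OF nz(1), symmetric]
      by (intro allI vec.span_sum vec.span_scale vec.span_base imageI)
    ultimately show ?thesis by blast
  qed
  ultimately show ?thesis using G by blast
qed

definition rows_proj :: "('a::field ^ 'r) set set \<Rightarrow> ('a ^ ('k::finite \<times> 'r::finite)) set set" where
  "rows_proj C = proj_of {q. \<exists>L\<in>C. rows_in q L}"

lemma rows_projE:
  assumes "P \<in> rows_proj C"
  obtains q L where "L \<in> C" "rows_in q L" "(\<chi> p. q p) \<noteq> 0" "P = vec.span {\<chi> p. q p}"
  using assms unfolding rows_proj_def by (elim proj_ofE) blast

lemma rows_in_nonzero: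
  fixes L :: "('a::field ^ 'r::finite) set"
  assumes "L \<in> grassmannian w"
  obtains q :: "'k::finite \<times> 'r \<Rightarrow> 'a" where "rows_in q L" "(\<chi> p. q p) \<noteq> 0"
proof -
  have "\<not> L \<subseteq> {0}" using assms vec.dim_eq_0[of L] unfolding grassmannian_def by auto
  then obtain v where v: "v \<in> L" "v \<noteq> 0" by blast
  then obtain j where "v $ j \<noteq> 0" by (auto simp: Finite_Cartesian_Product.vec_eq_iff)
  then have "(\<chi> p. (\<lambda>(a :: 'k, j). v $ j) p) \<noteq> 0" unfolding vec_nonzero_coord by auto
  moreover have "rows_in (\<lambda>(a :: 'k, j). v $ j) L" unfolding rows_in_def using v(1) by simp
  ultimately show thesis using that by blast
qed

text \<open>A family of linear spaces over an irreducible base: the forms are transferred to the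
  base, a generic \<open>L\<close> is chosen there, and then a generic matrix with rows in that
  \<open>L\<close>.\<close>

lemma irreducible_rows_proj:
  fixes C :: "('a::field_char_0 ^ 'r::finite) set set"
  assumes C: "irreducible_in (grass_zariski w) C"
  shows "irreducible_in proj_zariski (proj_zariski closure_of (rows_proj C :: ('a ^ ('k::finite \<times> 'r)) set set))"
proof (rule proj.irreducible_closure)
  have CG: "C \<subseteq> grassmannian w" "C \<noteq> {}" using C unfolding irreducible_in_def grass.topspace by auto
  show "(rows_proj C :: ('a ^ ('k \<times> 'r)) set set) \<subseteq> proj_space" unfolding rows_proj_def by (rule proj_of_sub)
  obtain L where L: "L \<in> C" using CG by blast
  obtain q :: "'k \<times> 'r \<Rightarrow> 'a" where "rows_in q L" "(\<chi> p. q p) \<noteq> 0" using rows_in_nonzero CG(1) L by blast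
  then show "(rows_proj C :: ('a ^ ('k \<times> 'r)) set set) \<noteq> {}" using L unfolding rows_proj_def proj_of_def by blast
  fix H :: "(('k \<times> 'r \<Rightarrow> 'a) \<Rightarrow> 'a) set"
  assume H: "finite H" "\<And>h. h \<in> H \<Longrightarrow> form h \<and> (\<exists>P\<in>rows_proj C. proj.nz h P)"
  have "\<forall>h. \<exists>G. h \<in> H \<longrightarrow> form G \<and> (\<exists>L\<in>C. grass.nz w G L) \<and>
     (\<forall>L'\<in>grassmannian w. grass.nz w G L' \<longrightarrow> (\<exists>q'. rows_in q' L' \<and> h q' \<noteq> 0))"
  proof
    fix h
    show "\<exists>G. h \<in> H \<longrightarrow> form G \<and> (\<exists>L\<in>C. grass.nz w G L) \<and>
     (\<forall>L'\<in>grassmannian w. grass.nz w G L' \<longrightarrow> (\<exists>q'. rows_in q' L' \<and> h q' \<noteq> 0))"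
    proof (cases "h \<in> H")
      case True
      obtain P where P: "P \<in> rows_proj C" "proj.nz h P" using H(2)[OF True] by blast
      obtain q L where q: "L \<in> C" "rows_in q L" "(\<chi> p. q p) \<noteq> 0" "P = vec.span {\<chi> p. q p}"
        by (rule rows_projE[OF P(1)])
      have "h q \<noteq> 0" using proj_nz_span[OF _ q(3), of h] P(2) H(2)[OF True] q(4) by blast
      then show ?thesis using form_transfer[of h L w q] H(2)[OF True] q(1,2) CG(1) by blast
    qed blast
  qed
  from choice[OF this] obtain G where G: "\<And>h. h \<in> H \<Longrightarrow> form (G h)" "\<And>h. h \<in> H \<Longrightarrow> \<exists>L\<in>C. grass.nz w (G h) L"
    "\<And>h L'. h \<in> H \<Longrightarrow> L' \<in> grassmannian w \<Longrightarrow> grass.nz w (G h) L' \<Longrightarrow> \<exists>q'. rows_in q' L' \<and> h q' \<noteq> 0" by blast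
  have "\<exists>L\<in>C. \<forall>g\<in>G ` H. grass.nz w g L"
    by (rule grass.irreducible_nz[OF C]) (use H(1) G in auto)
  then obtain L where L: "L \<in> C" "\<And>h. h \<in> H \<Longrightarrow> grass.nz w (G h) L" by blast
  have Lg: "L \<in> grassmannian w" using L(1) CG(1) by blast
  then have sub: "vec.subspace L" unfolding grassmannian_def by blast
  obtain q0 :: "'k \<times> 'r \<Rightarrow> 'a" where q0: "rows_in q0 L" "(\<chi> p. q0 p) \<noteq> 0" using rows_in_nonzero[OF Lg] by blast
  have "\<exists>P\<in>proj_of {q. rows_in q L}. \<forall>h\<in>H. proj.nz h P"
  proof (rule common_nonzero[of _ q0])
    fix x y :: "'k \<times> 'r \<Rightarrow> 'a" and t
    assume "x \<in> {q. rows_in q L}" "y \<in> {q. rows_in q L}"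
    then show "(\<lambda>v. x v + t * (y v - x v)) \<in> {q. rows_in q L}" using rows_in_line[OF sub] by blast
  next
    show "\<exists>q\<in>{q. rows_in q L}. h q \<noteq> 0" if "h \<in> H" for h using G(3)[OF that Lg L(2)[OF that]] by blast
  qed (use H q0 in auto)
  moreover have "proj_of {q. rows_in q L} \<subseteq> (rows_proj C :: ('a ^ ('k \<times> 'r)) set set)"
    unfolding rows_proj_def by (rule proj_of_mono) (use L(1) in blast)
  ultimately show "\<exists>P\<in>rows_proj C. \<forall>h\<in>H. proj.nz h P" by blast
qed

context segre_setup
begin

text \<open>All rows are combinations of the \<open>s' + 1\<close> independent vectors whose span
  contains \<open>L\<close>; their coefficients give a configuration with the same vectors.\<close>

lemma rows_in_sec0:
  assumes L: "L \<in> GS0" and q: "rows_in q L" "(\<chi> p. q p) \<noteq> 0"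
  shows "vec.span {\<chi> p. q p} \<in> sec0"
proof -
  obtain b where b: "L = vec.span (b ` {..w})" using L GS0_sub grassmannian_family by blast
  obtain t0 where t0: "t0 \<in> configs" "\<And>l. l \<le> w \<Longrightarrow> config_row s' t0 l = b l"
    "vec.dim (vec.span (config_point t0 ` {..s'})) = s' + 1" by (rule GS0_config[OF L b]) blast
  have "b ` {..w} \<subseteq> vec.span (config_point t0 ` {..s'})"
  proof
    fix v assume "v \<in> b ` {..w}"
    then obtain l where "l \<le> w" "v = b l" by auto
    then show "v \<in> vec.span (config_point t0 ` {..s'})" using config_row_span[of t0 l] t0(2) by simp
  qed
  then have Ls: "L \<subseteq> vec.span (config_point t0 ` {..s'})" unfolding b by (intro vec.span_minimal) auto
  have "\<forall>a. \<exists>c. (\<chi> j. q (a, j)) = (\<Sum>i\<le>s'. c i *s config_point t0 i)"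
  proof
    fix a
    have "(\<chi> j. q (a, j)) \<in> vec.span (config_point t0 ` {..s'})" using q(1) Ls unfolding rows_in_def by blast
    then show "\<exists>c. (\<chi> j. q (a, j)) = (\<Sum>i\<le>s'. c i *s config_point t0 i)" unfolding span_family .
  qed
  from choice[OF this] obtain c where c: "\<And>a. (\<chi> j. q (a, j)) = (\<Sum>i\<le>s'. c a i *s config_point t0 i)" by blast
  define t :: "(nat \<times> nat) + (nat \<times> 'r) \<Rightarrow> 'a" where
    "t = (\<lambda>v. case v of Inl (l, i) \<Rightarrow> c (inv_into UNIV \<rho> l) i | Inr p \<Rightarrow> t0 (Inr p))"
  have cp: "config_point t = config_point t0" by (rule ext) (simp add: config_point_def t_def)
  have "t \<in> configs" using t0(1) unfolding configs_def t_def by simp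
  moreover have "config_mat t = q"
  proof (rule ext, clarify)
    fix a j
    have "config_row s' t (\<rho> a) = (\<chi> j. q (a, j))"
      unfolding config_row_def cp c by (simp add: t_def inv_\<rho>)
    then show "config_mat t (a, j) = q (a, j)" unfolding config_mat_def by simp
  qed
  ultimately show ?thesis
    using config_sec0[of t] t0(3) q(2) proj_space_span_iff unfolding cp by blast
qed

lemma GS_sub: "GS \<subseteq> grassmannian w"
  unfolding GS_def using closure_of_subset_topspace[of "grass_zariski w" GS0] unfolding grass.topspace .

lemma closedin_GS: "closedin (grass_zariski w) GS"
  unfolding GS_def by simp

text \<open>A nonvanishing condition at a matrix over \<open>L\<close> becomes one at
  \<open>L\<close> by \<open>form_transfer\<close>, hence holds at some \<open>L'\<close> in
  \<open>GS0\<close>, and returns to a matrix over \<open>L'\<close>.\<close>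

lemma rows_proj_sec:
  assumes "C \<subseteq> GS" shows "rows_proj C \<subseteq> sec"
proof
  fix P :: "('a ^ ('k \<times> 'r)) set" assume "P \<in> rows_proj C"
  then obtain q L where q: "L \<in> C" "rows_in q L" "(\<chi> p. q p) \<noteq> 0" "P = vec.span {\<chi> p. q p}"
    by (rule rows_projE)
  have LGS: "L \<in> GS" using q(1) assms by blast
  show "P \<in> sec" unfolding sec_def
  proof (rule proj.in_closure)
    show "P \<in> proj_space" using q proj_space_span_iff by blast
    fix H assume H: "finite H" "\<And>h. h \<in> H \<Longrightarrow> form h \<and> proj.nz h P"
    obtain p0 where p0: "q p0 \<noteq> 0" using q(3) vec_nonzero_coord by blast
    \<comment> \<open>The factor \<open>x p0\<close> keeps the matrix found over \<open>L'\<close>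
      nonzero.\<close>
    define F where "F x = x p0 * (\<Prod>h\<in>H. h x)" for x
    have F: "form F" unfolding F_def by (intro form_mult form_coord form_prod) (use H in auto)
    have "h q \<noteq> 0" if "h \<in> H" for h using H(2)[OF that] proj_nz_span[OF _ q(3), of h] q(4) by blast
    then have "F q \<noteq> 0" unfolding F_def using p0 H(1) by (simp add: prod_zero_iff)
    then obtain G where G: "form G" "grass.nz w G L"
      "\<And>L'. L' \<in> grassmannian w \<Longrightarrow> grass.nz w G L' \<Longrightarrow> \<exists>q'. rows_in q' L' \<and> F q' \<noteq> 0"
      using form_transfer[OF F _ q(2), of w] LGS GS_sub by blast
    obtain L' where L': "L' \<in> GS0" "grass.nz w G L'" using grass.closure_nz[OF G(1,2)] LGS unfolding GS_def by blast
    then obtain q' where q': "rows_in q' L'" "F q' \<noteq> 0" using G(3) GS0_sub by blast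
    then have nz: "(\<chi> p. q' p) \<noteq> 0" unfolding F_def vec_nonzero_coord by (intro exI[of _ p0]) auto
    have "h q' \<noteq> 0" if "h \<in> H" for h using q'(2) that H(1) unfolding F_def by (auto simp: prod_zero_iff)
    then have "\<forall>h\<in>H. proj.nz h (vec.span {\<chi> p. q' p})" using H(2) proj_nz_span[OF _ nz] by blast
    moreover have "vec.span {\<chi> p. q' p} \<in> sec0" by (rule rows_in_sec0[OF L'(1) q'(1) nz])
    ultimately show "\<exists>Q\<in>sec0. Q \<in> proj_space \<and> (\<forall>h\<in>H. proj.nz h Q)" using sec0_sub by blast
  qed
qed

text \<open>A form \<open>G\<close> separating some \<open>L\<close> from \<open>C\<close> is
  applied to the Pluecker coordinates of the first \<open>w + 1\<close> rows, which exist as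
  \<open>w \<le> k\<close>. For rows in a member of \<open>C\<close> these are a multiple, possibly
  zero, of its coordinates, so the result vanishes.\<close>

lemma rows_proj_strict:
  assumes C: "closedin (grass_zariski w) C" "irreducible_in (grass_zariski w) C"
    and C': "C \<subset> C'" "C' \<subseteq> grassmannian w"
  shows "proj_zariski closure_of (rows_proj C :: ('a ^ ('k \<times> 'r)) set set) \<subset> proj_zariski closure_of rows_proj C'"
proof -
  obtain L where L: "L \<in> C'" "L \<notin> C" using C'(1) by blast
  have Lg: "L \<in> grassmannian w" using L(1) C'(2) by blast
  obtain G where G: "form G" "grass.nz w G L" "\<forall>L'\<in>C. \<not> grass.nz w G L'"
    using grass.closed_separate[OF C Lg L(2)] by blast
  obtain n where n: "homf UNIV n G" using G(1) unfolding form_def by blast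
  define sel :: "('k \<times> 'r \<Rightarrow> 'a) \<Rightarrow> nat \<Rightarrow> 'a ^ 'r" where "sel q l = (\<chi> j. q (inv_into UNIV \<rho> l, j))" for q l
  define F where "F q = G (plucker w (sel q))" for q
  have "homf UNIV (Suc w * 1) (\<lambda>q. plucker w (sel q) J)" for J
    by (rule hom_plucker) (simp add: sel_def hom_coord del: One_nat_def)
  then have "homf UNIV (n * (Suc w * 1)) (\<lambda>q. G (\<lambda>J. plucker w (sel q) J))" by (intro hom_subst[OF n])
  then have F: "form F" unfolding F_def form_def by (rule exI)
  obtain b where b: "L = vec.span (b ` {..w})" using grassmannian_family[OF Lg] by blast
  have Gb: "G (plucker w b) \<noteq> 0" using grass_nz_frame[OF G(1), of b w] Lg G(2) b by simp
  define q where "q = (\<lambda>(a, j). if \<rho> a \<le> w then b (\<rho> a) $ j else 0)"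
  have rq: "rows_in q L" unfolding rows_in_def
  proof
    fix a
    show "(\<chi> j. q (a, j)) \<in> L"
    proof (cases "\<rho> a \<le> w")
      case True
      then have "(\<chi> j. q (a, j)) = b (\<rho> a)" by (simp add: q_def)
      then show ?thesis unfolding b using True by (auto intro: vec.span_base)
    next
      case False
      then have "(\<chi> j. q (a, j)) = 0" by (simp add: q_def Finite_Cartesian_Product.vec_eq_iff)
      then show ?thesis unfolding b by (simp add: vec.span_zero)
    qed
  qed
  have sq: "sel q l = b l" if "l \<le> w" for l
    using that w \<rho>_inv[of l] by (simp add: sel_def q_def)
  have "plucker w (sel q) = plucker w b"
    by (rule ext) (auto simp: plucker_def sq intro!: sum.cong prod.cong)
  then have Fq: "F q \<noteq> 0" using Gb unfolding F_def by simp
  obtain J where J: "plucker w b J \<noteq> 0" using Lg span_family_in_grassmannian[of b w] b by auto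
  have "(\<chi> p. q p) \<noteq> 0"
  proof
    assume z: "(\<chi> p. q p) = 0"
    have "sel q l = 0" for l
      using z unfolding sel_def by (simp add: Finite_Cartesian_Product.vec_eq_iff)
    then have "b 0 = 0" using sq[of 0] by simp
    then have "\<not> (\<forall>c. (\<Sum>l\<le>w. c l *s b l) = 0 \<longrightarrow> (\<forall>l\<le>w. c l = 0))"
      by (auto intro!: exI[of _ "\<lambda>l. if l = 0 then 1 else 0"] sum.neutral)
    then show False using plucker_nonzero_independent[OF J] dim_span_family by blast
  qed
  note qnz = this
  show ?thesis
  proof (rule proj.closure_strict[of _ _ F "vec.span {\<chi> p. q p}"])
    show "(rows_proj C :: ('a ^ ('k \<times> 'r)) set set) \<subseteq> rows_proj C'"
      unfolding rows_proj_def by (rule proj_of_mono) (use C'(1) in blast)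
    show "(rows_proj C' :: ('a ^ ('k \<times> 'r)) set set) \<subseteq> proj_space" unfolding rows_proj_def by (rule proj_of_sub)
    show "form F" by (rule F)
    show "vec.span {\<chi> p. q p} \<in> rows_proj C'" unfolding rows_proj_def proj_of_def using rq qnz L(1) by blast
    show "proj.nz F (vec.span {\<chi> p. q p})" using proj_nz_span[OF F qnz] Fq by blast
    fix P :: "('a ^ ('k \<times> 'r)) set" assume "P \<in> rows_proj C"
    then obtain q' L' where q': "L' \<in> C" "rows_in q' L'" "(\<chi> p. q' p) \<noteq> 0" "P = vec.span {\<chi> p. q' p}"
      by (rule rows_projE)
    have Lg': "L' \<in> grassmannian w" using q'(1) C' by blast
    obtain b' where b': "L' = vec.span (b' ` {..w})" using grassmannian_family[OF Lg'] by blast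
    have "sel q' ` {..w} \<subseteq> vec.span (b' ` {..w})" using q'(2) unfolding b' sel_def rows_in_def by blast
    then obtain \<delta> where "\<And>J. plucker w (sel q') J = \<delta> * plucker w b' J" using plucker_eq_scaled by blast
    then have "plucker w (sel q') = (\<lambda>J. \<delta> * plucker w b' J)" by (rule ext)
    then have "F q' = \<delta> ^ n * G (plucker w b')" unfolding F_def using hom_homog[OF n] by simp
    moreover have "G (plucker w b') = 0" using grass_nz_frame[OF G(1), of b' w] Lg' G(3) q'(1) b' by auto
    ultimately show "\<not> proj.nz F P" using proj_nz_span[OF F q'(3)] q'(4) by simp
  qed
qed

text \<open>By a normalized frame, a matrix with rows in \<open>L\<close> is determined by its
  entries in the columns \<open>J\<close>, which can be arbitrary: these are \<open>c\<close> linear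
  coordinates. In \<open>W m\<close> only the first \<open>m\<close> of them may be nonzero, and
  \<open>z m\<close> is the basis matrix for the coordinate \<open>m\<close>.\<close>

lemma linear_flag:
  assumes L: "L \<in> grassmannian w" and c: "c = (k + 1) * (w + 1)"
  obtains W :: "nat \<Rightarrow> ('k \<times> 'r \<Rightarrow> 'a) set" and g :: "nat \<Rightarrow> ('k \<times> 'r \<Rightarrow> 'a) \<Rightarrow> 'a" and z
  where "\<And>m q. q \<in> W m \<Longrightarrow> rows_in q L" "\<And>m. W m \<subseteq> W (Suc m)"
    "\<And>m x y t. x \<in> W m \<Longrightarrow> y \<in> W m \<Longrightarrow> (\<lambda>v. x v + t * (y v - x v)) \<in> W m"
    "\<And>m. form (g m)" "\<And>m q. m < c \<Longrightarrow> q \<in> W m \<Longrightarrow> g m q = 0"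
    "\<And>m. m < c \<Longrightarrow> z m \<in> W (Suc m)" "\<And>m. m < c \<Longrightarrow> g m (z m) \<noteq> 0" "\<And>m. m < c \<Longrightarrow> (\<chi> p. z m p) \<noteq> 0"
proof -
  obtain b where b: "L = vec.span (b ` {..w})" using grassmannian_family[OF L] by blast
  obtain J where J: "plucker w b J \<noteq> 0" using L span_family_in_grassmannian[of b w] b by auto
  define y where "y = normal_frame w b J"
  have y: "unit_block w J y" "vec.span (y ` {..w}) = L" unfolding y_def b by (rule normal_frame[OF J])+
  have sub: "vec.subspace L" using L unfolding grassmannian_def by blast
  have "CARD('k) = k + 1" using bij_betw_same_card[OF \<rho>] by simp
  then have "card ((UNIV :: 'k set) \<times> {..w}) = c" unfolding c by (simp add: card_cartesian_product)
  moreover have "finite ((UNIV :: 'k set) \<times> {..w})" by simp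
  ultimately obtain e where e: "bij_betw e {0..<c} ((UNIV :: 'k set) \<times> {..w})" using ex_bij_betw_nat_finite by metis
  define g where "g m q = q (fst (e m), J ! snd (e m))" for m and q :: "'k \<times> 'r \<Rightarrow> 'a"
  define W where "W m = {q. rows_in q L \<and> (\<forall>i. m \<le> i \<and> i < c \<longrightarrow> g i q = 0)}" for m
  define z where "z m = (\<lambda>(a, j). if a = fst (e m) then y (snd (e m)) $ j else 0)" for m
  have gz: "g i (z m) = (if i = m then 1 else 0)" if im: "i < c" "m < c" for i m
  proof -
    have le: "snd (e i) \<le> w" "snd (e m) \<le> w" using bij_betw_apply[OF e, of i] bij_betw_apply[OF e, of m] im by auto
    have "i = m \<longleftrightarrow> e i = e m" using e im unfolding bij_betw_def inj_on_def by auto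
    then show ?thesis using y(1) le unfolding g_def z_def unit_block_def by (auto simp: prod_eq_iff)
  qed
  have rz: "rows_in (z m) L" if "m < c" for m
    unfolding rows_in_def
  proof
    fix a
    have "snd (e m) \<le> w" using bij_betw_apply[OF e, of m] that by auto
    then have "y (snd (e m)) \<in> L" using y(2) vec.span_base[of "y (snd (e m))" "y ` {..w}"] by auto
    moreover have "(\<chi> j. z m (a, j)) = (if a = fst (e m) then y (snd (e m)) else 0)"
      by (auto simp: z_def Finite_Cartesian_Product.vec_eq_iff)
    ultimately show "(\<chi> j. z m (a, j)) \<in> L" using vec.subspace_0[OF sub] by simp
  qed
  show thesis
  proof (rule that[of W g z])
    show "rows_in q L" if "q \<in> W m" for m q using that unfolding W_def by blast
    show "W m \<subseteq> W (Suc m)" for m unfolding W_def by auto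
    show "(\<lambda>v. x v + t * (y v - x v)) \<in> W m" if "x \<in> W m" "y \<in> W m" for m x y t
      using that rows_in_line[OF sub] unfolding W_def g_def by auto
    show "form (g m)" for m unfolding g_def by (rule form_coord)
    show "g m q = 0" if "m < c" "q \<in> W m" for m q using that unfolding W_def by auto
    show "z m \<in> W (Suc m)" if "m < c" for m using rz[OF that] gz[OF _ that] unfolding W_def by auto
    show "g m (z m) \<noteq> 0" if "m < c" for m using gz[OF that that] by simp
    then show "(\<chi> p. z m p) \<noteq> 0" if "m < c" for m
      using that unfolding vec_nonzero_coord g_def by blast
  qed
qed

text \<open>
  The first \<open>c\<close> members of the chain lie in the fibre over one point of \<open>C 0\<close>, the others are the
  preimages of the \<open>C i\<close>.
\<close>

lemma sec_chain:
  assumes C: "chain_in (grass_zariski w) GS C n"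
  shows "\<exists>D. chain_in proj_zariski sec D (n + (k + 1) * (w + 1) - 1)"
proof -
  \<comment> \<open>Here \<open>c\<close> is the projective dimension of a fibre, one less than the
    constant of \<open>linear_flag\<close>.\<close>
  define c where "c = (k + 1) * (w + 1) - 1"
  have Sc: "Suc c = (k + 1) * (w + 1)" unfolding c_def by simp
  have Ci: "\<And>i. i \<le> n \<Longrightarrow> closedin (grass_zariski w) (C i)" "\<And>i. i \<le> n \<Longrightarrow> irreducible_in (grass_zariski w) (C i)"
    "\<And>i. i \<le> n \<Longrightarrow> C i \<subseteq> GS" "\<And>i. i < n \<Longrightarrow> C i \<subset> C (Suc i)" using C unfolding chain_in_def by auto
  obtain L where L: "L \<in> C 0" using Ci(2)[of 0] unfolding irreducible_in_def by auto
  have Lg: "L \<in> grassmannian w" using L Ci(3)[of 0] GS_sub by blast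
  obtain W g z where W: "\<And>m q. q \<in> W m \<Longrightarrow> rows_in (q :: 'k \<times> 'r \<Rightarrow> 'a) L" "\<And>m. W m \<subseteq> W (Suc m)"
    "\<And>m x y t. x \<in> W m \<Longrightarrow> y \<in> W m \<Longrightarrow> (\<lambda>v. x v + t * (y v - x v)) \<in> W m"
    and g: "\<And>m. form (g m)" "\<And>m q. m < Suc c \<Longrightarrow> q \<in> W m \<Longrightarrow> g m q = 0"
    and z: "\<And>m. m < Suc c \<Longrightarrow> z m \<in> W (Suc m)" "\<And>m. m < Suc c \<Longrightarrow> g m (z m) \<noteq> 0" "\<And>m. m < Suc c \<Longrightarrow> (\<chi> p. z m p) \<noteq> 0"
    by (rule linear_flag[OF Lg Sc]) (rule that; assumption)
  \<comment> \<open>The flag begins with \<open>W 1\<close>, as \<open>W 0\<close> is constructed to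
    hold only the zero matrix. It stops at \<open>W c\<close>; the place of the full fibre is taken
    by \<open>rows_proj (C 0)\<close>.\<close>
  define Z where "Z i = (if i < c then proj_of (W (Suc i)) else rows_proj (C (i - c)))" for i
  define D where "D i = proj_zariski closure_of Z i" for i
  have WZ: "proj_of (W m) \<subseteq> rows_proj (C 0)" for m
    unfolding rows_proj_def by (rule proj_of_mono) (use W(1) L in blast)
  have Zsec: "Z i \<subseteq> sec" if "i \<le> n + c" for i
  proof (cases "i < c")
    case True
    then show ?thesis using WZ rows_proj_sec[OF Ci(3)[of 0]] unfolding Z_def by auto
  next
    case False
    then show ?thesis using rows_proj_sec[OF Ci(3)[of "i - c"]] that unfolding Z_def by auto
  qed
  have sp: "vec.span {\<chi> p. z m p} \<in> proj_of (W (Suc m))" if "m < Suc c" for m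
    unfolding proj_of_def using z[OF that] by blast
  have nzg: "\<not> proj.nz (g m) P" if m: "m < Suc c" and P: "P \<in> proj_of (W m)" for m P
  proof -
    obtain q where "q \<in> W m" "(\<chi> p. q p) \<noteq> 0" "P = vec.span {\<chi> p. q p}" by (rule proj_ofE[OF P])
    then show ?thesis using proj_nz_span[OF g(1)[of m], of q] g(2)[OF m] by blast
  qed
  have "chain_in proj_zariski sec D (n + c)"
    unfolding chain_in_def
  proof (intro conjI allI impI)
    fix i assume i: "i \<le> n + c"
    show "closedin proj_zariski (D i)" unfolding D_def by simp
    show "D i \<subseteq> sec" unfolding D_def by (rule closure_of_minimal[OF Zsec[OF i] closedin_sec])
    show "irreducible_in proj_zariski (D i)"
    proof (cases "i < c")
      case True
      then show ?thesis unfolding D_def Z_def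
        using irreducible_proj_of[of "W (Suc i)" "z i"] W(3) z(1,3)[of i] by simp
    next
      case False
      have "i - c \<le> n" using i by simp
      from irreducible_rows_proj[OF Ci(2)[OF this]] show ?thesis unfolding D_def Z_def using False by simp
    qed
  next
    fix i assume i: "i < n + c"
    show "D i \<subset> D (i + 1)"
    proof (cases "i < c")
      case True
      \<comment> \<open>For \<open>i = c - 1\<close> the next set is \<open>rows_proj (C 0)\<close>,
        which still contains the point of the witness \<open>z c\<close>.\<close>
      have "proj_of (W (Suc i)) \<subseteq> Z (Suc i)"
        using WZ proj_of_mono[OF W(2)[of "Suc i"]] True unfolding Z_def by auto
      moreover have "vec.span {\<chi> p. z (Suc i) p} \<in> Z (Suc i)"
        using sp[of "Suc i"] WZ True unfolding Z_def by auto
      moreover have "Z (Suc i) \<subseteq> proj_space" using Zsec[of "Suc i"] sec_sub i by auto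
      moreover have "proj.nz (g (Suc i)) (vec.span {\<chi> p. z (Suc i) p})"
        using proj_nz_span[OF g(1), of "z (Suc i)" "Suc i"] z(2,3)[of "Suc i"] True by simp
      ultimately have "proj_zariski closure_of proj_of (W (Suc i)) \<subset> proj_zariski closure_of Z (Suc i)"
        using proj.closure_strict[of "proj_of (W (Suc i))" "Z (Suc i)" "g (Suc i)"] g(1) nzg True by simp
      then show ?thesis unfolding D_def using True by (simp add: Z_def[of i])
    next
      case False
      then have "Suc i - c = Suc (i - c)" "i - c < n" using i by auto
      then show ?thesis unfolding D_def Z_def
        using rows_proj_strict[OF Ci(1)[of "i - c"] Ci(2)[of "i - c"] Ci(4)[of "i - c"]] Ci(3)[of "Suc (i - c)"] GS_sub False
        by simp
    qed
  qed
  moreover have "n + c = n + (k + 1) * (w + 1) - 1" unfolding c_def by simp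
  ultimately show ?thesis by metis
qed

theorem dim_sec:
  "\<exists>d. krull_dim (subtopology (grass_zariski w) GS) = enat d \<and>
       krull_dim (subtopology proj_zariski sec) = enat (d + (k + 1) * (w + 1) - 1)"
proof -
  obtain J where J: "length J = Suc w" "chart J \<noteq> {}" by (rule chart_nonempty)
  obtain B where B: "B \<subseteq> MV" "\<forall>h\<in>van MV (chart J). polf B h \<longrightarrow> h = (\<lambda>x. 0)" "pgrow (chart J) MV (card B)"
    using transcendence_basis[OF pirr_chart[OF J]] by auto
  define c where "c = (k + 1) * (w + 1)"
  have c: "c > 0" unfolding c_def by simp
  obtain C where C: "chain_in (grass_zariski w) GS C (card B)" using GS_chain_exists[OF J B(1)] B(2) by blast
  obtain D where D: "chain_in proj_zariski sec D (card B + c - 1)" using sec_chain[OF C] unfolding c_def by blast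
  have up: "n \<le> card B + c - 1" if "chain_in proj_zariski sec D n" for D n
    using proj_chain_bound[OF that grow_sec[OF J B(3)]] unfolding c_def .
  \<comment> \<open>The bound for \<open>GS\<close> comes from the bound for \<open>sec\<close>
    applied to the lifted chain; the truncated subtraction cancels because
    \<open>c > 0\<close>.\<close>
  have "n \<le> card B" if ch: "chain_in (grass_zariski w) GS C n" for C n
  proof -
    obtain D where "chain_in proj_zariski sec D (n + c - 1)" using sec_chain[OF ch] unfolding c_def by blast
    then have "n + c - 1 \<le> card B + c - 1" by (rule up)
    then show ?thesis using c by simp
  qed
  then have "krull_dim (subtopology (grass_zariski w) GS) = enat (card B)"
    by (rule krull_dim_eqI[OF closedin_GS C])
  moreover have "krull_dim (subtopology proj_zariski sec) = enat (card B + c - 1)"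
    by (rule krull_dim_eqI[OF closedin_sec D up])
  ultimately show ?thesis unfolding c_def by blast
qed

end

theorem theorem5p1:
  fixes X :: "('a::{alg_closed_field, field_char_0} ^ 'r) set set"
    and k r s w :: nat
  assumes "CARD('k::finite) = k + 1" and "CARD('r) = r + 1"
    and "irreducible_projective_variety X" and "nondegenerate X"
    and "s \<ge> 1" and "s - 1 \<le> r"
    and "w = min k (s - 1)"
  shows "proj_dim (secant_variety s (segre X :: ('a ^ ('k \<times> 'r)) set set)) =
         grass_dim w (grassmann_secant_variety w s X) + enat ((w + 1) * (k + 1)) - 1"
proof -
  \<comment> \<open>The row index type is enumerated because configurations number their rows, so
    that the first \<open>w + 1\<close> rows make sense.\<close>
  obtain \<rho> :: "'k \<Rightarrow> nat" where \<rho>: "bij_betw \<rho> UNIV {0..<CARD('k)}"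
    using ex_bij_betw_finite_nat[of "UNIV :: 'k set"] by auto
  have "{0..<CARD('k)} = {..k}" using assms(1) by auto
  then interpret segre_setup X "s - 1" w \<rho> k
    using assms \<rho> by unfold_locales auto
  have s: "Suc (s - 1) = s" using assms(5) by simp
  have "secant_variety s (segre X :: ('a ^ ('k \<times> 'r)) set set) = sec"
    unfolding secant_variety_def sec_def sec0_def s ..
  moreover have "grassmann_secant_variety w s X = GS"
    unfolding grassmann_secant_variety_def GS_def GS0_def s ..
  moreover obtain d where "grass_dim w GS = enat d" "proj_dim sec = enat (d + (k + 1) * (w + 1) - 1)"
    using dim_sec by blast
  ultimately show ?thesis by (simp add: one_enat_def mult.commute)
qed

end
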